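(* Let $s>0$, $0<s_1<s_2$, $\alpha\in\mathcal{Q}$, $\mathfrak{w}_0\in\mathcal{X}_0^{\mathrm{dpg}}$, $\hat{\mathfrak{w}}\in\hat{\mathcal{X}}^{\mathrm{dpg}}$ and $\mathfrak{w}^{\mathrm{dpg}}=(\mathfrak{w}_0,\hat{\mathfrak{w}})$. Let $\mathfrak{u}^{\mathrm{dpg}}=(\mathfrak{u}_0,\hat{\mathfrak{u}})$ denote the exact solution of the undiscretized ultraweak DPG formulation for the given $\alpha$. Then the following hold. 1. The functional $\hat{\mathcal{L}}_s^{\mathrm{dpg}}$ is variationally correct and satisfies $$(1+k_{s,\alpha})^{-1}\,\|\mathfrak{u}^{\mathrm{dpg}}-\mathfrak{w}^{\mathrm{dpg}}\|_{s,\alpha}^2\;\le\;\hat{\mathcal{L}}_s^{\mathrm{dpg}}(\mathfrak{w}^{\mathrm{dpg}})\;\le\;(1+k_{s,\alpha})\,\|\mathfrak{u}^{\mathrm{dpg}}-\mathfrak{w}^{\mathrm{dpg}}\|_{s,\alpha}^2 .$$ 2. The loss functional is related to the error through the $K$-functional: $$\hat{\mathcal{L}}_s^{\mathrm{dpg}}(\mathfrak{w}^{\mathrm{dpg}})=s^2\|A_\alpha E(\hat{\mathfrak{u}}-\hat{\mathfrak{w}})\|_{L_2}^2+K\big(s,\,(\mathfrak{u}_0-\mathfrak{w}_0)-E(\hat{\mathfrak{u}}-\hat{\mathfrak{w}})\big).$$ 3. The functional $\hat{\mathcal{L}}_{s_1,s_2}^{\mathrm{dpg}}$ is non-negative. 4.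 The interior variable error satisfies $$\hat{\mathcal{L}}_{s_1,s_2}^{\mathrm{dpg},L}(\mathfrak{w}^{\mathrm{dpg}})\;\le\;\|\mathfrak{u}_0-\mathfrak{w}_0\|_{L_2}^2\;\le\;\hat{\mathcal{L}}_{s_1,s_2}^{\mathrm{dpg},R}(\mathfrak{w}^{\mathrm{dpg}}).$$ 5. For all $\alpha$ for which the inequality $\|(r,w)\|_{L_2}\le c_\alpha\|A_\alpha(r,w)\|_{L_2}$ (for all $(r,w)\in H(\mathrm{div})\times\mathring{H}^1$) holds with a fixed $c_\alpha$, as $s_1\to\infty$ (with $s_1<s_2$), both the upper and lower bounds in item 4 converge to the non-negative functional $\hat{\mathcal{L}}_{s_1,s_2}^{\mathrm{dpg}}$: $$\hat{\mathcal{L}}_{s_1,s_2}^{\mathrm{dpg},L}(\mathfrak{w}^{\mathrm{dpg}})\to\hat{\mathcal{L}}_{s_1,s_2}^{\mathrm{dpg}}(\mathfrak{w}^{\mathrm{dpg}}),\qquad \hat{\mathcal{L}}_{s_1,s_2}^{\mathrm{dpg},R}(\mathfrak{w}^{\mathrm{dpg}})\to\hat{\mathcal{L}}_{s_1,s_2}^{\mathrm{dpg}}(\mathfrak{w}^{\mathrm{dpg}}).$$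
   Context: **Domain, parameters, mesh.** $\Omega\subset\mathbb{R}^d$ is a bounded Lipschitz domain, subdivided into finitely many subdomains $\Omega_1,\dots,\Omega_{m_\alpha}$ with indicator functions $\chi_i$. The parameter set is $\mathcal{Q}=\{\underline{\alpha}+\sum_{i=1}^{m_\alpha}\alpha_i\chi_i:\ \alpha_i\ge 0,\ \underline{\alpha}>0\}$. $\Omega_h$ is a conforming shape-regular simplicial finite element mesh of $\Omega$; $n$ denotes outward unit normals on element boundaries. $f\in L_2(\Omega)$ is a given source and $F=(0,f)$. **Function spaces and operators.** $H(\mathrm{div})$ is the space of vector fields in $L_2(\Omega)^d$ with divergence in $L_2(\Omega)$; $\mathring{H}^1=\{v\in H^1(\Omega):v|_{\partial\Omega}=0\}$. $\|\cdot\|_{L_2}$ and $(\cdot,\cdot)_{L_2}$ are the norm and inner product of $L_2(\Omega)$ or its Cartesian products. $A_\alpha(q,u)=(\alpha q+\nabla u,\ \mathrm{div}\,q)$ and $A_\alpha^*(q,u)=(\alpha q-\nabla u,\ -\mathrm{div}\,q)$. For $\alpha\in\mathcal{Q}$, $c_\alpha>0$ denotes a constant (which exists) such that $\|(r,w)\|_{L_2}\le c_\alpha\|A_\alpha(r,w)\|_{L_2}$ for all $(r,w)\in H(\mathrm{div})\times\mathring{H}^1$. **Traces.** $\mathrm{tr}(w)|_{\partial K}=w|_{\partial K}$ for $w\in\mathring{H}^1$ and $\mathrm{tr}_n(r)|_{\partial K}=(r\cdot n)|_{\partial K}$ for $r\in H(\mathrm{div})$, for all $K\in\Omega_h$, with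 values in $\prod_KH^{1/2}(\partial K)$ and $\prod_KH^{-1/2}(\partial K)$. Their ranges are $\mathring{H}^{1/2}(\partial\Omega_h)$ and $H^{-1/2}(\partial\Omega_h)$. **DPG formulation.** $\mathcal{X}_0^{\mathrm{dpg}}=L_2(\Omega)^d\times L_2(\Omega)$ (interior variables), $\hat{\mathcal{X}}^{\mathrm{dpg}}=\mathring{H}^{1/2}(\partial\Omega_h)\times H^{-1/2}(\partial\Omega_h)$ (interface variables), and $\mathcal{X}^{\mathrm{dpg}}=\mathcal{X}_0^{\mathrm{dpg}}\times\hat{\mathcal{X}}^{\mathrm{dpg}}$. The test space is $\mathcal{Y}^{\mathrm{dpg}}=\prod_{K\in\Omega_h}H(\mathrm{div},K)\times\prod_{K\in\Omega_h}H^1(K)$. The bilinear form is $$b_\alpha^{\mathrm{dpg}}((q,u,\hat u,\hat q_n),(\tau,\nu))=\sum_{K\in\Omega_h}\Big(\int_K(q,u)\cdot A_\alpha^*(\tau,\nu)+\langle\tau\cdot n,\hat u\rangle_{\partial K}+\langle\hat q_n,\nu\rangle_{\partial K}\Big),$$ where $\langle\cdot,\cdot\rangle_{\partial K}$ is the duality pairing between $H^{-1/2}(\partial K)$ and $H^{1/2}(\partial K)$ and $A_\alpha^*$ is applied element by element. The exact solution $\mathfrak{u}^{\mathrm{dpg}}=(\mathfrak{u}_0,\hat{\mathfrak{u}})=(q,u,\hat u,\hat q_n)\in\mathcal{X}^{\mathrm{dpg}}$ is the unique solution of $b_\alpha^{\mathrm{dpg}}(\mathfrak{u}^{\mathrm{dpg}},(\tau,\nu))=(f,\nu)_{L_2}$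 for all $(\tau,\nu)\in\mathcal{Y}^{\mathrm{dpg}}$. Here $\mathfrak{u}_0=(q,u)\in H(\mathrm{div})\times\mathring{H}^1$ solves $\alpha q+\nabla u=0$, $\mathrm{div}\,q=f$ in $\Omega$, and $\hat{\mathfrak{u}}=(\mathrm{tr}(u),\mathrm{tr}_n(q))$. **Scaled test norm and loss.** For $s>0$, $\mathcal{Y}^{\mathrm{dpg}}$ is endowed with $$\|(\tau,\nu)\|_{\mathcal{Y},s}^2=\sum_{K\in\Omega_h}\big(\|A_\alpha^*(\tau,\nu)\|_{L_2(K)}^2+s^{-2}\|(\tau,\nu)\|_{L_2(K)}^2\big)$$ and the corresponding inner product $(\cdot,\cdot)_{\mathcal{Y},s}$. For $\mathfrak{w}\in\mathcal{X}^{\mathrm{dpg}}$, let $\varepsilon_s^{\mathfrak{w}}\in\mathcal{Y}^{\mathrm{dpg}}$ solve $(\varepsilon_s^{\mathfrak{w}},\mathfrak{v})_{\mathcal{Y},s}=(F,\mathfrak{v})_{L_2}-b_\alpha^{\mathrm{dpg}}(\mathfrak{w},\mathfrak{v})$ for all $\mathfrak{v}\in\mathcal{Y}^{\mathrm{dpg}}$, and set $\hat{\mathcal{L}}_s^{\mathrm{dpg}}(\mathfrak{w})=\|\varepsilon_s^{\mathfrak{w}}\|_{\mathcal{Y},s}^2$. **Variational correctness.** A loss functional is variationally correct if it is bounded above and below by positive constants, independent of its argument, times the square of the norm of the error between its argument and the exact solution. In item 1 the norm is $\|\cdot\|_{s,\alpha}$ and the constants are the displayed ones. **Extension, norm and $K$-functional.**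 For $\hat{\mathfrak{w}}\in\hat{\mathcal{X}}^{\mathrm{dpg}}$ let $Z(\hat{\mathfrak{w}})=\{(r,w)\in H(\mathrm{div})\times\mathring{H}^1:(\mathrm{tr}\,w,\mathrm{tr}_n r)=\hat{\mathfrak{w}}\}$ and let $E\hat{\mathfrak{w}}=\arg\min_{(r,w)\in Z(\hat{\mathfrak{w}})}\|A_\alpha(r,w)\|_{L_2}$. Define $$\|(\mathfrak{w}_0,\hat{\mathfrak{w}})\|_{s,\alpha}^2=\|\mathfrak{w}_0\|_{L_2}^2+s^2\|A_\alpha E\hat{\mathfrak{w}}\|_{L_2}^2,$$ $$K(s,\mathfrak{w}_0)=\inf_{\mathfrak{z}\in Z(0)}\big(\|\mathfrak{w}_0-\mathfrak{z}\|_{L_2}^2+s^2\|A_\alpha\mathfrak{z}\|_{L_2}^2\big),\qquad \mathfrak{w}_0\in\mathcal{X}_0^{\mathrm{dpg}}.$$ **Constants and two-parameter functionals.** $$k_{s,\alpha}=\frac12\left(\frac{c_\alpha^2}{s^2}+\sqrt{\frac{c_\alpha^4}{s^4}+4\frac{c_\alpha^2}{s^2}}\right),\qquad \hat{\mathcal{L}}_{s_1,s_2}^{\mathrm{dpg}}(\mathfrak{w})=\frac{s_2^2\hat{\mathcal{L}}_{s_1}^{\mathrm{dpg}}(\mathfrak{w})-s_1^2\hat{\mathcal{L}}_{s_2}^{\mathrm{dpg}}(\mathfrak{w})}{s_2^2-s_1^2},$$ $$\hat{\mathcal{L}}_{s_1,s_2}^{\mathrm{dpg},L}(\mathfrak{w})=\frac{(1+k_{s_1,\alpha})^{-1}s_2^2\hat{\mathcal{L}}_{s_1}^{\mathrm{dpg}}(\mathfrak{w})-(1+k_{s_2,\alpha})s_1^2\hat{\mathcal{L}}_{s_2}^{\mathrm{dpg}}(\mathfrak{w})}{s_2^2-s_1^2},$$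 $$\hat{\mathcal{L}}_{s_1,s_2}^{\mathrm{dpg},R}(\mathfrak{w})=\frac{(1+k_{s_1,\alpha})s_2^2\hat{\mathcal{L}}_{s_1}^{\mathrm{dpg}}(\mathfrak{w})-(1+k_{s_2,\alpha})^{-1}s_1^2\hat{\mathcal{L}}_{s_2}^{\mathrm{dpg}}(\mathfrak{w})}{s_2^2-s_1^2}.$$
   Formalization: Item 5 fails if the interface error is nonzero (the gaps grow like s_1). Proved instead: the gaps vanish relative to s_2^2 L_{s_1}/(s_2^2-s_1^2), uniformly; and absolutely when the interface component is exact and s_1(1-(s_1/s_2)^2) tends to infinity. *)

theory Defs
  imports "HOL-Analysis.Analysis"
begin

section \<open>Domain, parameters, mesh\<close>

definition lipschitz_domain :: "(real ^ 'd) set \<Rightarrow> bool" where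
  "lipschitz_domain \<Omega> \<longleftrightarrow>
     \<Omega> \<noteq> {} \<and> open \<Omega> \<and> connected \<Omega> \<and> bounded \<Omega> \<and>
     (\<forall>x \<in> frontier \<Omega>. \<exists>r > 0. \<exists>e L g. norm e = 1 \<and> L-lipschitz_on {z. z \<bullet> e = 0} g \<and>
        (\<forall>y \<in> ball x r. y \<in> \<Omega> \<longleftrightarrow> g (y - (y \<bullet> e) *\<^sub>R e) < y \<bullet> e))"

definition subdivision :: "(real ^ 'd) set \<Rightarrow> nat \<Rightarrow> (nat \<Rightarrow> (real ^ 'd) set) \<Rightarrow> bool" where
  "subdivision \<Omega> m Sub \<longleftrightarrow>
     (\<forall>i \<in> {1..m}. Sub i \<noteq> {} \<and> open (Sub i) \<and> connected (Sub i) \<and> Sub i \<subseteq> \<Omega>) \<and>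
     disjoint_family_on Sub {1..m} \<and>
     (\<Union>i \<in> {1..m}. closure (Sub i)) = closure \<Omega>"

definition params :: "nat \<Rightarrow> (nat \<Rightarrow> (real ^ 'd) set) \<Rightarrow> (real ^ 'd \<Rightarrow> real) set" where
  "params m Sub = {\<lambda>x. a0 + (\<Sum>i = 1..m. a i * indicator (Sub i) x) | a0 a.
     0 < a0 \<and> (\<forall>i \<in> {1..m}. 0 \<le> a i)}"

text \<open>Mesh elements are the open simplices; conformity is \<^const>\<open>triangulation\<close> of their closures.\<close>

definition conforming_mesh :: "(real ^ 'd) set \<Rightarrow> (real ^ 'd) set set \<Rightarrow> bool" where
  "conforming_mesh \<Omega> M \<longleftrightarrow>
     finite M \<and>
     (\<forall>K \<in> M. int CARD('d) simplex closure K \<and> K = interior (closure K) \<and> K \<subseteq> \<Omega>) \<and>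
     triangulation (closure ` M) \<and>
     (\<Union>K \<in> M. closure K) = closure \<Omega>"

definition shape_regular :: "real \<Rightarrow> (real ^ 'd) set set \<Rightarrow> bool" where
  "shape_regular \<sigma> M \<longleftrightarrow> (\<forall>K \<in> M. \<exists>x r. 0 < r \<and> ball x r \<subseteq> K \<and> diameter K \<le> \<sigma> * r)"


section \<open>Lebesgue and Sobolev spaces\<close>

text \<open>
  Elements of Lebesgue spaces are represented by functions on the whole space of which only the
  values almost everywhere on the set in question matter.  A pair of a vector field and a scalar
  field is a function with values in the Euclidean space \<open>(real ^ 'd) \<times> real\<close>.
\<close>

type_synonym 'd field = "real ^ 'd \<Rightarrow> (real ^ 'd) \<times> real"

definition L2 :: "(real ^ 'd) set \<Rightarrow> (real ^ 'd \<Rightarrow> 'b::euclidean_space) set" where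
  "L2 U = {f. f \<in> borel_measurable (lebesgue_on U) \<and>
              integrable (lebesgue_on U) (\<lambda>x. (norm (f x))\<^sup>2)}"

definition L2_ip :: "(real ^ 'd) set \<Rightarrow> (real ^ 'd \<Rightarrow> 'b::euclidean_space) \<Rightarrow> (real ^ 'd \<Rightarrow> 'b) \<Rightarrow> real" where
  "L2_ip U f g = (LINT x | lebesgue_on U. f x \<bullet> g x)"

definition L2_norm :: "(real ^ 'd) set \<Rightarrow> (real ^ 'd \<Rightarrow> 'b::euclidean_space) \<Rightarrow> real" where
  "L2_norm U f = sqrt (L2_ip U f f)"

text \<open>\<open>D [i\<^sub>1, \<dots>, i\<^sub>k]\<close> are the iterated partial derivatives of \<open>\<phi>\<close>.\<close>

definition smooth :: "(real ^ 'd \<Rightarrow> real) \<Rightarrow> bool" where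
  "smooth \<phi> \<longleftrightarrow> (\<exists>D :: 'd list \<Rightarrow> real ^ 'd \<Rightarrow> real. D [] = \<phi> \<and>
     (\<forall>is x. (D is has_derivative (\<lambda>h. \<Sum>i \<in> UNIV. D (i # is) x * h $ i)) (at x)))"

definition grad :: "(real ^ 'd \<Rightarrow> real) \<Rightarrow> real ^ 'd \<Rightarrow> real ^ 'd" where
  "grad \<phi> x = (\<chi> i. frechet_derivative \<phi> (at x) (axis i 1))"

definition test_functions :: "(real ^ 'd) set \<Rightarrow> (real ^ 'd \<Rightarrow> real) set" where
  "test_functions U =
     {\<phi>. smooth \<phi> \<and> compact (closure {x. \<phi> x \<noteq> 0}) \<and> closure {x. \<phi> x \<noteq> 0} \<subseteq> U}"

definition has_weak_grad :: "(real ^ 'd) set \<Rightarrow> (real ^ 'd \<Rightarrow> real) \<Rightarrow> (real ^ 'd \<Rightarrow> real ^ 'd) \<Rightarrow> bool" where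
  "has_weak_grad U v g \<longleftrightarrow> g \<in> L2 U \<and>
     (\<forall>\<phi> \<in> test_functions U.
        (LINT x | lebesgue_on U. v x *\<^sub>R grad \<phi> x) = - (LINT x | lebesgue_on U. \<phi> x *\<^sub>R g x))"

definition has_weak_div :: "(real ^ 'd) set \<Rightarrow> (real ^ 'd \<Rightarrow> real ^ 'd) \<Rightarrow> (real ^ 'd \<Rightarrow> real) \<Rightarrow> bool" where
  "has_weak_div U q g \<longleftrightarrow> g \<in> L2 U \<and>
     (\<forall>\<phi> \<in> test_functions U.
        (LINT x | lebesgue_on U. q x \<bullet> grad \<phi> x) = - (LINT x | lebesgue_on U. \<phi> x * g x))"

definition weak_grad :: "(real ^ 'd) set \<Rightarrow> (real ^ 'd \<Rightarrow> real) \<Rightarrow> real ^ 'd \<Rightarrow> real ^ 'd" where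
  "weak_grad U v = (SOME g. has_weak_grad U v g)"

definition weak_div :: "(real ^ 'd) set \<Rightarrow> (real ^ 'd \<Rightarrow> real ^ 'd) \<Rightarrow> real ^ 'd \<Rightarrow> real" where
  "weak_div U q = (SOME g. has_weak_div U q g)"

definition H1 :: "(real ^ 'd) set \<Rightarrow> (real ^ 'd \<Rightarrow> real) set" where
  "H1 U = {v \<in> L2 U. \<exists>g. has_weak_grad U v g}"

definition H1_norm :: "(real ^ 'd) set \<Rightarrow> (real ^ 'd \<Rightarrow> real) \<Rightarrow> real" where
  "H1_norm U v = sqrt ((L2_norm U v)\<^sup>2 + (L2_norm U (weak_grad U v))\<^sup>2)"

definition Hdiv :: "(real ^ 'd) set \<Rightarrow> (real ^ 'd \<Rightarrow> real ^ 'd) set" where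
  "Hdiv U = {q \<in> L2 U. \<exists>g. has_weak_div U q g}"


section \<open>Traces\<close>

text \<open>
  The boundary restriction of functions that are smooth up to the boundary is extended to \<open>H1 U\<close>
  by continuity: two functions have the same trace iff their difference is an \<open>H1\<close>-limit of smooth
  functions that vanish pointwise on the boundary.  The trace of a function is its class modulo
  this relation, so that \<open>H\<^sup>1\<^sup>/\<^sup>2(\<partial>U)\<close> is the quotient of \<open>H1 U\<close> by the functions with zero boundary
  values.  The sets below are used for bounded Lipschitz \<open>U\<close> only.
\<close>

definition zero_boundary_values :: "(real ^ 'd) set \<Rightarrow> (real ^ 'd \<Rightarrow> real) set" where
  "zero_boundary_values U = {v \<in> H1 U. \<forall>e > 0. \<exists>\<phi>. smooth \<phi> \<and> \<phi> \<in> H1 U \<and>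
     (\<forall>x \<in> frontier U. \<phi> x = 0) \<and> H1_norm U (v - \<phi>) < e}"

type_synonym 'd trace = "(real ^ 'd \<Rightarrow> real) set"

definition trace :: "(real ^ 'd) set \<Rightarrow> (real ^ 'd \<Rightarrow> real) \<Rightarrow> 'd trace" where
  "trace U v = {w \<in> H1 U. w - v \<in> zero_boundary_values U}"

definition Hhalf :: "(real ^ 'd) set \<Rightarrow> 'd trace set" where
  "Hhalf U = trace U ` H1 U"

definition H10 :: "(real ^ 'd) set \<Rightarrow> (real ^ 'd \<Rightarrow> real) set" where
  "H10 U = {v \<in> H1 U. trace U v = trace U (\<lambda>x. 0)}"

text \<open>
  The normal trace of \<open>r\<close> is the functional on \<open>H\<^sup>1\<^sup>/\<^sup>2(\<partial>U)\<close> given by Green's formula, evaluated with an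
  arbitrary \<open>H1\<close>-extension of the argument.  The duality pairing between \<open>H\<^sup>-\<^sup>1\<^sup>/\<^sup>2(\<partial>U)\<close> and
  \<open>H\<^sup>1\<^sup>/\<^sup>2(\<partial>U)\<close> is function application.
\<close>

type_synonym 'd flux = "'d trace \<Rightarrow> real"

definition normal_trace :: "(real ^ 'd) set \<Rightarrow> (real ^ 'd \<Rightarrow> real ^ 'd) \<Rightarrow> 'd flux" where
  "normal_trace U r = (\<lambda>g \<in> Hhalf U.
     let v = (SOME v. v \<in> g) in L2_ip U r (weak_grad U v) + L2_ip U (weak_div U r) v)"

text \<open>Products over the mesh are extensional functions of the mesh element.\<close>

type_synonym 'd interface = "((real ^ 'd) set \<Rightarrow> 'd trace) \<times> ((real ^ 'd) set \<Rightarrow> 'd flux)"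

definition tr :: "(real ^ 'd) set set \<Rightarrow> (real ^ 'd \<Rightarrow> real) \<Rightarrow> (real ^ 'd) set \<Rightarrow> 'd trace" where
  "tr M w = (\<lambda>K \<in> M. trace K w)"

definition tr_n :: "(real ^ 'd) set set \<Rightarrow> (real ^ 'd \<Rightarrow> real ^ 'd) \<Rightarrow> (real ^ 'd) set \<Rightarrow> 'd flux" where
  "tr_n M r = (\<lambda>K \<in> M. normal_trace K r)"

definition Xhat :: "(real ^ 'd) set \<Rightarrow> (real ^ 'd) set set \<Rightarrow> 'd interface set" where
  "Xhat \<Omega> M = tr M ` H10 \<Omega> \<times> tr_n M ` Hdiv \<Omega>"

definition hat_zero :: "(real ^ 'd) set set \<Rightarrow> 'd interface" where
  "hat_zero M = (\<lambda>K \<in> M. trace K (\<lambda>x. 0), \<lambda>K \<in> M. \<lambda>g \<in> Hhalf K. 0)"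

definition hat_diff :: "(real ^ 'd) set set \<Rightarrow> 'd interface \<Rightarrow> 'd interface \<Rightarrow> 'd interface" where
  "hat_diff M a b =
     (\<lambda>K \<in> M. {v - w | v w. v \<in> fst a K \<and> w \<in> fst b K},
      \<lambda>K \<in> M. \<lambda>g \<in> Hhalf K. snd a K g - snd b K g)"


section \<open>Operators and the ultraweak DPG formulation\<close>

definition A_op :: "(real ^ 'd) set \<Rightarrow> (real ^ 'd \<Rightarrow> real) \<Rightarrow> 'd field \<Rightarrow> 'd field" where
  "A_op U \<alpha> z = (\<lambda>x. (\<alpha> x *\<^sub>R fst (z x) + weak_grad U (snd \<circ> z) x, weak_div U (fst \<circ> z) x))"

definition A_adj :: "(real ^ 'd) set \<Rightarrow> (real ^ 'd \<Rightarrow> real) \<Rightarrow> 'd field \<Rightarrow> 'd field" where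
  "A_adj U \<alpha> z = (\<lambda>x. (\<alpha> x *\<^sub>R fst (z x) - weak_grad U (snd \<circ> z) x, - weak_div U (fst \<circ> z) x))"

definition Hdiv_H10 :: "(real ^ 'd) set \<Rightarrow> 'd field set" where
  "Hdiv_H10 \<Omega> = {z. fst \<circ> z \<in> Hdiv \<Omega> \<and> snd \<circ> z \<in> H10 \<Omega>}"

definition stability_constant :: "(real ^ 'd) set \<Rightarrow> (real ^ 'd \<Rightarrow> real) \<Rightarrow> real \<Rightarrow> bool" where
  "stability_constant \<Omega> \<alpha> c \<longleftrightarrow>
     0 < c \<and> (\<forall>z \<in> Hdiv_H10 \<Omega>. L2_norm \<Omega> z \<le> c * L2_norm \<Omega> (A_op \<Omega> \<alpha> z))"

type_synonym 'd dpg = "'d field \<times> 'd interface"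

definition X_dpg :: "(real ^ 'd) set \<Rightarrow> (real ^ 'd) set set \<Rightarrow> 'd dpg set" where
  "X_dpg \<Omega> M = L2 \<Omega> \<times> Xhat \<Omega> M"

definition X_diff :: "(real ^ 'd) set set \<Rightarrow> 'd dpg \<Rightarrow> 'd dpg \<Rightarrow> 'd dpg" where
  "X_diff M u w = (fst u - fst w, hat_diff M (snd u) (snd w))"

text \<open>Since the elements are disjoint, a broken function is a single piecewise defined function.\<close>

definition Y_dpg :: "(real ^ 'd) set set \<Rightarrow> 'd field set" where
  "Y_dpg M = {y. \<forall>K \<in> M. fst \<circ> y \<in> Hdiv K \<and> snd \<circ> y \<in> H1 K}"

definition b_dpg :: "(real ^ 'd) set set \<Rightarrow> (real ^ 'd \<Rightarrow> real) \<Rightarrow> 'd dpg \<Rightarrow> 'd field \<Rightarrow> real" where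
  "b_dpg M \<alpha> w y = (case w of (w0, uhat, qhat) \<Rightarrow>
     \<Sum>K \<in> M. L2_ip K w0 (A_adj K \<alpha> y)
           + normal_trace K (fst \<circ> y) (uhat K)
           + qhat K (trace K (snd \<circ> y)))"

definition exact_dpg_solution ::
  "(real ^ 'd) set \<Rightarrow> (real ^ 'd) set set \<Rightarrow> (real ^ 'd \<Rightarrow> real) \<Rightarrow> (real ^ 'd \<Rightarrow> real) \<Rightarrow> 'd dpg \<Rightarrow> bool" where
  "exact_dpg_solution \<Omega> M \<alpha> f u \<longleftrightarrow>
     u \<in> X_dpg \<Omega> M \<and> (\<forall>y \<in> Y_dpg M. b_dpg M \<alpha> u y = L2_ip \<Omega> f (snd \<circ> y))"


section \<open>Loss functionals\<close>

definition Y_ip :: "(real ^ 'd) set set \<Rightarrow> (real ^ 'd \<Rightarrow> real) \<Rightarrow> real \<Rightarrow> 'd field \<Rightarrow> 'd field \<Rightarrow> real" where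
  "Y_ip M \<alpha> s y z = (\<Sum>K \<in> M. L2_ip K (A_adj K \<alpha> y) (A_adj K \<alpha> z) + L2_ip K y z / s\<^sup>2)"

definition Y_norm :: "(real ^ 'd) set set \<Rightarrow> (real ^ 'd \<Rightarrow> real) \<Rightarrow> real \<Rightarrow> 'd field \<Rightarrow> real" where
  "Y_norm M \<alpha> s y = sqrt (Y_ip M \<alpha> s y y)"

definition error_rep :: "(real ^ 'd) set \<Rightarrow> (real ^ 'd) set set \<Rightarrow> (real ^ 'd \<Rightarrow> real) \<Rightarrow> (real ^ 'd \<Rightarrow> real)
    \<Rightarrow> real \<Rightarrow> 'd dpg \<Rightarrow> 'd field" where
  "error_rep \<Omega> M \<alpha> f s w = (SOME \<epsilon>. \<epsilon> \<in> Y_dpg M \<and>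
     (\<forall>y \<in> Y_dpg M. Y_ip M \<alpha> s \<epsilon> y = L2_ip \<Omega> (\<lambda>x. (0, f x)) y - b_dpg M \<alpha> w y))"

definition loss :: "(real ^ 'd) set \<Rightarrow> (real ^ 'd) set set \<Rightarrow> (real ^ 'd \<Rightarrow> real) \<Rightarrow> (real ^ 'd \<Rightarrow> real)
    \<Rightarrow> real \<Rightarrow> 'd dpg \<Rightarrow> real" where
  "loss \<Omega> M \<alpha> f s w = (Y_norm M \<alpha> s (error_rep \<Omega> M \<alpha> f s w))\<^sup>2"

definition kconst :: "real \<Rightarrow> real \<Rightarrow> real" where
  "kconst c s = 1/2 * (c^2 / s^2 + sqrt (c^4 / s^4 + 4 * (c^2 / s^2)))"

definition loss2 :: "(real ^ 'd) set \<Rightarrow> (real ^ 'd) set set \<Rightarrow> (real ^ 'd \<Rightarrow> real) \<Rightarrow> (real ^ 'd \<Rightarrow> real)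
    \<Rightarrow> real \<Rightarrow> real \<Rightarrow> 'd dpg \<Rightarrow> real" where
  "loss2 \<Omega> M \<alpha> f s1 s2 w =
     (s2\<^sup>2 * loss \<Omega> M \<alpha> f s1 w - s1\<^sup>2 * loss \<Omega> M \<alpha> f s2 w) / (s2\<^sup>2 - s1\<^sup>2)"

definition loss2_L :: "(real ^ 'd) set \<Rightarrow> (real ^ 'd) set set \<Rightarrow> (real ^ 'd \<Rightarrow> real) \<Rightarrow> real
    \<Rightarrow> (real ^ 'd \<Rightarrow> real) \<Rightarrow> real \<Rightarrow> real \<Rightarrow> 'd dpg \<Rightarrow> real" where
  "loss2_L \<Omega> M \<alpha> c f s1 s2 w =
     (inverse (1 + kconst c s1) * s2\<^sup>2 * loss \<Omega> M \<alpha> f s1 w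
       - (1 + kconst c s2) * s1\<^sup>2 * loss \<Omega> M \<alpha> f s2 w) / (s2\<^sup>2 - s1\<^sup>2)"

definition loss2_R :: "(real ^ 'd) set \<Rightarrow> (real ^ 'd) set set \<Rightarrow> (real ^ 'd \<Rightarrow> real) \<Rightarrow> real
    \<Rightarrow> (real ^ 'd \<Rightarrow> real) \<Rightarrow> real \<Rightarrow> real \<Rightarrow> 'd dpg \<Rightarrow> real" where
  "loss2_R \<Omega> M \<alpha> c f s1 s2 w =
     ((1 + kconst c s1) * s2\<^sup>2 * loss \<Omega> M \<alpha> f s1 w
       - inverse (1 + kconst c s2) * s1\<^sup>2 * loss \<Omega> M \<alpha> f s2 w) / (s2\<^sup>2 - s1\<^sup>2)"

text \<open>
  The leading (positive) term of \<^const>\<open>loss2\<close>.  For fixed \<open>w\<close> with interface error \<open>e \<noteq> 0\<close> the loss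
  grows like \<open>s\<^sup>2\<close> while \<open>kconst c s\<close> decays only like \<open>c / s\<close>, so \<open>loss2_R - loss2\<close> is at least
  \<open>kconst c s1 * s1\<^sup>2 * \<parallel>A_op (E e)\<parallel>\<^sup>2\<close> and grows like \<open>s1\<close>.  What tends to zero is the difference
  measured relative to the terms from which the functionals are formed.
\<close>

definition loss2_scale :: "(real ^ 'd) set \<Rightarrow> (real ^ 'd) set set \<Rightarrow> (real ^ 'd \<Rightarrow> real) \<Rightarrow> (real ^ 'd \<Rightarrow> real)
    \<Rightarrow> real \<Rightarrow> real \<Rightarrow> 'd dpg \<Rightarrow> real" where
  "loss2_scale \<Omega> M \<alpha> f s1 s2 w = s2\<^sup>2 * loss \<Omega> M \<alpha> f s1 w / (s2\<^sup>2 - s1\<^sup>2)"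


section \<open>Minimal extension, energy norm, K-functional, variational correctness\<close>

definition Z_set :: "(real ^ 'd) set \<Rightarrow> (real ^ 'd) set set \<Rightarrow> 'd interface \<Rightarrow> 'd field set" where
  "Z_set \<Omega> M what = {z \<in> Hdiv_H10 \<Omega>. (tr M (snd \<circ> z), tr_n M (fst \<circ> z)) = what}"

definition E_ext :: "(real ^ 'd) set \<Rightarrow> (real ^ 'd) set set \<Rightarrow> (real ^ 'd \<Rightarrow> real) \<Rightarrow> 'd interface \<Rightarrow> 'd field" where
  "E_ext \<Omega> M \<alpha> what = arg_min (\<lambda>z. L2_norm \<Omega> (A_op \<Omega> \<alpha> z)) (\<lambda>z. z \<in> Z_set \<Omega> M what)"

definition dpg_norm :: "(real ^ 'd) set \<Rightarrow> (real ^ 'd) set set \<Rightarrow> (real ^ 'd \<Rightarrow> real) \<Rightarrow> real \<Rightarrow> 'd dpg \<Rightarrow> real" where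
  "dpg_norm \<Omega> M \<alpha> s w =
     sqrt ((L2_norm \<Omega> (fst w))\<^sup>2 + s\<^sup>2 * (L2_norm \<Omega> (A_op \<Omega> \<alpha> (E_ext \<Omega> M \<alpha> (snd w))))\<^sup>2)"

definition K_fun :: "(real ^ 'd) set \<Rightarrow> (real ^ 'd) set set \<Rightarrow> (real ^ 'd \<Rightarrow> real) \<Rightarrow> real \<Rightarrow> 'd field \<Rightarrow> real" where
  "K_fun \<Omega> M \<alpha> s w0 = (INF z \<in> Z_set \<Omega> M (hat_zero M).
     (L2_norm \<Omega> (w0 - z))\<^sup>2 + s\<^sup>2 * (L2_norm \<Omega> (A_op \<Omega> \<alpha> z))\<^sup>2)"

definition variationally_correct :: "'x set \<Rightarrow> ('x \<Rightarrow> real) \<Rightarrow> ('x \<Rightarrow> real) \<Rightarrow> bool" where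
  "variationally_correct X err \<L> \<longleftrightarrow>
     (\<exists>c1 > 0. \<exists>c2 > 0. \<forall>w \<in> X. c1 * (err w)\<^sup>2 \<le> \<L> w \<and> \<L> w \<le> c2 * (err w)\<^sup>2)"

end

theory Submission
  imports Defs
begin

text \<open>
  Write \<open>W\<close> for the union of the open mesh elements, \<open>e0 = u0 - w0\<close> for the interior error and call a pair in
  \<open>H(div) \<times> H1\<close> with zero boundary values an extension of the interface error if it has the interface
  error as its traces.  Green's formula turns the interface terms of the bilinear form into volume terms, so
  for every extension \<open>z\<close> the residual, tested with \<open>y\<close>, equals

    \<open>(e0 - z, A_adj y) + (A_op z, y)\<close>.

  The loss is the squared norm of this functional in the dual of the test space with norm
  \<open>\<parallel>A_adj y\<parallel>\<^sup>2 + s\<^sup>-\<^sup>2 \<parallel>y\<parallel>\<^sup>2\<close>.  Hence it is at most \<open>\<parallel>e0 - z\<parallel>\<^sup>2 + s\<^sup>2 \<parallel>A_op z\<parallel>\<^sup>2\<close>.  Equality holds for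
  one \<open>z\<close>: if \<open>\<epsilon>\<close> is the Riesz representer of the residual, then \<open>p = e0 - z - A_adj \<epsilon>\<close> and
  \<open>g = s\<^sup>-\<^sup>2 \<epsilon> - A_op z\<close> satisfy \<open>(p, A_adj y) = (g, y)\<close> for all broken \<open>y\<close>, and \<open>broken_adjoint\<close> says that
  such a \<open>p\<close> has zero interface values and \<open>A_op p = g\<close>; so \<open>z + p\<close> is the optimal extension.  Therefore
  (\<open>loss_least_squares\<close>)

    \<open>loss s = min { \<parallel>e0 - z\<parallel>\<^sup>2 + s\<^sup>2 \<parallel>A_op z\<parallel>\<^sup>2 | z extends the interface error }\<close>.

  The rest is elementary.  The minimal extension \<open>E\<close> has \<open>A_op E\<close> orthogonal to \<open>A_op k\<close> for all \<open>k\<close> with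
  zero interface values, which splits off the \<open>K\<close>-functional.  Young's inequality with parameter
  \<open>k = kconst c s\<close> and the stability estimate give the two-sided bound; \<open>k\<close> is the parameter that balances
  both terms.  A linear combination of the bounds for \<open>s1\<close> and \<open>s2\<close> eliminates \<open>\<parallel>A_op E\<parallel>\<^sup>2\<close>.  The dual norm
  divided by \<open>s\<^sup>2\<close> decreases in \<open>s\<close>, so the two-parameter functional is non-negative, and it differs from its
  lower and upper variants by at most \<open>2 kconst c s1\<close> times its leading term.

  The analytic core is a description of zero boundary values by Green's formula.  A function \<open>v\<close> in \<open>H1\<close>
  of a bounded open set has zero boundary values iff \<open>(r, grad v) + (div r, v) = 0\<close> for all \<open>r\<close> in \<open>H(div)\<close>
  (\<open>zero_boundary_values_iff_green\<close>).  One direction is a truncation argument for smooth functions that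
  vanish on the boundary.  The other uses the orthogonal projection of \<open>v\<close> onto the functions with zero
  boundary values: the remainder \<open>w\<close> satisfies \<open>div (grad w) = w\<close>, and Green's formula for \<open>w\<close> and
  \<open>grad w\<close> shows \<open>w = 0\<close>.  With this description the zero interface values of \<open>broken_adjoint\<close> are what the
  test functions supported on single elements express.  Completeness (\<open>L2_complete\<close>), uniqueness of weak
  derivatives (\<open>fundamental_lemma\<close>) and \<open>Riesz_representation\<close> supply the Hilbert space background.
\<close>

section \<open>Riesz representation in semi-inner product spaces of functions\<close>

text \<open>
  Linear combinations are formed pointwise by one operation, so that a single linearity rule per form covers
  sums, differences and multiples.
\<close>

definition comb :: "real \<Rightarrow> ('x \<Rightarrow> 'b::real_vector) \<Rightarrow> real \<Rightarrow> ('x \<Rightarrow> 'b) \<Rightarrow> 'x \<Rightarrow> 'b" where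
  "comb a u b v = (\<lambda>x. a *\<^sub>R u x + b *\<^sub>R v x)"

lemma diff_eq_comb: "u - v = comb 1 u (-1) v"
  by (auto simp: comb_def fun_eq_iff)

text \<open>
  The forms are only semi-definite, because functions that agree almost everywhere are not identified.
\<close>

locale semi_inner =
  fixes V :: "('x \<Rightarrow> 'b::real_vector) set" and B :: "('x \<Rightarrow> 'b) \<Rightarrow> ('x \<Rightarrow> 'b) \<Rightarrow> real"
  assumes comb_closed: "u \<in> V \<Longrightarrow> v \<in> V \<Longrightarrow> comb a u b v \<in> V"
    and comb_left: "u \<in> V \<Longrightarrow> v \<in> V \<Longrightarrow> w \<in> V \<Longrightarrow> B (comb a u b v) w = a * B u w + b * B v w"
    and sym: "u \<in> V \<Longrightarrow> v \<in> V \<Longrightarrow> B u v = B v u"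
    and nonneg: "u \<in> V \<Longrightarrow> 0 \<le> B u u"
begin

lemma comb_right: "u \<in> V \<Longrightarrow> v \<in> V \<Longrightarrow> w \<in> V \<Longrightarrow> B w (comb a u b v) = a * B w u + b * B w v"
  using comb_left comb_closed sym by metis

lemma comb_square:
  assumes "u \<in> V" "v \<in> V"
  shows "B (comb a u b v) (comb a u b v) = a\<^sup>2 * B u u + 2 * a * b * B u v + b\<^sup>2 * B v v"
  using assms comb_closed[OF assms] sym[OF assms]
  by (simp add: comb_left comb_right power2_eq_square algebra_simps)

text \<open>
  The discriminant of a non-negative quadratic form.
\<close>

lemma Cauchy_Schwarz:
  assumes "u \<in> V" "v \<in> V"
  shows "(B u v)\<^sup>2 \<le> B u u * B v v"
proof -
  have q: "0 \<le> a\<^sup>2 * B u u + 2 * a * b * B u v + b\<^sup>2 * B v v" for a b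
    using comb_square[OF assms] nonneg[OF comb_closed[OF assms]] by metis
  show ?thesis
  proof (cases "B v v = 0")
    case True
    have "B u v = 0"
    proof (rule ccontr)
      assume ne: "B u v \<noteq> 0"
      have "0 \<le> B u u + 2 * (- (B u u + 1) / (2 * B u v)) * B u v"
        using q[of 1 "- (B u u + 1) / (2 * B u v)"] True by simp
      then show False using ne by (simp add: field_simps)
    qed
    then show ?thesis using True by simp
  next
    case False
    then have pos: "B v v > 0" using nonneg[OF assms(2)] by simp
    have "0 \<le> (B v v)\<^sup>2 * B u u + 2 * B v v * (- B u v) * B u v + (- B u v)\<^sup>2 * B v v"
      by (rule q)
    also have "\<dots> = B v v * (B u u * B v v - (B u v)\<^sup>2)"
      by (simp add: power2_eq_square algebra_simps)
    finally show ?thesis using pos by (simp add: zero_le_mult_iff)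
  qed
qed

lemma Cauchy_Schwarz_sqrt:
  assumes "u \<in> V" "v \<in> V"
  shows "\<bar>B u v\<bar> \<le> sqrt (B u u) * sqrt (B v v)"
  using Cauchy_Schwarz[OF assms] by (metis real_le_rsqrt real_sqrt_mult power2_abs)

lemma triangle:
  assumes "u \<in> V" "v \<in> V"
  shows "sqrt (B (comb a u b v) (comb a u b v)) \<le> \<bar>a\<bar> * sqrt (B u u) + \<bar>b\<bar> * sqrt (B v v)"
proof (rule real_le_lsqrt)
  have "2 * a * b * B u v \<le> 2 * \<bar>a\<bar> * \<bar>b\<bar> * \<bar>B u v\<bar>"
    by (metis abs_ge_self abs_mult abs_numeral)
  also have "\<dots> \<le> 2 * \<bar>a\<bar> * \<bar>b\<bar> * (sqrt (B u u) * sqrt (B v v))"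
    by (intro mult_left_mono Cauchy_Schwarz_sqrt assms) auto
  finally show "B (comb a u b v) (comb a u b v) \<le> (\<bar>a\<bar> * sqrt (B u u) + \<bar>b\<bar> * sqrt (B v v))\<^sup>2"
    unfolding comb_square[OF assms]
    using nonneg[OF assms(1)] nonneg[OF assms(2)]
    by (simp add: power2_sum power_mult_distrib algebra_simps)
qed (use nonneg[OF assms(1)] nonneg[OF assms(2)] in auto)

end

locale semi_hilbert = semi_inner +
  assumes nonempty: "V \<noteq> {}"
    and complete: "(\<And>n. X n \<in> V) \<Longrightarrow>
      (\<And>e. 0 < e \<Longrightarrow> \<exists>N. \<forall>m\<ge>N. \<forall>n\<ge>N. B (comb 1 (X m) (-1) (X n)) (comb 1 (X m) (-1) (X n)) < e) \<Longrightarrow>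
      \<exists>x\<in>V. (\<lambda>n. B (comb 1 (X n) (-1) x) (comb 1 (X n) (-1) x)) \<longlonglongrightarrow> 0"
begin

text \<open>
  The representer minimizes \<open>B y y - 2 * l y\<close>: a minimizing sequence is Cauchy by the
  parallelogram identity, and the first variation vanishes at its limit.
\<close>

theorem Riesz_representation:
  assumes l: "\<And>a u b v. u \<in> V \<Longrightarrow> v \<in> V \<Longrightarrow> l (comb a u b v) = a * l u + b * l v"
    and bound: "\<And>y. y \<in> V \<Longrightarrow> \<bar>l y\<bar> \<le> C * sqrt (B y y)"
  shows "\<exists>x\<in>V. \<forall>y\<in>V. B x y = l y"
proof -
  define J where "J y = B y y - 2 * l y" for y
  have lower: "- C\<^sup>2 \<le> J y" if "y \<in> V" for y
  proof -
    have "l y \<le> C * sqrt (B y y)" using bound[OF that] by simp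
    moreover have "0 \<le> (sqrt (B y y) - C)\<^sup>2" by simp
    ultimately show ?thesis
      using nonneg[OF that] by (simp add: J_def power2_diff algebra_simps)
  qed
  define m where "m = (INF y\<in>V. J y)"
  have bdd: "bdd_below (J ` V)" using lower by (intro bdd_belowI2) auto
  have m_le: "m \<le> J y" if "y \<in> V" for y
    unfolding m_def using bdd that by (rule cINF_lower)
  have "\<exists>y\<in>V. J y < m + inverse (real (Suc n))" for n
  proof -
    have "(INF y\<in>V. J y) < m + inverse (real (Suc n))" by (simp add: m_def)
    then show ?thesis using cINF_less_iff[OF nonempty bdd] by blast
  qed
  then obtain X where XV: "\<And>n. X n \<in> V" and XJ: "\<And>n. J (X n) < m + inverse (real (Suc n))"
    by metis
  have para: "B (comb 1 u (-1) v) (comb 1 u (-1) v) \<le> 2 * (J u - m) + 2 * (J v - m)"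
    if "u \<in> V" "v \<in> V" for u v
  proof -
    have "m \<le> J (comb (1/2) u (1/2) v)" using that comb_closed m_le by blast
    also have "\<dots> = B u u / 4 + B u v / 2 + B v v / 4 - l u - l v"
      unfolding J_def using that by (simp add: comb_square l power2_eq_square)
    finally show ?thesis using that unfolding J_def by (simp add: comb_square)
  qed
  have inv0: "(\<lambda>n. inverse (real (Suc n))) \<longlonglongrightarrow> 0" by (rule LIMSEQ_inverse_real_of_nat)
  have "\<exists>N. \<forall>m\<ge>N. \<forall>n\<ge>N. B (comb 1 (X m) (-1) (X n)) (comb 1 (X m) (-1) (X n)) < e" if "0 < e" for e
  proof -
    have "\<forall>\<^sub>F n in sequentially. inverse (real (Suc n)) < e / 4"
      using order_tendstoD(2)[OF inv0, of "e / 4"] that by simp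
    then obtain N where N: "\<And>n. n \<ge> N \<Longrightarrow> inverse (real (Suc n)) < e / 4"
      unfolding eventually_sequentially by blast
    have "B (comb 1 (X i) (-1) (X j)) (comb 1 (X i) (-1) (X j)) < e" if "i \<ge> N" "j \<ge> N" for i j
    proof -
      have "J (X i) - m < e / 4" "J (X j) - m < e / 4"
        using XJ[of i] XJ[of j] N[OF that(1)] N[OF that(2)] by linarith+
      then have "2 * (J (X i) - m) + 2 * (J (X j) - m) < 2 * (e / 4) + 2 * (e / 4)"
        by (intro add_strict_mono mult_strict_left_mono) auto
      then show ?thesis
        by (intro le_less_trans[OF para[OF XV[of i] XV[of j]]]) simp
    qed
    then show ?thesis by blast
  qed
  from complete[OF XV this] obtain x where x: "x \<in> V"
    and lim: "(\<lambda>n. B (comb 1 (X n) (-1) x) (comb 1 (X n) (-1) x)) \<longlonglongrightarrow> 0" by blast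
  have "B x y = l y" if y: "y \<in> V" for y
  proof -
    have "(\<lambda>n. B (X n) y - B x y) \<longlonglongrightarrow> 0"
    proof (rule Lim_null_comparison)
      show "\<forall>\<^sub>F n in sequentially. norm (B (X n) y - B x y)
          \<le> sqrt (B (comb 1 (X n) (-1) x) (comb 1 (X n) (-1) x)) * sqrt (B y y)"
      proof (intro always_eventually allI)
        fix n
        show "norm (B (X n) y - B x y)
            \<le> sqrt (B (comb 1 (X n) (-1) x) (comb 1 (X n) (-1) x)) * sqrt (B y y)"
          using Cauchy_Schwarz_sqrt[OF comb_closed[OF XV[of n] x, of 1 "-1"] y]
          by (simp add: comb_left[OF XV x y])
      qed
      show "(\<lambda>n. sqrt (B (comb 1 (X n) (-1) x) (comb 1 (X n) (-1) x)) * sqrt (B y y)) \<longlonglongrightarrow> 0"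
        using tendsto_mult[OF tendsto_real_sqrt[OF lim] tendsto_const[of "sqrt (B y y)"]] by simp
    qed
    then have limy: "(\<lambda>n. B (X n) y) \<longlonglongrightarrow> B x y" by (simp add: LIM_zero_iff)
    define d where "d = B x y - l y"
    have q: "0 \<le> 2 * t * d + t\<^sup>2 * B y y" for t
    proof (rule tendsto_lowerbound)
      show "(\<lambda>n. inverse (real (Suc n)) + 2 * t * (B (X n) y - l y) + t\<^sup>2 * B y y)
          \<longlonglongrightarrow> 2 * t * d + t\<^sup>2 * B y y"
        unfolding d_def by (rule tendsto_eq_intros limy inv0 refl | simp)+
      show "\<forall>\<^sub>F n in sequentially. 0 \<le> inverse (real (Suc n)) + 2 * t * (B (X n) y - l y) + t\<^sup>2 * B y y"
      proof (intro always_eventually allI)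
        fix n
        have "m \<le> J (comb 1 (X n) t y)" using comb_closed[OF XV y] m_le by blast
        also have "\<dots> = J (X n) + 2 * t * (B (X n) y - l y) + t\<^sup>2 * B y y"
          unfolding J_def by (simp add: comb_square[OF XV y] l[OF XV y] algebra_simps)
        finally show "0 \<le> inverse (real (Suc n)) + 2 * t * (B (X n) y - l y) + t\<^sup>2 * B y y"
          using XJ[of n] by linarith
      qed
    qed simp
    have "d = 0"
    proof (cases "B y y = 0")
      case True
      then have "d * d \<le> 0" using q[of "-d"] by simp
      then show ?thesis using zero_le_square[of d] by simp
    next
      case False
      then have pos: "B y y > 0" using nonneg[OF y] by simp
      have "0 \<le> 2 * (- d / B y y) * d + (- d / B y y)\<^sup>2 * B y y" by (rule q)
      also have "\<dots> = - (d\<^sup>2 / B y y)" using pos by (simp add: power2_eq_square field_simps)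
      finally show ?thesis using pos by (simp add: divide_le_0_iff)
    qed
    then show ?thesis by (simp add: d_def)
  qed
  then show ?thesis using x by blast
qed

end

section \<open>The space of square integrable functions\<close>

lemma L2D: "f \<in> L2 U \<Longrightarrow> f \<in> borel_measurable (lebesgue_on U)"
  "f \<in> L2 U \<Longrightarrow> integrable (lebesgue_on U) (\<lambda>x. (norm (f x))\<^sup>2)"
  by (auto simp: L2_def)

lemma L2_zero: "(\<lambda>x. 0) \<in> L2 U"
  by (auto simp: L2_def)

lemma L2_bound:
  assumes "f \<in> borel_measurable (lebesgue_on U)" "integrable (lebesgue_on U) g"
    "AE x in lebesgue_on U. (norm (f x))\<^sup>2 \<le> g x"
  shows "f \<in> L2 U"
  unfolding L2_def
proof (intro CollectI conjI)
  show "integrable (lebesgue_on U) (\<lambda>x. (norm (f x))\<^sup>2)"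
    by (rule Bochner_Integration.integrable_bound[OF assms(2)]) (use assms(1,3) in auto)
qed (use assms in auto)

lemma L2_comb:
  assumes "f \<in> L2 U" "g \<in> L2 U"
  shows "comb a f b g \<in> L2 U"
proof (rule L2_bound)
  note [measurable] = L2D(1)[OF assms(1)] L2D(1)[OF assms(2)]
  show "comb a f b g \<in> borel_measurable (lebesgue_on U)" unfolding comb_def by measurable
  show "integrable (lebesgue_on U) (\<lambda>x. 2 * a\<^sup>2 * (norm (f x))\<^sup>2 + 2 * b\<^sup>2 * (norm (g x))\<^sup>2)"
    using L2D(2)[OF assms(1)] L2D(2)[OF assms(2)] by auto
  have "(norm (a *\<^sub>R u + b *\<^sub>R v))\<^sup>2 \<le> 2 * a\<^sup>2 * (norm u)\<^sup>2 + 2 * b\<^sup>2 * (norm v)\<^sup>2" for u v :: 'b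
  proof -
    have "0 \<le> (norm (a *\<^sub>R u - b *\<^sub>R v))\<^sup>2" by simp
    then show ?thesis
      unfolding power2_norm_eq_inner
      by (simp add: inner_simps power2_eq_square inner_commute algebra_simps)
  qed
  then show "AE x in lebesgue_on U. (norm (comb a f b g x))\<^sup>2
      \<le> 2 * a\<^sup>2 * (norm (f x))\<^sup>2 + 2 * b\<^sup>2 * (norm (g x))\<^sup>2"
    by (simp add: comb_def)
qed

lemma L2_inner_integrable:
  assumes "f \<in> L2 U" "g \<in> L2 U"
  shows "integrable (lebesgue_on U) (\<lambda>x. f x \<bullet> g x)"
proof (rule Bochner_Integration.integrable_bound)
  note [measurable] = L2D(1)[OF assms(1)] L2D(1)[OF assms(2)]
  show "integrable (lebesgue_on U) (\<lambda>x. (norm (f x))\<^sup>2 + (norm (g x))\<^sup>2)"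
    using L2D(2)[OF assms(1)] L2D(2)[OF assms(2)] by auto
  show "(\<lambda>x. f x \<bullet> g x) \<in> borel_measurable (lebesgue_on U)" by measurable
  have "\<bar>u \<bullet> v\<bar> \<le> (norm u)\<^sup>2 + (norm v)\<^sup>2" for u v :: 'b
  proof -
    have "\<bar>u \<bullet> v\<bar> \<le> norm u * norm v" by (rule Cauchy_Schwarz_ineq2)
    moreover have "0 \<le> (norm u - norm v)\<^sup>2" by simp
    moreover have "0 \<le> (norm u)\<^sup>2 + (norm v)\<^sup>2" by simp
    ultimately show ?thesis by (simp add: power2_diff)
  qed
  then show "AE x in lebesgue_on U. norm (f x \<bullet> g x) \<le> norm ((norm (f x))\<^sup>2 + (norm (g x))\<^sup>2)"
    by auto
qed

lemma L2_ip_sym: "L2_ip U f g = L2_ip U g f"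
  by (simp add: L2_ip_def inner_commute)

lemma L2_ip_comb_left:
  assumes "f \<in> L2 U" "g \<in> L2 U" "h \<in> L2 U"
  shows "L2_ip U (comb a f b g) h = a * L2_ip U f h + b * L2_ip U g h"
  using L2_inner_integrable[OF assms(1,3)] L2_inner_integrable[OF assms(2,3)]
  by (simp add: L2_ip_def comb_def inner_left_distrib)

lemma L2_ip_comb_right:
  assumes "f \<in> L2 U" "g \<in> L2 U" "h \<in> L2 U"
  shows "L2_ip U h (comb a f b g) = a * L2_ip U h f + b * L2_ip U h g"
  using L2_ip_comb_left[OF assms] by (simp add: L2_ip_sym)

lemma L2_ip_nonneg: "0 \<le> L2_ip U f f"
  by (auto simp: L2_ip_def intro!: Bochner_Integration.integral_nonneg)

lemma L2_ip_self: "L2_ip U f f = (LINT x|lebesgue_on U. (norm (f x))\<^sup>2)"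
  by (simp add: L2_ip_def power2_norm_eq_inner)

lemma L2_norm_power2: "(L2_norm U f)\<^sup>2 = L2_ip U f f"
  by (simp add: L2_norm_def L2_ip_nonneg)

interpretation L2: semi_inner "L2 U" "L2_ip U"
  by unfold_locales (auto simp: L2_comb L2_ip_comb_left L2_ip_nonneg intro: L2_ip_sym)

definition ae_eq :: "(real ^ 'd) set \<Rightarrow> (real ^ 'd \<Rightarrow> 'b) \<Rightarrow> (real ^ 'd \<Rightarrow> 'b) \<Rightarrow> bool" where
  "ae_eq U f g \<longleftrightarrow> (AE x in lebesgue_on U. f x = g x)"

lemma ae_eq_refl: "ae_eq U f f"
  by (simp add: ae_eq_def)

lemma ae_eq_sym: "ae_eq U f g \<Longrightarrow> ae_eq U g f"
  unfolding ae_eq_def by (auto elim: eventually_mono)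

lemma ae_eq_trans: "ae_eq U f g \<Longrightarrow> ae_eq U g h \<Longrightarrow> ae_eq U f h"
  unfolding ae_eq_def by (elim AE_mp) auto

lemma ae_eq_comb: "ae_eq U f f' \<Longrightarrow> ae_eq U g g' \<Longrightarrow> ae_eq U (comb a f b g) (comb a f' b g')"
  unfolding ae_eq_def comb_def by (elim AE_mp) auto

abbreviation L2_dist2 :: "(real ^ 'd) set \<Rightarrow> (real ^ 'd \<Rightarrow> 'b::euclidean_space) \<Rightarrow> (real ^ 'd \<Rightarrow> 'b) \<Rightarrow> real" where
  "L2_dist2 U f g \<equiv> L2_ip U (comb 1 f (-1) g) (comb 1 f (-1) g)"

lemma nn_integral_norm_square_eq_ip:
  assumes "f \<in> L2 U"
  shows "(\<integral>\<^sup>+x. ennreal ((norm (f x))\<^sup>2) \<partial>lebesgue_on U) = ennreal (L2_ip U f f)"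
  unfolding L2_ip_self using L2D(2)[OF assms] by (rule nn_integral_eq_integral) auto

text \<open>
  Riesz--Fischer: along a subsequence with geometrically decreasing increments the sequence converges
  almost everywhere, since the increments are summable in \<open>L1\<close>; Fatou's lemma turns the pointwise
  limit into the limit in mean square.
\<close>

theorem L2_complete:
  fixes X :: "nat \<Rightarrow> real ^ 'd \<Rightarrow> 'b::euclidean_space"
  assumes U: "U \<in> lmeasurable" and X: "\<And>n. X n \<in> L2 U"
    and Cauchy: "\<And>e. 0 < e \<Longrightarrow> \<exists>N. \<forall>m\<ge>N. \<forall>n\<ge>N.
      L2_dist2 U (X m) (X n) < e"
  shows "\<exists>x\<in>L2 U. (\<lambda>n. L2_dist2 U (X n) x) \<longlonglongrightarrow> 0"
proof -
  let ?M = "lebesgue_on U"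
  interpret finite_measure ?M using U by (rule finite_measure_lebesgue_on)
  note Xm[measurable] = L2D(1)[OF X]
  have diffL2: "comb 1 (X m) (-1) (X n) \<in> L2 U" for m n by (intro L2_comb X)
  define D where "D m n = L2_dist2 U (X m) (X n)" for m n
  have "\<forall>k. \<exists>N. \<forall>m\<ge>N. \<forall>n\<ge>N. D m n < (1/4)^k"
    unfolding D_def using Cauchy by simp
  then obtain N where N: "\<And>k m n. m \<ge> N k \<Longrightarrow> n \<ge> N k \<Longrightarrow> D m n < (1/4)^k" by metis
  \<comment> \<open>indices beyond \<open>N k\<close> at stage \<open>k\<close>; the summand \<open>k\<close> makes them tend to infinity\<close>
  define R where "R k = (\<Sum>j\<le>k. N j) + k" for k
  have NR: "N k \<le> R k" "N k \<le> R (Suc k)" for k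
    using member_le_sum[of k "{..k}" N] by (auto simp: R_def)
  define d where "d k x = norm (X (R (Suc k)) x - X (R k) x)" for k x
  have d_int: "(\<integral>\<^sup>+x. ennreal (d k x) \<partial>?M) \<le> ennreal ((1/2)^k * (1 + measure ?M (space ?M)))" for k
  proof -
    let ?f = "comb 1 (X (R (Suc k))) (-1) (X (R k))"
    \<comment> \<open>Young's inequality; the weight \<open>2^k\<close> is compensated by the decay \<open>(1/4)^k\<close> of the squared increments\<close>
    have "d k x \<le> 2^k * (norm (?f x))\<^sup>2 + (1/2)^k" for x
    proof -
      let ?a = "norm (?f x)" and ?c = "2^k :: real"
      have "0 \<le> (?c * ?a - 1)\<^sup>2" by simp
      then have "2 * (?c * ?a) \<le> ?c * (?c * ?a\<^sup>2 + (1/2)^k)"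
        by (simp add: power2_diff power2_eq_square algebra_simps power_one_over)
      then have "2 * ?a \<le> ?c * ?a\<^sup>2 + (1/2)^k"
        by (metis mult.left_commute mult_le_cancel_left_pos zero_less_numeral zero_less_power)
      moreover have "0 \<le> ?a" by simp
      ultimately have "?a \<le> ?c * ?a\<^sup>2 + (1/2)^k" by linarith
      then show ?thesis by (simp add: d_def comb_def)
    qed
    then have "(\<integral>\<^sup>+x. ennreal (d k x) \<partial>?M) \<le> (\<integral>\<^sup>+x. ennreal (2^k * (norm (?f x))\<^sup>2 + (1/2)^k) \<partial>?M)"
      by (intro nn_integral_mono ennreal_leI) auto
    also have "\<dots> = ennreal (\<integral>x. 2^k * (norm (?f x))\<^sup>2 + (1/2)^k \<partial>?M)"
      by (rule nn_integral_eq_integral) (use L2D(2)[OF diffL2] in auto)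
    also have "(\<integral>x. 2^k * (norm (?f x))\<^sup>2 + (1/2)^k \<partial>?M)
        = 2^k * D (R (Suc k)) (R k) + (1/2)^k * measure ?M (space ?M)"
      using L2D(2)[OF diffL2] by (simp add: D_def L2_ip_self)
    also have "\<dots> \<le> (1/2)^k * (1 + measure ?M (space ?M))"
    proof -
      have "2^k * D (R (Suc k)) (R k) \<le> 2^k * (1/4)^k"
        using N[OF NR(2) NR(1)] by (intro mult_left_mono) (auto intro: less_imp_le)
      also have "\<dots> = (1/2::real)^k" by (simp flip: power_mult_distrib)
      finally show ?thesis by (simp add: algebra_simps)
    qed
    finally show ?thesis by (simp add: ennreal_leI)
  qed
  have [measurable]: "d k \<in> borel_measurable ?M" for k unfolding d_def by measurable
  have "(\<integral>\<^sup>+x. (\<Sum>k. ennreal (d k x)) \<partial>?M) = (\<Sum>k. \<integral>\<^sup>+x. ennreal (d k x) \<partial>?M)"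
    by (rule nn_integral_suminf) measurable
  also have "\<dots> \<le> (\<Sum>k. ennreal ((1/2)^k * (1 + measure ?M (space ?M))))"
    by (intro suminf_le d_int) auto
  also have "\<dots> < \<infinity>"
  proof -
    have "summable (\<lambda>k. (1/2::real)^k * (1 + measure ?M (space ?M)))"
      by (intro summable_mult2 summable_geometric) auto
    then have "(\<Sum>k. ennreal ((1/2)^k * (1 + measure ?M (space ?M))))
        = ennreal (\<Sum>k. (1/2)^k * (1 + measure ?M (space ?M)))"
      by (intro suminf_ennreal2) auto
    then show ?thesis by simp
  qed
  finally have "AE x in ?M. (\<Sum>k. ennreal (d k x)) \<noteq> \<infinity>"
    by (intro nn_integral_PInf_AE) auto
  then have conv: "AE x in ?M. convergent (\<lambda>k. X (R k) x)"
  proof (rule eventually_mono)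
    fix x assume "(\<Sum>k. ennreal (d k x)) \<noteq> \<infinity>"
    then have "summable (\<lambda>k. d k x)"
      by (intro summable_suminf_not_top) (auto simp: d_def)
    then have "summable (\<lambda>k. X (R (Suc k)) x - X (R k) x)"
      unfolding d_def by (rule summable_norm_cancel)
    then have "convergent (\<lambda>n. \<Sum>k<n. X (R (Suc k)) x - X (R k) x)"
      by (simp add: summable_iff_convergent)
    then have "convergent (\<lambda>n. X (R n) x - X (R 0) x)"
      by (simp add: sum_lessThan_telescope[of "\<lambda>k. X (R k) x"])
    then have "convergent (\<lambda>n. (X (R n) x - X (R 0) x) + X (R 0) x)"
      by (rule convergent_add[OF _ convergent_const])
    then show "convergent (\<lambda>k. X (R k) x)" by simp
  qed
  define x where "x = (\<lambda>y. lim (\<lambda>k. X (R k) y))"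
  have xm[measurable]: "x \<in> borel_measurable ?M"
    unfolding x_def by (rule borel_measurable_lim_metric) measurable
  have lim: "AE y in ?M. (\<lambda>k. X (R k) y) \<longlonglongrightarrow> x y"
    using conv by eventually_elim (auto simp: x_def convergent_LIMSEQ_iff)
  have Rk: "k \<le> R k" for k by (simp add: R_def)
  have fatou: "(\<integral>\<^sup>+y. ennreal ((norm (comb 1 (X m) (-1) x y))\<^sup>2) \<partial>?M) \<le> ennreal e"
    if "0 < e" "\<And>n. n \<ge> n0 \<Longrightarrow> D m n < e" for e m n0
  proof -
    have "(\<integral>\<^sup>+y. ennreal ((norm (comb 1 (X m) (-1) x y))\<^sup>2) \<partial>?M)
        = (\<integral>\<^sup>+y. liminf (\<lambda>k. ennreal ((norm (comb 1 (X m) (-1) (X (R k)) y))\<^sup>2)) \<partial>?M)"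
    proof (rule nn_integral_cong_AE, use lim in eventually_elim)
      fix y assume "(\<lambda>k. X (R k) y) \<longlonglongrightarrow> x y"
      then have "(\<lambda>k. ennreal ((norm (comb 1 (X m) (-1) (X (R k)) y))\<^sup>2))
          \<longlonglongrightarrow> ennreal ((norm (comb 1 (X m) (-1) x y))\<^sup>2)"
        unfolding comb_def by (intro tendsto_intros tendsto_ennrealI) 
      then show "ennreal ((norm (comb 1 (X m) (-1) x y))\<^sup>2)
          = liminf (\<lambda>k. ennreal ((norm (comb 1 (X m) (-1) (X (R k)) y))\<^sup>2))"
        by (intro lim_imp_Liminf[symmetric]) auto
    qed
    also have "\<dots> \<le> liminf (\<lambda>k. \<integral>\<^sup>+y. ennreal ((norm (comb 1 (X m) (-1) (X (R k)) y))\<^sup>2) \<partial>?M)"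
      by (rule nn_integral_liminf) (use L2D(1)[OF diffL2] in measurable)
    also have "\<dots> = liminf (\<lambda>k. ennreal (D m (R k)))"
      using nn_integral_norm_square_eq_ip[OF diffL2] by (simp add: D_def)
    also have "\<dots> \<le> liminf (\<lambda>k. ennreal e)"
    proof (rule Liminf_mono, unfold eventually_sequentially, intro exI[of _ n0] allI impI ennreal_leI)
      fix k assume "n0 \<le> k"
      then show "D m (R k) \<le> e" using that(2)[of "R k"] Rk[of k] by simp
    qed
    finally show ?thesis by (simp add: Liminf_const)
  qed
  have diffx: "comb 1 (X m) (-1) x \<in> L2 U"
    if "0 < e" "\<And>n. n \<ge> n0 \<Longrightarrow> D m n < e" for e m n0
    unfolding L2_def
  proof (intro CollectI conjI integrableI_bounded)
    show "(\<integral>\<^sup>+y. ennreal (norm ((norm (comb 1 (X m) (-1) x y))\<^sup>2)) \<partial>?M) < \<infinity>"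
      using fatou[of e n0 m] that by (simp add: order_le_less_trans)
  qed (simp_all add: comb_def)
  have Cauchy': "\<exists>n0. \<forall>m\<ge>n0. \<forall>n\<ge>n0. D m n < e" if "0 < e" for e
    using Cauchy[OF that] by (simp add: D_def)
  obtain n1 where n1: "\<And>n. n \<ge> n1 \<Longrightarrow> D n1 n < 1" using Cauchy'[of 1] by auto
  have "comb 1 (X n1) (-1) (comb 1 (X n1) (-1) x) \<in> L2 U"
    by (intro L2_comb X diffx[of 1, OF _ n1]) auto
  also have "comb 1 (X n1) (-1) (comb 1 (X n1) (-1) x) = x" by (auto simp: comb_def)
  finally have xL2: "x \<in> L2 U" .
  have "(\<lambda>n. L2_dist2 U (X n) x) \<longlonglongrightarrow> 0"
  proof (rule LIMSEQ_I)
    fix r :: real assume r: "0 < r"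
    then obtain n0 where n0: "\<And>m n. m \<ge> n0 \<Longrightarrow> n \<ge> n0 \<Longrightarrow> D m n < r / 2"
      using Cauchy'[of "r/2"] by auto
    have "L2_dist2 U (X m) x \<le> r / 2" if "m \<ge> n0" for m
      using fatou[of "r/2" n0 m] n0[OF that] r
        nn_integral_norm_square_eq_ip[OF L2_comb[OF X[of m] xL2], of 1 "-1"] by simp
    then have "\<forall>m\<ge>n0. norm (L2_dist2 U (X m) x - 0) < r"
      using r L2_ip_nonneg by (smt (verit) field_sum_of_halves real_norm_def)
    then show "\<exists>no. \<forall>n\<ge>no. norm (L2_dist2 U (X n) x - 0) < r" by blast
  qed
  with xL2 show ?thesis by blast
qed

lemma L2_bounded_linear:
  assumes "bounded_linear T" "f \<in> L2 U"
  shows "(\<lambda>x. T (f x)) \<in> L2 U"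
proof -
  interpret T: bounded_linear T by fact
  obtain C where C: "\<And>x. norm (T x) \<le> norm x * C" using T.bounded by blast
  show ?thesis
  proof (rule L2_bound)
    note [measurable] = L2D(1)[OF assms(2)]
    have [measurable]: "T \<in> borel_measurable borel"
      by (intro borel_measurable_continuous_onI T.continuous_on continuous_on_id)
    show "(\<lambda>x. T (f x)) \<in> borel_measurable (lebesgue_on U)" by measurable
    show "integrable (lebesgue_on U) (\<lambda>x. (norm (f x))\<^sup>2 * C\<^sup>2)"
      using L2D(2)[OF assms(2)] by simp
    show "AE x in lebesgue_on U. (norm (T (f x)))\<^sup>2 \<le> (norm (f x))\<^sup>2 * C\<^sup>2"
      using power_mono[OF C norm_ge_zero, of _ 2] by (simp add: power_mult_distrib)
  qed
qed

lemma L2_multiplier: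
  assumes "a \<in> borel_measurable (lebesgue_on U)" "\<And>x. x \<in> U \<Longrightarrow> \<bar>a x\<bar> \<le> C" "f \<in> L2 U"
  shows "(\<lambda>x. a x *\<^sub>R f x) \<in> L2 U"
proof (rule L2_bound)
  note [measurable] = L2D(1)[OF assms(3)] assms(1)
  show "(\<lambda>x. a x *\<^sub>R f x) \<in> borel_measurable (lebesgue_on U)" by measurable
  show "integrable (lebesgue_on U) (\<lambda>x. C\<^sup>2 * (norm (f x))\<^sup>2)"
    using L2D(2)[OF assms(3)] by simp
  have "(norm (a x *\<^sub>R f x))\<^sup>2 \<le> C\<^sup>2 * (norm (f x))\<^sup>2" if "x \<in> U" for x
    using power_mono[OF assms(2)[OF that] abs_ge_zero, of 2]
    by (simp add: power_mult_distrib mult_right_mono)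
  then show "AE x in lebesgue_on U. (norm (a x *\<^sub>R f x))\<^sup>2 \<le> C\<^sup>2 * (norm (f x))\<^sup>2"
    by (intro AE_I2) auto
qed

lemma L2_pair:
  assumes "f \<in> L2 U" "g \<in> L2 U"
  shows "(\<lambda>x. (f x, g x)) \<in> L2 U"
proof (rule L2_bound)
  note [measurable] = L2D(1)[OF assms(1)] L2D(1)[OF assms(2)]
  show "(\<lambda>x. (f x, g x)) \<in> borel_measurable (lebesgue_on U)" by measurable
  show "integrable (lebesgue_on U) (\<lambda>x. (norm (f x))\<^sup>2 + (norm (g x))\<^sup>2)"
    using L2D(2)[OF assms(1)] L2D(2)[OF assms(2)] by simp
  show "AE x in lebesgue_on U. (norm (f x, g x))\<^sup>2 \<le> (norm (f x))\<^sup>2 + (norm (g x))\<^sup>2"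
    by (simp add: norm_Pair)
qed

lemma L2_fst: "z \<in> L2 U \<Longrightarrow> fst \<circ> z \<in> L2 U"
  using L2_bounded_linear[OF bounded_linear_fst] by (simp add: comp_def)

lemma L2_snd: "z \<in> L2 U \<Longrightarrow> snd \<circ> z \<in> L2 U"
  using L2_bounded_linear[OF bounded_linear_snd] by (simp add: comp_def)

lemma L2_component: "g \<in> L2 U \<Longrightarrow> (\<lambda>x. g x $ i) \<in> L2 U"
  by (rule L2_bounded_linear[OF bounded_linear_vec_nth])

lemma L2_axis: "g \<in> L2 U \<Longrightarrow> (\<lambda>x. g x *\<^sub>R axis i 1) \<in> L2 U"
  by (rule L2_bounded_linear[OF bounded_linear_scaleR_left])

lemma continuous_bounded_on:
  fixes f :: "'a::euclidean_space \<Rightarrow> 'b::real_normed_vector"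
  assumes "continuous_on UNIV f" "bounded U"
  obtains C where "0 \<le> C" "\<And>x. x \<in> U \<Longrightarrow> norm (f x) \<le> C"
proof -
  have "compact (f ` closure U)"
    using assms by (intro compact_continuous_image) (auto intro: continuous_on_subset)
  then obtain C where "\<And>x. x \<in> closure U \<Longrightarrow> norm (f x) \<le> C"
    using compact_imp_bounded bounded_iff by (metis imageI)
  then show thesis
    by (intro that[of "max 0 C"]) (auto intro: max.coboundedI2 closure_subset[THEN subsetD])
qed

lemma continuous_measurable_on:
  fixes f :: "real ^ 'd \<Rightarrow> 'b::euclidean_space"
  shows "continuous_on UNIV f \<Longrightarrow> open U \<Longrightarrow> f \<in> borel_measurable (lebesgue_on U)"
  by (rule continuous_imp_measurable_on_sets_lebesgue) (auto intro: continuous_on_subset)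

lemma finite_measure_bounded_open:
  "open U \<Longrightarrow> bounded U \<Longrightarrow> finite_measure (lebesgue_on U)"
  by (intro finite_measure_lebesgue_on lmeasurable_open)

lemma continuous_L2:
  fixes f :: "real ^ 'd \<Rightarrow> 'b::euclidean_space"
  assumes "continuous_on UNIV f" "open U" "bounded U"
  shows "f \<in> L2 U"
proof -
  interpret finite_measure "lebesgue_on U" using assms by (intro finite_measure_bounded_open)
  obtain C where C: "\<And>x. x \<in> U \<Longrightarrow> norm (f x) \<le> C" using continuous_bounded_on assms(1,3) by blast
  show ?thesis
    by (rule L2_bound[of _ _ "\<lambda>x. C\<^sup>2"])
      (use assms C in \<open>auto intro!: continuous_measurable_on AE_I2 power_mono\<close>)
qed

lemma L2_cong_ae:
  assumes "f \<in> L2 U" "f' \<in> L2 U" "g \<in> L2 U" "g' \<in> L2 U" "ae_eq U f f'" "ae_eq U g g'"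
  shows "L2_ip U f g = L2_ip U f' g'"
  unfolding L2_ip_def
proof (rule integral_cong_AE)
  note [measurable] = L2D(1)[OF assms(1)] L2D(1)[OF assms(2)] L2D(1)[OF assms(3)] L2D(1)[OF assms(4)]
  show "(\<lambda>x. f x \<bullet> g x) \<in> borel_measurable (lebesgue_on U)" by measurable
  show "(\<lambda>x. f' x \<bullet> g' x) \<in> borel_measurable (lebesgue_on U)" by measurable
  show "AE x in lebesgue_on U. f x \<bullet> g x = f' x \<bullet> g' x"
    using assms(5,6) unfolding ae_eq_def by eventually_elim simp
qed

lemma L2_ip_tendsto:
  assumes X: "\<And>n. X n \<in> L2 U" "x \<in> L2 U" "y \<in> L2 U"
    and lim: "(\<lambda>n. L2_dist2 U (X n) x) \<longlonglongrightarrow> 0"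
  shows "(\<lambda>n. L2_ip U (X n) y) \<longlonglongrightarrow> L2_ip U x y"
proof -
  have "(\<lambda>n. L2_ip U (X n) y - L2_ip U x y) \<longlonglongrightarrow> 0"
  proof (rule Lim_null_comparison)
    show "\<forall>\<^sub>F n in sequentially. norm (L2_ip U (X n) y - L2_ip U x y)
        \<le> sqrt (L2_dist2 U (X n) x) * sqrt (L2_ip U y y)"
    proof (intro always_eventually allI)
      fix n
      show "norm (L2_ip U (X n) y - L2_ip U x y)
          \<le> sqrt (L2_dist2 U (X n) x) * sqrt (L2_ip U y y)"
        using L2.Cauchy_Schwarz_sqrt[OF L2_comb[OF X(1)[of n] X(2), of 1 "-1"] X(3)]
        by (simp add: L2_ip_comb_left X)
    qed
    show "(\<lambda>n. sqrt (L2_dist2 U (X n) x) * sqrt (L2_ip U y y)) \<longlonglongrightarrow> 0"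
      using tendsto_mult[OF tendsto_real_sqrt[OF lim] tendsto_const[of "sqrt (L2_ip U y y)"]] by simp
  qed
  then show ?thesis by (simp add: LIM_zero_iff)
qed

lemma L2_scaleR_integrable:
  fixes v :: "real ^ 'd \<Rightarrow> real" and g :: "real ^ 'd \<Rightarrow> 'b::euclidean_space"
  assumes "v \<in> L2 U" "g \<in> L2 U"
  shows "integrable (lebesgue_on U) (\<lambda>x. v x *\<^sub>R g x)"
proof (rule Bochner_Integration.integrable_bound)
  note [measurable] = L2D(1)[OF assms(1)] L2D(1)[OF assms(2)]
  show "integrable (lebesgue_on U) (\<lambda>x. (norm (v x))\<^sup>2 + (norm (g x))\<^sup>2)"
    using L2D(2)[OF assms(1)] L2D(2)[OF assms(2)] by auto
  show "(\<lambda>x. v x *\<^sub>R g x) \<in> borel_measurable (lebesgue_on U)" by measurable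
  have "\<bar>a\<bar> * b \<le> \<bar>a\<bar>\<^sup>2 + b\<^sup>2" if "0 \<le> b" for a b :: real
  proof -
    have "0 \<le> (\<bar>a\<bar> - b)\<^sup>2" "0 \<le> \<bar>a\<bar> * b" using that by auto
    then show ?thesis by (simp add: power2_diff)
  qed
  then show "AE x in lebesgue_on U. norm (v x *\<^sub>R g x) \<le> norm ((norm (v x))\<^sup>2 + (norm (g x))\<^sup>2)"
    by (intro AE_I2) (simp add: abs_of_nonneg)
qed

lemma L2_ip_axis: "L2_ip U g (\<lambda>x. \<phi> x *\<^sub>R axis i 1) = L2_ip U (\<lambda>x. g x $ i) \<phi>"
  by (simp add: L2_ip_def inner_axis mult.commute)

lemma L2_subset:
  fixes f :: "real ^ 'd \<Rightarrow> 'b::euclidean_space"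
  assumes "f \<in> L2 V" "U \<subseteq> V" "open U" "open V"
  shows "f \<in> L2 U"
  unfolding L2_def
proof (intro CollectI conjI)
  show "f \<in> borel_measurable (lebesgue_on U)"
    using L2D(1)[OF assms(1)] assms(2) by (rule measurable_restrict_mono)
  have "set_integrable lebesgue V (\<lambda>x. (norm (f x))\<^sup>2)"
    using L2D(2)[OF assms(1)] assms(4) by (simp add: integrable_restrict_space set_integrable_def)
  then have "set_integrable lebesgue U (\<lambda>x. (norm (f x))\<^sup>2)"
    by (rule set_integrable_subset) (use assms in auto)
  then show "integrable (lebesgue_on U) (\<lambda>x. (norm (f x))\<^sup>2)"
    using assms(3) by (simp add: integrable_restrict_space set_integrable_def)
qed

lemma L2_ip_restrict:
  assumes "U \<subseteq> V" "open U" "open V" "\<And>x. x \<in> V - U \<Longrightarrow> f x \<bullet> g x = 0"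
  shows "L2_ip V f g = L2_ip U f g"
proof -
  have "L2_ip V f g = (LINT x|lebesgue. (if x \<in> V then f x \<bullet> g x else 0))"
    using assms(3) by (simp add: L2_ip_def Lebesgue_Measure.integral_restrict_UNIV)
  also have "\<dots> = (LINT x|lebesgue. (if x \<in> U then f x \<bullet> g x else 0))"
    using assms(1,4) by (intro Bochner_Integration.integral_cong) auto
  also have "\<dots> = L2_ip U f g"
    using assms(2) by (simp add: L2_ip_def Lebesgue_Measure.integral_restrict_UNIV)
  finally show ?thesis .
qed

lemma ae_eq_subset:
  assumes "ae_eq V f g" "U \<subseteq> V" "open U" "open V"
  shows "ae_eq U f g"
  using assms unfolding ae_eq_def
  by (auto simp: AE_restrict_space_iff elim!: eventually_mono)

section \<open>Smooth functions\<close>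

text \<open>
  Iterating a choice of partial derivatives inside \<open>S\<close> along a list of indices produces the family of all
  iterated derivatives.
\<close>

lemma smooth_coinduct:
  assumes "\<phi> \<in> S"
    and step: "\<And>f. f \<in> S \<Longrightarrow> \<exists>g. (\<forall>i. g i \<in> S) \<and>
      (\<forall>x. (f has_derivative (\<lambda>h. \<Sum>i\<in>UNIV. g i x * h $ i)) (at x))"
  shows "smooth \<phi>"
proof -
  obtain G where G: "\<And>f i. f \<in> S \<Longrightarrow> G f i \<in> S"
    "\<And>f x. f \<in> S \<Longrightarrow> (f has_derivative (\<lambda>h. \<Sum>i\<in>UNIV. G f i x * h $ i)) (at x)"
    using step by metis
  define D where "D = rec_list \<phi> (\<lambda>i is f. G f i)"
  have D: "D [] = \<phi>" "\<And>i is. D (i # is) = G (D is) i" by (simp_all add: D_def)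
  have "D is \<in> S" for "is" by (induction "is") (use assms(1) G D in auto)
  then show ?thesis unfolding smooth_def using D G(2) by (intro exI[of _ D]) auto
qed

lemma smooth_partials:
  assumes "smooth \<phi>"
  shows "\<exists>g. (\<forall>i. smooth (g i)) \<and> (\<forall>x. (\<phi> has_derivative (\<lambda>h. \<Sum>i\<in>UNIV. g i x * h $ i)) (at x))"
proof -
  obtain D where D: "D [] = \<phi>"
    "\<And>is x. (D is has_derivative (\<lambda>h. \<Sum>i\<in>UNIV. D (i # is) x * h $ i)) (at x)"
    using assms unfolding smooth_def by blast
  have "smooth (D [i])" for i
    unfolding smooth_def using D(2) by (intro exI[of _ "\<lambda>is. D (is @ [i])"]) auto
  then show ?thesis using D(1) D(2)[of "[]"] by (intro exI[of _ "\<lambda>i. D [i]"]) auto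
qed

lemma grad_eqI:
  assumes "(\<phi> has_derivative (\<lambda>h. \<Sum>i\<in>UNIV. g i * h $ i)) (at x)"
  shows "grad \<phi> x $ i = g i"
proof -
  have "frechet_derivative \<phi> (at x) = (\<lambda>h. \<Sum>i\<in>UNIV. g i * h $ i)"
    using frechet_derivative_at[OF assms] by simp
  then show ?thesis by (simp add: grad_def axis_def if_distrib cong: if_cong)
qed

lemma smooth_grad:
  assumes "smooth \<phi>"
  shows "smooth (\<lambda>x. grad \<phi> x $ i)" and "(\<phi> has_derivative (\<lambda>h. \<Sum>i\<in>UNIV. grad \<phi> x $ i * h $ i)) (at x)"
proof -
  obtain g where g: "\<And>i. smooth (g i)" "\<And>x. (\<phi> has_derivative (\<lambda>h. \<Sum>i\<in>UNIV. g i x * h $ i)) (at x)"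
    using smooth_partials[OF assms] by blast
  have *: "grad \<phi> x $ i = g i x" for x i by (rule grad_eqI[OF g(2)])
  show "smooth (\<lambda>x. grad \<phi> x $ i)"
    "(\<phi> has_derivative (\<lambda>h. \<Sum>i\<in>UNIV. grad \<phi> x $ i * h $ i)) (at x)"
    using g by (simp_all add: *)
qed

lemma smooth_has_derivative_inner:
  assumes "smooth \<phi>" shows "(\<phi> has_derivative (\<lambda>h. grad \<phi> x \<bullet> h)) (at x)"
  using smooth_grad(2)[OF assms] by (simp add: inner_vec_def)

lemma smooth_continuous: "smooth \<phi> \<Longrightarrow> continuous_on S \<phi>"
  by (intro continuous_at_imp_continuous_on ballI has_derivative_continuous[OF smooth_grad(2)])

lemma grad_continuous: "smooth \<phi> \<Longrightarrow> continuous_on S (grad \<phi>)"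
  using smooth_continuous[OF smooth_grad(1)]
  by (subst continuous_on_componentwise) (auto simp: Basis_vec_def inner_axis)

text \<open>
  The closure of \<open>G\<close> under sums and products.  By the product rule it suffices to differentiate the
  generators, so products and compositions of smooth functions can be treated together.
\<close>

inductive_set alg :: "(real ^ 'd \<Rightarrow> real) set \<Rightarrow> (real ^ 'd \<Rightarrow> real) set" for G where
  base: "f \<in> G \<Longrightarrow> f \<in> alg G"
| add: "f \<in> alg G \<Longrightarrow> g \<in> alg G \<Longrightarrow> (\<lambda>x. f x + g x) \<in> alg G"
| mult: "f \<in> alg G \<Longrightarrow> g \<in> alg G \<Longrightarrow> (\<lambda>x. f x * g x) \<in> alg G"

lemma smooth_alg:
  assumes G: "\<And>f. f \<in> G \<Longrightarrow> \<exists>g. (\<forall>i. g i \<in> alg G) \<and>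
      (\<forall>x. (f has_derivative (\<lambda>h. \<Sum>i\<in>UNIV. g i x * h $ i)) (at x))"
    and "\<phi> \<in> alg G"
  shows "smooth \<phi>"
proof (rule smooth_coinduct[OF assms(2)])
  fix f assume "f \<in> alg G"
  then show "\<exists>g. (\<forall>i. g i \<in> alg G) \<and>
      (\<forall>x. (f has_derivative (\<lambda>h. \<Sum>i\<in>UNIV. g i x * h $ i)) (at x))"
  proof induction
    case (base f)
    then show ?case by (rule G)
  next
    case (add f g)
    then obtain f' g' where
      f: "\<And>i. f' i \<in> alg G" "\<And>x. (f has_derivative (\<lambda>h. \<Sum>i\<in>UNIV. f' i x * h $ i)) (at x)" and
      g: "\<And>i. g' i \<in> alg G" "\<And>x. (g has_derivative (\<lambda>h. \<Sum>i\<in>UNIV. g' i x * h $ i)) (at x)"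
      by blast
    have "((\<lambda>x. f x + g x) has_derivative (\<lambda>h. \<Sum>i\<in>UNIV. (f' i x + g' i x) * h $ i)) (at x)" for x
      using has_derivative_add[OF f(2) g(2)] by (simp add: distrib_right sum.distrib)
    moreover have "(\<lambda>x. f' i x + g' i x) \<in> alg G" for i by (intro alg.add f(1) g(1))
    ultimately show ?case by (intro exI[of _ "\<lambda>i x. f' i x + g' i x"]) simp
  next
    case (mult f g)
    then obtain f' g' where
      f: "\<And>i. f' i \<in> alg G" "\<And>x. (f has_derivative (\<lambda>h. \<Sum>i\<in>UNIV. f' i x * h $ i)) (at x)" and
      g: "\<And>i. g' i \<in> alg G" "\<And>x. (g has_derivative (\<lambda>h. \<Sum>i\<in>UNIV. g' i x * h $ i)) (at x)"
      by blast
    have "((\<lambda>x. f x * g x) has_derivative (\<lambda>h. \<Sum>i\<in>UNIV. (f x * g' i x + f' i x * g x) * h $ i)) (at x)" for x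
    proof -
      have "(\<lambda>h. f x * (\<Sum>i\<in>UNIV. g' i x * h $ i) + (\<Sum>i\<in>UNIV. f' i x * h $ i) * g x)
          = (\<lambda>h. \<Sum>i\<in>UNIV. (f x * g' i x + f' i x * g x) * h $ i)"
        by (simp only: fun_eq_iff sum_distrib_left sum_distrib_right sum.distrib[symmetric])
          (simp add: algebra_simps)
      then show ?thesis using has_derivative_mult[OF f(2)[of x] g(2)[of x]] by simp
    qed
    moreover have "(\<lambda>x. f x * g' i x + f' i x * g x) \<in> alg G" for i
      by (intro alg.add alg.mult f(1) g(1) mult(1,2))
    ultimately show ?case
      by (intro exI[of _ "\<lambda>i x. f x * g' i x + f' i x * g x"]) simp
  qed
qed

text \<open>
  The functions \<open>t\<^sup>-\<^sup>n exp (- 1/t)\<close>, extended by zero to \<open>t \<le> 0\<close>.  This family is closed under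
  differentiation up to linear combinations.
\<close>

definition exp_bump :: "nat \<Rightarrow> real \<Rightarrow> real" where
  "exp_bump n t = (if 0 < t then inverse t ^ n * exp (- inverse t) else 0)"

lemma exp_bump_tendsto_0: "((\<lambda>t. exp_bump n t) \<longlongrightarrow> 0) (at_right 0)"
proof -
  have "((\<lambda>x::real. x ^ n / exp x) \<longlongrightarrow> 0) at_top" by (rule tendsto_power_div_exp_0)
  then have "((\<lambda>t::real. inverse t ^ n / exp (inverse t)) \<longlongrightarrow> 0) (at_right 0)"
    by (rule filterlim_compose[OF _ filterlim_inverse_at_top_right])
  moreover have "\<forall>\<^sub>F t::real in at_right 0. inverse t ^ n / exp (inverse t) = exp_bump n t"
    by (rule eventually_at_right_less[THEN eventually_mono]) (simp add: exp_bump_def exp_minus field_simps)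
  ultimately show ?thesis by (rule Lim_transform_eventually)
qed

lemma exp_bump_has_derivative:
  "(exp_bump n has_real_derivative (exp_bump (n + 2) t - real n * exp_bump (n + 1) t)) (at t)"
proof (cases "t = 0")
  case False
  show ?thesis
  proof (cases "0 < t")
    case True
    define x where "x = inverse t"
    have inv: "(inverse has_real_derivative - (x\<^sup>2)) (at t)"
      using DERIV_inverse[of t UNIV] True by (simp add: x_def power2_eq_square)
    have "((\<lambda>t. inverse t ^ n) has_real_derivative real n * (- (x\<^sup>2) * x ^ (n - Suc 0))) (at t)"
      using DERIV_power[OF inv, of n] by (simp add: x_def)
    moreover have "((\<lambda>t. exp (- inverse t)) has_real_derivative exp (- x) * x\<^sup>2) (at t)"
      using DERIV_chain2[OF DERIV_exp DERIV_minus[OF inv]] by (simp add: x_def)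
    ultimately have "((\<lambda>t. inverse t ^ n * exp (- inverse t)) has_real_derivative
        real n * (- (x\<^sup>2) * x ^ (n - Suc 0)) * exp (- x) + exp (- x) * x\<^sup>2 * x ^ n) (at t)"
      unfolding x_def by (rule DERIV_mult)
    moreover have "real n * (- (x\<^sup>2) * x ^ (n - Suc 0)) * exp (- x) + exp (- x) * x\<^sup>2 * x ^ n
        = exp_bump (n + 2) t - real n * exp_bump (n + 1) t"
      using True by (cases n) (simp_all add: exp_bump_def x_def power_add power2_eq_square algebra_simps)
    ultimately have "((\<lambda>t. inverse t ^ n * exp (- inverse t)) has_real_derivative
        (exp_bump (n + 2) t - real n * exp_bump (n + 1) t)) (at t)"
      by simp
    then show ?thesis
      by (rule has_field_derivative_transform_within_open[of _ _ _ "{0<..}"])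
        (use True in \<open>auto simp: exp_bump_def\<close>)
  next
    case neg: False
    have "((\<lambda>t. 0) has_real_derivative 0) (at t)" by simp
    then have "(exp_bump n has_real_derivative 0) (at t)"
      by (rule has_field_derivative_transform_within_open[of _ _ _ "{..<0}"])
        (use neg False in \<open>auto simp: exp_bump_def\<close>)
    then show ?thesis using neg by (simp add: exp_bump_def)
  qed
next
  case True
  have "((\<lambda>h. exp_bump n h / h) \<longlongrightarrow> 0) (at_right 0)"
    using exp_bump_tendsto_0[of "Suc n"]
    by (rule Lim_transform_eventually)
      (rule eventually_at_right_less[THEN eventually_mono], simp add: exp_bump_def field_simps)
  moreover have "((\<lambda>h. exp_bump n h / h) \<longlongrightarrow> 0) (at_left 0)"
    by (rule tendsto_eventually) (simp add: exp_bump_def eventually_at_filter)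
  ultimately have "((\<lambda>h. exp_bump n h / h) \<longlongrightarrow> 0) (at 0)"
    by (simp add: filterlim_split_at)
  then show ?thesis using True by (simp add: DERIV_def exp_bump_def)
qed

text \<open>
  Every partial derivative of a generator is a sum of products of generators.
\<close>

definition bump_closure :: "(real ^ 'd \<Rightarrow> real) set" where
  "bump_closure = {f. smooth f} \<union> {\<lambda>x. exp_bump n (\<phi> x) | n \<phi>. smooth \<phi>}"

lemma smooth_const: "smooth (\<lambda>x. c)"
proof (rule smooth_coinduct[of _ "range (\<lambda>c x. c)"])
  fix f :: "real ^ 'a \<Rightarrow> real" assume "f \<in> range (\<lambda>c x. c)"
  then show "\<exists>g. (\<forall>i. g i \<in> range (\<lambda>c x. c)) \<and>
      (\<forall>x. (f has_derivative (\<lambda>h. \<Sum>i\<in>UNIV. g i x * h $ i)) (at x))"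
    by (intro exI[of _ "\<lambda>i x. 0"]) auto
qed simp

lemma smooth_coord: "smooth (\<lambda>x. x $ i)"
proof (rule smooth_coinduct[of _ "insert (\<lambda>x. x $ i) {\<lambda>x. c | c. True}"])
  fix f :: "real ^ 'a \<Rightarrow> real" assume "f \<in> insert (\<lambda>x. x $ i) {\<lambda>x. c |c. True}"
  then consider "f = (\<lambda>x. x $ i)" | c where "f = (\<lambda>x. c)" by auto
  then show "\<exists>g. (\<forall>j. g j \<in> insert (\<lambda>x. x $ i) {\<lambda>x. c |c. True}) \<and>
      (\<forall>x. (f has_derivative (\<lambda>h. \<Sum>j\<in>UNIV. g j x * h $ j)) (at x))"
  proof cases
    case 1
    have "((\<lambda>x. x $ i) has_derivative (\<lambda>h. \<Sum>j\<in>UNIV. (if j = i then 1 else 0) * h $ j)) (at x)" for x :: "real ^ 'a"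
      by (simp add: if_distrib if_distribR bounded_linear_imp_has_derivative bounded_linear_vec_nth cong: if_cong)
    then show ?thesis unfolding 1 by (intro exI[of _ "\<lambda>j x. if j = i then 1 else 0"]) auto
  next
    case 2
    then show ?thesis by (intro exI[of _ "\<lambda>i x. 0"]) auto
  qed
qed simp

lemma smooth_bump_closure:
  assumes "f \<in> alg bump_closure"
  shows "smooth f"
proof (rule smooth_alg[OF _ assms])
  fix f :: "real ^ 'a \<Rightarrow> real" assume "f \<in> bump_closure"
  then consider "smooth f" | n \<phi> where "smooth \<phi>" "f = (\<lambda>x. exp_bump n (\<phi> x))"
    unfolding bump_closure_def by blast
  then show "\<exists>g. (\<forall>i. g i \<in> alg bump_closure) \<and> (\<forall>x. (f has_derivative (\<lambda>h. \<Sum>i\<in>UNIV. g i x * h $ i)) (at x))"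
  proof cases
    case 1
    obtain g where "\<And>i. smooth (g i)" "\<And>x. (f has_derivative (\<lambda>h. \<Sum>i\<in>UNIV. g i x * h $ i)) (at x)"
      using smooth_partials[OF 1] by blast
    then show ?thesis by (intro exI[of _ g]) (auto simp: bump_closure_def intro: alg.base)
  next
    case 2
    obtain g where g: "\<And>i. smooth (g i)" "\<And>x. (\<phi> has_derivative (\<lambda>h. \<Sum>i\<in>UNIV. g i x * h $ i)) (at x)"
      using smooth_partials[OF 2(1)] by blast
    let ?g = "\<lambda>i x. (exp_bump (n + 2) (\<phi> x) + (- real n) * exp_bump (n + 1) (\<phi> x)) * g i x"
    have b: "(\<lambda>x. exp_bump k (\<phi> x)) \<in> alg bump_closure" for k
      using 2(1) by (intro alg.base) (auto simp: bump_closure_def)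
    have s: "smooth h \<Longrightarrow> h \<in> alg bump_closure" for h
      by (intro alg.base) (auto simp: bump_closure_def)
    have mem: "?g i \<in> alg bump_closure" for i
      using alg.mult[OF alg.add[OF b[of "n+2"] alg.mult[OF s[OF smooth_const[of "- real n"]] b[of "n+1"]]] s[OF g(1)[of i]]] .
    have "(f has_derivative (\<lambda>h. \<Sum>i\<in>UNIV. ?g i x * h $ i)) (at x)" for x
    proof -
      have "((\<lambda>x. exp_bump n (\<phi> x)) has_derivative
          (\<lambda>h. (\<Sum>i\<in>UNIV. g i x * h $ i) * (exp_bump (n + 2) (\<phi> x) - real n * exp_bump (n + 1) (\<phi> x)))) (at x)"
        by (rule DERIV_compose_FDERIV[OF exp_bump_has_derivative g(2)])
      moreover have "(\<lambda>h. (\<Sum>i\<in>UNIV. g i x * h $ i) * (exp_bump (n + 2) (\<phi> x) - real n * exp_bump (n + 1) (\<phi> x)))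
          = (\<lambda>h. \<Sum>i\<in>UNIV. ?g i x * h $ i)"
        by (simp add: fun_eq_iff sum_distrib_right mult_ac)
      ultimately show ?thesis by (simp only: 2(2))
    qed
    with mem show ?thesis by (intro exI[of _ ?g] conjI allI)
  qed
qed

lemma smooth_in_alg: "smooth f \<Longrightarrow> f \<in> alg bump_closure"
  by (intro alg.base) (auto simp: bump_closure_def)

lemma smooth_add: "smooth f \<Longrightarrow> smooth g \<Longrightarrow> smooth (\<lambda>x. f x + g x)"
  by (rule smooth_bump_closure, rule alg.add) (simp_all add: smooth_in_alg)

lemma smooth_mult: "smooth f \<Longrightarrow> smooth g \<Longrightarrow> smooth (\<lambda>x. f x * g x)"
  by (rule smooth_bump_closure, rule alg.mult) (simp_all add: smooth_in_alg)

lemma smooth_exp_bump: "smooth f \<Longrightarrow> smooth (\<lambda>x. exp_bump n (f x))"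
  by (rule smooth_bump_closure, rule alg.base) (auto simp: bump_closure_def)

lemma smooth_prod: "finite I \<Longrightarrow> (\<And>i. i \<in> I \<Longrightarrow> smooth (f i)) \<Longrightarrow> smooth (\<lambda>x. \<Prod>i\<in>I. f i x)"
  by (induction I rule: finite_induct) (simp_all add: smooth_const smooth_mult)

section \<open>Test functions\<close>

lemma grad_unique: "(\<phi> has_derivative (\<lambda>h. g \<bullet> h)) (at x) \<Longrightarrow> grad \<phi> x = g"
  by (rule vec_eq_iff[THEN iffD2], rule allI, rule grad_eqI) (simp add: inner_vec_def)

lemma grad_mult:
  assumes "smooth f" "smooth g"
  shows "grad (\<lambda>x. f x * g x) x = f x *\<^sub>R grad g x + g x *\<^sub>R grad f x"
proof (rule grad_unique)
  have "(\<lambda>h. f x * (grad g x \<bullet> h) + (grad f x \<bullet> h) * g x)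
      = (\<lambda>h. (f x *\<^sub>R grad g x + g x *\<^sub>R grad f x) \<bullet> h)"
    by (simp add: fun_eq_iff inner_add_left mult.commute)
  then show "((\<lambda>x. f x * g x) has_derivative (\<lambda>h. (f x *\<^sub>R grad g x + g x *\<^sub>R grad f x) \<bullet> h)) (at x)"
    using has_derivative_mult[OF smooth_has_derivative_inner[OF assms(1), of x]
        smooth_has_derivative_inner[OF assms(2), of x]] by simp
qed

lemma grad_eq_0:
  assumes "open S" "x \<in> S" "\<And>y. y \<in> S \<Longrightarrow> \<phi> y = 0"
  shows "grad \<phi> x = 0"
proof (rule grad_unique)
  have "((\<lambda>y. 0) has_derivative (\<lambda>h. 0)) (at x)" by simp
  then have "(\<phi> has_derivative (\<lambda>h. 0)) (at x)"
    by (rule has_derivative_transform_within_open) (use assms in auto)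
  then show "(\<phi> has_derivative (\<lambda>h. 0 \<bullet> h)) (at x)" by simp
qed

lemma test_functionsD:
  assumes "\<phi> \<in> test_functions U"
  shows "smooth \<phi>" "compact (closure {x. \<phi> x \<noteq> 0})" "closure {x. \<phi> x \<noteq> 0} \<subseteq> U"
  using assms by (auto simp: test_functions_def)

lemma test_function_vanish:
  assumes "x \<notin> closure {x. \<phi> x \<noteq> 0}"
  shows "\<phi> x = 0" "grad \<phi> x = 0"
proof -
  have 0: "\<phi> y = 0" if "y \<in> - closure {x. \<phi> x \<noteq> 0}" for y
    using that closure_subset[of "{x. \<phi> x \<noteq> 0}"] by (auto dest: subsetD)
  have x: "x \<in> - closure {x. \<phi> x \<noteq> 0}" unfolding Compl_iff by (rule assms)
  then show "\<phi> x = 0" by (rule 0)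
  show "grad \<phi> x = 0"
    by (rule grad_eq_0[of "- closure {x. \<phi> x \<noteq> 0}"]) (rule 0 x open_Compl closed_closure | assumption)+
qed

lemma test_functions_mono: "\<phi> \<in> test_functions U \<Longrightarrow> U \<subseteq> V \<Longrightarrow> \<phi> \<in> test_functions V"
  by (auto simp: test_functions_def)

lemma test_functions_mult:
  assumes "\<phi> \<in> test_functions U" "smooth g"
  shows "(\<lambda>x. g x * \<phi> x) \<in> test_functions U"
proof -
  have sub: "closure {x. g x * \<phi> x \<noteq> 0} \<subseteq> closure {x. \<phi> x \<noteq> 0}" by (rule closure_mono) auto
  have "bounded {x. \<phi> x \<noteq> 0}" using test_functionsD(2)[OF assms(1)] by (simp only: compact_closure)
  then have "bounded {x. g x * \<phi> x \<noteq> 0}" by (rule bounded_subset) auto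
  then have "compact (closure {x. g x * \<phi> x \<noteq> 0})" by (simp only: compact_closure)
  moreover have "closure {x. g x * \<phi> x \<noteq> 0} \<subseteq> U"
    using sub test_functionsD(3)[OF assms(1)] by (rule subset_trans)
  ultimately show ?thesis
    using smooth_mult[OF assms(2) test_functionsD(1)[OF assms(1)]] by (simp only: test_functions_def mem_Collect_eq)
qed

lemma test_functions_L2:
  assumes "\<phi> \<in> test_functions V" "open U" "bounded U"
  shows "\<phi> \<in> L2 U" "grad \<phi> \<in> L2 U"
  using assms by (auto intro!: continuous_L2 smooth_continuous grad_continuous dest: test_functionsD)

text \<open>
  By translation invariance of the Lebesgue measure the integral of every difference quotient vanishes,
  and the quotients converge dominatedly because \<open>\<phi>\<close> is Lipschitz with bounded support.
\<close>

lemma integral_partial_derivative_eq_0: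
  assumes \<phi>: "smooth \<phi>" and supp: "bounded {x. \<phi> x \<noteq> 0}"
  shows "(LINT x|lborel. grad \<phi> x $ i) = 0"
proof -
  define e :: "real ^ 'a" where "e = axis i 1"
  have ne: "norm e = 1" by (simp add: e_def)
  obtain R where R: "\<And>x. \<phi> x \<noteq> 0 \<Longrightarrow> norm x \<le> R"
    using supp unfolding bounded_iff by blast
  have gr0: "grad \<phi> x = 0" if "norm x > R" for x
    by (rule grad_eq_0[of "- cball 0 R"]) (use that R in \<open>auto simp: not_le[symmetric]\<close>)
  obtain C where C0: "0 \<le> C" and C: "\<And>x. x \<in> cball 0 R \<Longrightarrow> norm (grad \<phi> x) \<le> C"
    using continuous_bounded_on[OF grad_continuous[OF \<phi>] bounded_cball] by metis
  have C: "norm (grad \<phi> x) \<le> C" for x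
    using C[of x] gr0[of x] C0 by (cases "norm x \<le> R") auto
  have lip: "\<bar>\<phi> y - \<phi> x\<bar> \<le> C * norm (y - x)" for x y
  proof -
    have "norm (\<phi> y - \<phi> x) \<le> C * norm (y - x)"
    proof (rule differentiable_bound[where f'="\<lambda>x h. grad \<phi> x \<bullet> h" and S=UNIV])
      show "onorm ((\<bullet>) (grad \<phi> x)) \<le> C" for x
        using Cauchy_Schwarz_ineq2[of "grad \<phi> x"] C[of x]
        by (intro onorm_le) (metis mult_right_mono norm_ge_zero order_trans real_norm_def)
    qed (auto intro!: smooth_has_derivative_inner \<phi>)
    then show ?thesis by simp
  qed
  have \<phi>m[measurable]: "\<phi> \<in> borel_measurable borel"
    by (intro borel_measurable_continuous_onI smooth_continuous \<phi>)
  have gm[measurable]: "(\<lambda>x. grad \<phi> x $ i) \<in> borel_measurable borel"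
    by (intro borel_measurable_continuous_onI smooth_continuous smooth_grad \<phi>)
  define ball :: "(real ^ 'a) set" where "ball = cball 0 (R + 1)"
  have bint: "integrable lborel (indicator ball :: real ^ 'a \<Rightarrow> real)"
    using emeasure_bounded_finite[OF bounded_cball, of 0 "R + 1"] by (simp add: integrable_indicator_iff ball_def)
  define f where "f n x = (\<phi> (inverse (real (Suc n)) *\<^sub>R e + x) - \<phi> x) * real (Suc n)" for n x
  have "(\<lambda>n. LINT x|lborel. f n x) \<longlonglongrightarrow> (LINT x|lborel. grad \<phi> x $ i)"
  proof (rule integral_dominated_convergence[where w="\<lambda>x. C * indicator ball x"])
    show "f n \<in> borel_measurable lborel" for n unfolding f_def by measurable
    show "integrable lborel (\<lambda>x. C * indicator ball x)" using bint by simp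
    show "AE x in lborel. (\<lambda>n. f n x) \<longlonglongrightarrow> grad \<phi> x $ i"
    proof (intro AE_I2)
      fix x
      have "((\<lambda>t. \<phi> (t *\<^sub>R e + x)) has_real_derivative grad \<phi> (0 *\<^sub>R e + x) \<bullet> (1 *\<^sub>R e)) (at 0)"
        unfolding has_field_derivative_def
        by (rule has_derivative_eq_rhs, rule has_derivative_compose[OF _ smooth_has_derivative_inner[OF \<phi>]])
          (auto intro!: derivative_eq_intros)
      then have "((\<lambda>t. \<phi> (t *\<^sub>R e + x)) has_real_derivative grad \<phi> x $ i) (at 0)"
        by (simp add: e_def inner_axis)
      then have "((\<lambda>t. (\<phi> (t *\<^sub>R e + x) - \<phi> x) / t) \<longlongrightarrow> grad \<phi> x $ i) (at 0)"
        by (simp add: DERIV_def)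
      moreover have "filterlim (\<lambda>n. inverse (real (Suc n))) (at 0) sequentially"
        by (intro filterlim_atI LIMSEQ_inverse_real_of_nat) auto
      ultimately have "(\<lambda>n. (\<phi> (inverse (real (Suc n)) *\<^sub>R e + x) - \<phi> x) / inverse (real (Suc n)))
          \<longlonglongrightarrow> grad \<phi> x $ i" by (rule filterlim_compose)
      then show "(\<lambda>n. f n x) \<longlonglongrightarrow> grad \<phi> x $ i" by (simp add: f_def field_simps)
    qed
    show "AE x in lborel. norm (f n x) \<le> C * indicator ball x" for n
    proof (intro AE_I2)
      fix x
      let ?h = "inverse (real (Suc n))"
      have h: "0 < ?h" "?h \<le> 1" by (auto simp: field_simps)
      show "norm (f n x) \<le> C * indicator ball x"
      proof (cases "norm x \<le> R + 1")
        case True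
        have "\<bar>\<phi> (?h *\<^sub>R e + x) - \<phi> x\<bar> \<le> C * ?h" using lip[of "?h *\<^sub>R e + x" x] ne h by simp
        then have "\<bar>\<phi> (?h *\<^sub>R e + x) - \<phi> x\<bar> * real (Suc n) \<le> C * ?h * real (Suc n)"
          by (rule mult_right_mono) simp
        also have "C * ?h * real (Suc n) = C" by simp
        finally have "norm (f n x) \<le> C" by (simp only: f_def real_norm_def abs_mult abs_of_nat)
        then show ?thesis using True by (simp add: ball_def)
      next
        case False
        have "norm x \<le> norm (?h *\<^sub>R e + x) + norm (?h *\<^sub>R e)"
          using norm_triangle_ineq4[of "?h *\<^sub>R e + x" "?h *\<^sub>R e"] by simp
        then have "norm (?h *\<^sub>R e + x) > R" using False h ne by simp
        then have "\<phi> (?h *\<^sub>R e + x) = 0" "\<phi> x = 0" using R False by force+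
        then show ?thesis using C0 by (simp add: f_def)
      qed
    qed
  qed auto
  moreover have "(LINT x|lborel. f n x) = 0" for n
  proof -
    let ?v = "inverse (real (Suc n)) *\<^sub>R e"
    have i1: "integrable lborel \<phi>"
    proof -
      obtain B where B: "\<And>x. x \<in> cball 0 (R+1) \<Longrightarrow> norm (\<phi> x) \<le> B"
        using continuous_bounded_on[OF smooth_continuous[OF \<phi>] bounded_cball] by metis
      show ?thesis
      proof (rule Bochner_Integration.integrable_bound)
      show "integrable lborel (\<lambda>x. B * indicator ball x :: real)" using bint by simp
      show "AE x in lborel. norm (\<phi> x) \<le> norm (B * indicator ball x)"
        using B R by (intro AE_I2) (force simp: indicator_def ball_def)
      qed simp
    qed
    have i2: "integrable lborel (\<lambda>x. \<phi> (?v + x))" "(LINT x|lborel. \<phi> (?v + x)) = (LINT x|lborel. \<phi> x)"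
    proof -
      have "integrable (distr lborel borel ((+) ?v)) \<phi>" using i1 by (simp only: lborel_distr_plus)
      then show "integrable lborel (\<lambda>x. \<phi> (?v + x))" by (subst (asm) integrable_distr_eq) auto
      have "(LINT x|lborel. \<phi> x) = (LINT x|distr lborel borel ((+) ?v). \<phi> x)" by (simp only: lborel_distr_plus)
      also have "\<dots> = (LINT x|lborel. \<phi> (?v + x))" by (subst integral_distr) auto
      finally show "(LINT x|lborel. \<phi> (?v + x)) = (LINT x|lborel. \<phi> x)" by simp
    qed
    show ?thesis using i1 i2 by (simp add: f_def)
  qed
  ultimately have "(\<lambda>n. 0 :: real) \<longlonglongrightarrow> (LINT x|lborel. grad \<phi> x $ i)" by simp
  then show ?thesis using LIMSEQ_unique tendsto_const by metis
qed

lemma integral_grad_test_function: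
  assumes "\<phi> \<in> test_functions U" "open U" "bounded U"
  shows "(LINT x|lebesgue_on U. grad \<phi> x) = 0"
proof -
  interpret finite_measure "lebesgue_on U" using assms by (intro finite_measure_bounded_open)
  note \<phi> = test_functionsD[OF assms(1)]
  have int: "integrable (lebesgue_on U) (grad \<phi>)"
  proof -
    obtain C where C: "\<And>x. x \<in> U \<Longrightarrow> norm (grad \<phi> x) \<le> C"
      using continuous_bounded_on[OF grad_continuous[OF \<phi>(1)] assms(3)] by metis
    show ?thesis
      by (rule integrable_const_bound[of _ C])
        (use C assms \<phi> in \<open>auto intro!: continuous_measurable_on grad_continuous AE_I2\<close>)
  qed
  have "(LINT x|lebesgue_on U. grad \<phi> x) $ i = 0" for i
  proof -
    have "(LINT x|lebesgue_on U. grad \<phi> x) $ i = (LINT x|lebesgue_on U. grad \<phi> x $ i)"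
      using integral_bounded_linear[OF bounded_linear_vec_nth int, of i] by simp
    also have "\<dots> = (LINT x|lebesgue. (if x \<in> U then grad \<phi> x $ i else 0))"
      using assms by (simp add: Lebesgue_Measure.integral_restrict_UNIV)
    also have "\<dots> = (LINT x|lebesgue. grad \<phi> x $ i)"
    proof (rule Bochner_Integration.integral_cong[OF refl])
      fix x
      show "(if x \<in> U then grad \<phi> x $ i else 0) = grad \<phi> x $ i"
        using test_function_vanish(2)[of x \<phi>] subsetD[OF \<phi>(3), of x] by (metis zero_index)
    qed
    also have "\<dots> = (LINT x|lborel. grad \<phi> x $ i)"
      by (intro integral_completion) (simp add: borel_measurable_continuous_onI smooth_continuous smooth_grad \<phi>)
    also have "\<dots> = 0"
    proof (rule integral_partial_derivative_eq_0[OF \<phi>(1)])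
      show "bounded {x. \<phi> x \<noteq> 0}"
        using \<phi>(2) by (simp only: compact_closure)
    qed
    finally show ?thesis .
  qed
  then show ?thesis by (simp add: vec_eq_iff)
qed

section \<open>The fundamental lemma of the calculus of variations\<close>

text \<open>
  A smooth function supported in the box; it increases to the indicator of the open box as \<open>k\<close> grows.
\<close>

definition box_bump :: "real \<Rightarrow> real ^ 'd \<Rightarrow> real ^ 'd \<Rightarrow> real ^ 'd \<Rightarrow> real" where
  "box_bump k a b x = (\<Prod>i\<in>UNIV. exp_bump 0 (k * (x $ i - a $ i)) * exp_bump 0 (k * (b $ i - x $ i)))"

lemma smooth_box_bump: "smooth (box_bump k a b)"
  unfolding box_bump_def diff_conv_add_uminus
  by (intro smooth_prod finite smooth_mult smooth_exp_bump smooth_add smooth_const)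
    (auto simp: algebra_simps intro!: smooth_add smooth_const smooth_coord smooth_mult[of "\<lambda>x. -1", simplified])

lemma exp_bump_0_range: "0 \<le> exp_bump 0 t" "exp_bump 0 t \<le> 1"
  by (simp_all add: exp_bump_def)

lemma box_bump_range: "0 \<le> box_bump k a b x" "box_bump k a b x \<le> 1"
  unfolding box_bump_def
  by (auto intro!: prod_nonneg prod_le_1 mult_nonneg_nonneg mult_le_one exp_bump_0_range)

lemma box_bump_tendsto: "(\<lambda>n. box_bump (real (Suc n)) a b x) \<longlonglongrightarrow> indicator (box a b) x"
proof -
  have e: "(\<lambda>n. exp_bump 0 (real (Suc n) * t)) \<longlonglongrightarrow> (if 0 < t then 1 else 0)" for t :: real
  proof (cases "0 < t")
    case True
    have "(\<lambda>n. exp (- (inverse (real (Suc n)) * inverse t))) \<longlonglongrightarrow> exp (- (0 * inverse t))"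
      by (intro tendsto_intros LIMSEQ_inverse_real_of_nat)
    then show ?thesis using True by (simp add: exp_bump_def)
  next
    case False
    then have "exp_bump 0 (real (Suc n) * t) = 0" for n by (simp add: exp_bump_def zero_less_mult_iff)
    then show ?thesis using False by simp
  qed
  have "(\<lambda>n. box_bump (real (Suc n)) a b x) \<longlonglongrightarrow>
      (\<Prod>i\<in>UNIV. (if 0 < x $ i - a $ i then 1 else 0) * (if 0 < b $ i - x $ i then 1 else 0))"
    unfolding box_bump_def by (intro tendsto_prod tendsto_mult e)
  also have "(\<Prod>i\<in>UNIV. (if 0 < x $ i - a $ i then 1 else 0) * (if 0 < b $ i - x $ i then 1 else 0))
      = (indicator (box a b) x :: real)"
  proof (cases "x \<in> box a b")
    case True
    then show ?thesis by (auto simp: mem_box_cart intro!: prod.neutral)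
  next
    case False
    then obtain i where "\<not> (a $ i < x $ i \<and> x $ i < b $ i)" by (auto simp: mem_box_cart)
    then have "(\<Prod>i\<in>UNIV. (if 0 < x $ i - a $ i then 1 else 0) * (if 0 < b $ i - x $ i then 1 else 0)) = (0::real)"
      by (intro prod_zero) auto
    then show ?thesis using False by simp
  qed
  finally show ?thesis .
qed

lemma box_bump_test_function:
  assumes "0 < k" "cbox a b \<subseteq> U"
  shows "box_bump k a b \<in> test_functions U"
proof -
  have sub: "{x. box_bump k a b x \<noteq> 0} \<subseteq> cbox a b"
  proof
    fix x assume "x \<in> {x. box_bump k a b x \<noteq> 0}"
    then have "exp_bump 0 (k * (x $ i - a $ i)) \<noteq> 0 \<and> exp_bump 0 (k * (b $ i - x $ i)) \<noteq> 0" for i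
      by (auto simp: box_bump_def)
    then have "a $ i \<le> x $ i \<and> x $ i \<le> b $ i" for i
      using assms(1) by (metis exp_bump_def diff_gt_0_iff_gt less_imp_le zero_less_mult_pos)
    then show "x \<in> cbox a b" by (simp add: mem_box_cart)
  qed
  then have "bounded {x. box_bump k a b x \<noteq> 0}" using bounded_cbox bounded_subset by blast
  then have "compact (closure {x. box_bump k a b x \<noteq> 0})" by (simp only: compact_closure)
  moreover have "closure {x. box_bump k a b x \<noteq> 0} \<subseteq> U"
    using closure_minimal[OF sub closed_cbox] assms(2) by (rule subset_trans)
  ultimately show ?thesis using smooth_box_bump[of k a b] by (simp only: test_functions_def mem_Collect_eq)
qed

text \<open>
  Indicators of boxes are bounded pointwise limits of test functions, so the integral over every box in
  \<open>U\<close> vanishes; almost every point is a Lebesgue point.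
\<close>

theorem fundamental_lemma:
  fixes h :: "real ^ 'd \<Rightarrow> real"
  assumes U: "open U" and h: "integrable (lebesgue_on U) h"
    and orth: "\<And>\<phi>. \<phi> \<in> test_functions U \<Longrightarrow> (LINT x|lebesgue_on U. \<phi> x * h x) = 0"
  shows "AE x in lebesgue_on U. h x = 0"
proof -
  define H where "H x = (if x \<in> U then h x else 0)" for x
  have Hi: "integrable lebesgue H"
    unfolding H_def using h U by (simp add: Lebesgue_Measure.integrable_restrict_UNIV)
  have HU: "H absolutely_integrable_on UNIV" using Hi by (simp add: set_integrable_def)
  have Hcb: "H absolutely_integrable_on cbox a b" for a b
    using HU by (rule set_integrable_subset) auto
  have box0: "integral (cbox a b) H = 0" if sub: "cbox a b \<subseteq> U" for a b
  proof -
    have hm: "h \<in> borel_measurable (lebesgue_on U)" using h by auto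
    have "(\<lambda>n. LINT x|lebesgue_on U. box_bump (real (Suc n)) a b x * h x)
        \<longlonglongrightarrow> (LINT x|lebesgue_on U. indicator (box a b) x * h x)"
    proof (rule integral_dominated_convergence[where w="\<lambda>x. \<bar>h x\<bar>"])
      have [measurable]: "box_bump (real (Suc n)) a b \<in> borel_measurable (lebesgue_on U)" for n
        using smooth_continuous[OF smooth_box_bump] U by (rule continuous_measurable_on)
      have [measurable]: "(\<lambda>x. indicator (box a b) x :: real) \<in> borel_measurable (lebesgue_on U)"
        by (rule borel_measurable_LIMSEQ_real[OF box_bump_tendsto]) measurable
      show "(\<lambda>x. indicator (box a b) x * h x) \<in> borel_measurable (lebesgue_on U)" using hm by measurable
      show "(\<lambda>x. box_bump (real (Suc n)) a b x * h x) \<in> borel_measurable (lebesgue_on U)" for n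
        using hm by measurable
      show "integrable (lebesgue_on U) (\<lambda>x. \<bar>h x\<bar>)" using h by simp
      show "AE x in lebesgue_on U. (\<lambda>n. box_bump (real (Suc n)) a b x * h x) \<longlonglongrightarrow> indicator (box a b) x * h x"
        by (intro AE_I2 tendsto_mult box_bump_tendsto tendsto_const)
      show "AE x in lebesgue_on U. norm (box_bump (real (Suc n)) a b x * h x) \<le> \<bar>h x\<bar>" for n
        using box_bump_range[of "real (Suc n)" a b]
        by (intro AE_I2) (simp add: abs_mult mult_left_le_one_le)
    qed
    moreover have "(LINT x|lebesgue_on U. box_bump (real (Suc n)) a b x * h x) = 0" for n
      using sub by (intro orth box_bump_test_function) auto
    ultimately have "(LINT x|lebesgue_on U. indicator (box a b) x * h x) = 0"
      by (simp add: LIMSEQ_const_iff)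
    also have "(LINT x|lebesgue_on U. indicator (box a b) x * h x)
        = (LINT x|lebesgue. (if x \<in> U then indicator (box a b) x * h x else 0))"
      using U by (simp add: Lebesgue_Measure.integral_restrict_UNIV)
    also have "\<dots> = (LINT x:box a b|lebesgue. H x)"
      unfolding set_lebesgue_integral_def by (intro Bochner_Integration.integral_cong) (auto simp: H_def)
    also have "\<dots> = integral (box a b) H"
      by (rule set_lebesgue_integral_eq_integral, rule set_integrable_subset[OF HU]) auto
    finally show ?thesis by (simp add: integral_open_interval)
  qed
  obtain N where N: "negligible N"
    and leb: "\<And>x e. x \<notin> N \<Longrightarrow> 0 < e \<Longrightarrow> \<exists>d>0. \<forall>k. 0 < k \<and> k < d \<longrightarrow>
      norm (integral (cbox x (x + k *\<^sub>R One)) H /\<^sub>R k ^ DIM(real ^ 'd) - H x) < e"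
    using integrable_ccontinuous_explicit[of H] Hcb set_lebesgue_integral_eq_integral(1) by metis
  have zero: "h x = 0" if x: "x \<in> U" "x \<notin> N" for x
  proof (rule ccontr)
    assume ne: "h x \<noteq> 0"
    then obtain d where d: "0 < d" and dd: "\<And>k. 0 < k \<Longrightarrow> k < d \<Longrightarrow>
        norm (integral (cbox x (x + k *\<^sub>R One)) H /\<^sub>R k ^ DIM(real ^ 'd) - H x) < \<bar>h x\<bar>"
      using leb[OF x(2), of "\<bar>h x\<bar>"] by auto
    obtain r where r: "0 < r" "cball x r \<subseteq> U" using U x(1) open_contains_cball by blast
    let ?o = "norm (One :: real ^ 'd)"
    define k where "k = min (d / 2) (r / (1 + ?o))"
    have o: "0 < 1 + ?o" by (simp add: add_pos_nonneg)
    have k: "0 < k" "k < d" "k * ?o \<le> r"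
    proof -
      show "0 < k" "k < d" using d r o by (auto simp: k_def)
      have "k * ?o \<le> k * (1 + ?o)" using \<open>0 < k\<close> by simp
      also have "\<dots> \<le> r / (1 + ?o) * (1 + ?o)" using o by (intro mult_right_mono) (auto simp: k_def)
      finally show "k * ?o \<le> r" using o by simp
    qed
    have "cbox x (x + k *\<^sub>R One) \<subseteq> cball x r"
    proof
      fix y assume y: "y \<in> cbox x (x + k *\<^sub>R One)"
      have "norm (y - x) \<le> norm (k *\<^sub>R (One :: real ^ 'd))"
        using y k(1) by (intro norm_le_componentwise) (auto simp: mem_box inner_simps)
      then show "y \<in> cball x r" using k by (simp add: dist_norm norm_minus_commute)
    qed
    then have "integral (cbox x (x + k *\<^sub>R One)) H = 0" using r(2) by (intro box0) auto
    then show False using dd[OF k(1,2)] x(1) by (simp add: H_def)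
  qed
  have "N \<in> null_sets lebesgue" using N by (simp add: negligible_iff_null_sets)
  then have "AE x in lebesgue. x \<notin> N" by (rule AE_not_in)
  then show ?thesis using U zero by (subst AE_restrict_space_iff) (auto elim: eventually_mono)
qed

section \<open>Weak derivatives\<close>

lemma test_function_outside:
  assumes "\<phi> \<in> test_functions U" "x \<notin> U"
  shows "\<phi> x = 0" "grad \<phi> x = 0"
proof -
  have "x \<notin> closure {x. \<phi> x \<noteq> 0}" using test_functionsD(3)[OF assms(1)] assms(2) by (rule contra_subsetD)
  then show "\<phi> x = 0" "grad \<phi> x = 0" by (rule test_function_vanish)+
qed

locale bounded_open =
  fixes U :: "(real ^ 'd) set"
  assumes open_U: "open U" and bounded_U: "bounded U"
begin

lemma test_L2: "\<phi> \<in> test_functions U \<Longrightarrow> \<phi> \<in> L2 U" "\<phi> \<in> test_functions U \<Longrightarrow> grad \<phi> \<in> L2 U"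
  using test_functions_L2 open_U bounded_U by blast+

lemma smooth_L2: "smooth \<phi> \<Longrightarrow> \<phi> \<in> L2 U" "smooth \<phi> \<Longrightarrow> grad \<phi> \<in> L2 U"
  by (auto intro!: continuous_L2 smooth_continuous grad_continuous open_U bounded_U)

lemma L2_orthogonal_test:
  fixes h :: "real ^ 'd \<Rightarrow> real"
  assumes "h \<in> L2 U" "\<And>\<phi>. \<phi> \<in> test_functions U \<Longrightarrow> L2_ip U h \<phi> = 0"
  shows "ae_eq U h (\<lambda>x. 0)"
proof -
  have "(\<lambda>x. 1::real) \<in> L2 U" by (intro continuous_L2 open_U bounded_U continuous_on_const)
  from L2_inner_integrable[OF assms(1) this] have "integrable (lebesgue_on U) h" by simp
  then show ?thesis
    unfolding ae_eq_def using assms(2)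
    by (intro fundamental_lemma open_U) (simp_all add: L2_ip_def mult.commute)
qed

text \<open>
  In this form both sides are \<open>L2\<close> inner products with fixed functions, hence linear and continuous in \<open>v\<close>
  and \<open>g\<close>.
\<close>

lemma has_weak_grad_iff:
  assumes v: "v \<in> L2 U"
  shows "has_weak_grad U v g \<longleftrightarrow> g \<in> L2 U \<and> (\<forall>\<phi>\<in>test_functions U. \<forall>i.
    L2_ip U v (\<lambda>x. grad \<phi> x $ i) = - L2_ip U g (\<lambda>x. \<phi> x *\<^sub>R axis i 1))"
proof -
  have "((LINT x | lebesgue_on U. v x *\<^sub>R grad \<phi> x) = - (LINT x | lebesgue_on U. \<phi> x *\<^sub>R g x)) \<longleftrightarrow>
      (\<forall>i. L2_ip U v (\<lambda>x. grad \<phi> x $ i) = - L2_ip U g (\<lambda>x. \<phi> x *\<^sub>R axis i 1))"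
    if g: "g \<in> L2 U" and \<phi>: "\<phi> \<in> test_functions U" for \<phi>
  proof -
    have 1: "(LINT x | lebesgue_on U. v x *\<^sub>R grad \<phi> x) $ i = L2_ip U v (\<lambda>x. grad \<phi> x $ i)" for i
      using integral_bounded_linear[OF bounded_linear_vec_nth L2_scaleR_integrable[OF v test_L2(2)[OF \<phi>]], of i]
      by (simp add: L2_ip_def)
    have 2: "(LINT x | lebesgue_on U. \<phi> x *\<^sub>R g x) $ i = L2_ip U g (\<lambda>x. \<phi> x *\<^sub>R axis i 1)" for i
      using integral_bounded_linear[OF bounded_linear_vec_nth L2_scaleR_integrable[OF test_L2(1)[OF \<phi>] g], of i]
      by (simp add: L2_ip_def inner_axis)
    show ?thesis by (simp add: vec_eq_iff 1 2)
  qed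
  then show ?thesis unfolding has_weak_grad_def by blast
qed

lemma has_weak_div_iff:
  "has_weak_div U q g \<longleftrightarrow> g \<in> L2 U \<and> (\<forall>\<phi>\<in>test_functions U. L2_ip U q (grad \<phi>) = - L2_ip U g \<phi>)"
  by (simp add: has_weak_div_def L2_ip_def mult.commute)

lemma test_axis_L2:
  assumes "\<phi> \<in> test_functions U"
  shows "(\<lambda>x. \<phi> x *\<^sub>R axis i 1) \<in> L2 U" "(\<lambda>x. grad \<phi> x $ i) \<in> L2 U"
  using L2_axis[OF test_L2(1)[OF assms]] L2_component[OF test_L2(2)[OF assms]] .

lemma has_weak_grad_comb:
  assumes "v \<in> L2 U" "v' \<in> L2 U" "has_weak_grad U v g" "has_weak_grad U v' g'"
  shows "has_weak_grad U (comb a v b v') (comb a g b g')"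
proof -
  note iff = has_weak_grad_iff[OF assms(1)] has_weak_grad_iff[OF assms(2)]
    has_weak_grad_iff[OF L2_comb[OF assms(1,2)]]
  show ?thesis
    using assms(3,4) unfolding iff
    by (auto intro: L2_comb simp: L2_ip_comb_left assms(1,2) test_axis_L2 algebra_simps)
qed

lemma has_weak_div_comb:
  assumes "q \<in> L2 U" "q' \<in> L2 U" "has_weak_div U q g" "has_weak_div U q' g'"
  shows "has_weak_div U (comb a q b q') (comb a g b g')"
  using assms(3,4) unfolding has_weak_div_iff
  by (auto intro: L2_comb simp: L2_ip_comb_left assms(1,2) test_L2 algebra_simps)

lemma has_weak_grad_unique:
  assumes v: "v \<in> L2 U" and g: "has_weak_grad U v g" "has_weak_grad U v g'"
  shows "ae_eq U g g'"
proof -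
  have L2: "g \<in> L2 U" "g' \<in> L2 U" using g by (auto simp: has_weak_grad_def)
  have "ae_eq U (\<lambda>x. comb 1 g (-1) g' x $ i) (\<lambda>x. 0)" for i
  proof (rule L2_orthogonal_test)
    show "(\<lambda>x. comb 1 g (-1) g' x $ i) \<in> L2 U" by (intro L2_component L2_comb L2)
    fix \<phi> assume \<phi>: "\<phi> \<in> test_functions U"
    have "L2_ip U g (\<lambda>x. \<phi> x *\<^sub>R axis i 1) = L2_ip U g' (\<lambda>x. \<phi> x *\<^sub>R axis i 1)"
      using g \<phi> unfolding has_weak_grad_iff[OF v] by (metis neg_equal_iff_equal)
    then show "L2_ip U (\<lambda>x. comb 1 g (-1) g' x $ i) \<phi> = 0"
      using \<phi> by (simp add: L2_ip_axis[symmetric] L2_ip_comb_left L2 test_axis_L2)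
  qed
  then have "AE x in lebesgue_on U. \<forall>i\<in>UNIV. comb 1 g (-1) g' x $ i = 0"
    unfolding ae_eq_def by (subst AE_finite_all) auto
  then show ?thesis unfolding ae_eq_def by eventually_elim (auto simp: comb_def vec_eq_iff)
qed

lemma has_weak_div_unique:
  assumes g: "has_weak_div U q g" "has_weak_div U q g'"
  shows "ae_eq U g g'"
proof -
  have L2: "g \<in> L2 U" "g' \<in> L2 U" using g by (auto simp: has_weak_div_def)
  have "ae_eq U (comb 1 g (-1) g') (\<lambda>x. 0)"
  proof (rule L2_orthogonal_test)
    show "comb 1 g (-1) g' \<in> L2 U" by (intro L2_comb L2)
    fix \<phi> assume \<phi>: "\<phi> \<in> test_functions U"
    have "L2_ip U g \<phi> = L2_ip U g' \<phi>"
      using g \<phi> unfolding has_weak_div_iff by (metis neg_equal_iff_equal)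
    then show "L2_ip U (comb 1 g (-1) g') \<phi> = 0"
      using \<phi> by (simp add: L2_ip_comb_left L2 test_L2)
  qed
  then show ?thesis unfolding ae_eq_def by eventually_elim (auto simp: comb_def)
qed

text \<open>
  The weak gradient is a closed operator, because its defining identities pass to the limit.
\<close>

lemma has_weak_grad_limit:
  assumes X: "\<And>n. X n \<in> L2 U" "\<And>n. G n \<in> L2 U" "\<And>n. has_weak_grad U (X n) (G n)"
    and "x \<in> L2 U" "g \<in> L2 U"
    and "(\<lambda>n. L2_dist2 U (X n) x) \<longlonglongrightarrow> 0"
    and "(\<lambda>n. L2_dist2 U (G n) g) \<longlonglongrightarrow> 0"
  shows "has_weak_grad U x g"
  unfolding has_weak_grad_iff[OF \<open>x \<in> L2 U\<close>]
proof (intro conjI ballI allI)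
  fix \<phi> i assume \<phi>: "\<phi> \<in> test_functions U"
  have "(\<lambda>n. L2_ip U (X n) (\<lambda>x. grad \<phi> x $ i)) \<longlonglongrightarrow> L2_ip U x (\<lambda>x. grad \<phi> x $ i)"
    using assms \<phi> by (intro L2_ip_tendsto test_axis_L2) auto
  moreover have "(\<lambda>n. - L2_ip U (G n) (\<lambda>x. \<phi> x *\<^sub>R axis i 1)) \<longlonglongrightarrow> - L2_ip U g (\<lambda>x. \<phi> x *\<^sub>R axis i 1)"
    using assms \<phi> by (intro tendsto_minus L2_ip_tendsto test_axis_L2) auto
  moreover have "L2_ip U (X n) (\<lambda>x. grad \<phi> x $ i) = - L2_ip U (G n) (\<lambda>x. \<phi> x *\<^sub>R axis i 1)" for n
    using X(3)[of n] \<phi> unfolding has_weak_grad_iff[OF X(1)] by blast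
  ultimately show "L2_ip U x (\<lambda>x. grad \<phi> x $ i) = - L2_ip U g (\<lambda>x. \<phi> x *\<^sub>R axis i 1)"
    using LIMSEQ_unique by simp
qed (use assms in auto)

lemma has_weak_div_limit:
  assumes X: "\<And>n. X n \<in> L2 U" "\<And>n. G n \<in> L2 U" "\<And>n. has_weak_div U (X n) (G n)"
    and "x \<in> L2 U" "g \<in> L2 U"
    and "(\<lambda>n. L2_dist2 U (X n) x) \<longlonglongrightarrow> 0"
    and "(\<lambda>n. L2_dist2 U (G n) g) \<longlonglongrightarrow> 0"
  shows "has_weak_div U x g"
  unfolding has_weak_div_iff
proof (intro conjI ballI)
  fix \<phi> assume \<phi>: "\<phi> \<in> test_functions U"
  have "(\<lambda>n. L2_ip U (X n) (grad \<phi>)) \<longlonglongrightarrow> L2_ip U x (grad \<phi>)"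
    using assms \<phi> by (intro L2_ip_tendsto) (simp_all add: test_L2)
  moreover have "(\<lambda>n. - L2_ip U (G n) \<phi>) \<longlonglongrightarrow> - L2_ip U g \<phi>"
    using assms \<phi> by (intro tendsto_minus L2_ip_tendsto) (simp_all add: test_L2)
  moreover have "L2_ip U (X n) (grad \<phi>) = - L2_ip U (G n) \<phi>" for n
    using X(3)[of n] \<phi> unfolding has_weak_div_iff by blast
  ultimately show "L2_ip U x (grad \<phi>) = - L2_ip U g \<phi>"
    using LIMSEQ_unique by simp
qed (use assms in auto)

lemma H1D:
  assumes "v \<in> H1 U"
  shows "v \<in> L2 U" "has_weak_grad U v (weak_grad U v)" "weak_grad U v \<in> L2 U"
proof -
  show "v \<in> L2 U" using assms by (simp add: H1_def)
  show "has_weak_grad U v (weak_grad U v)"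
    unfolding weak_grad_def using assms by (intro someI_ex[of "has_weak_grad U v"]) (simp add: H1_def)
  then show "weak_grad U v \<in> L2 U" by (simp add: has_weak_grad_def)
qed

lemma HdivD:
  assumes "r \<in> Hdiv U"
  shows "r \<in> L2 U" "has_weak_div U r (weak_div U r)" "weak_div U r \<in> L2 U"
proof -
  show "r \<in> L2 U" using assms by (simp add: Hdiv_def)
  show "has_weak_div U r (weak_div U r)"
    unfolding weak_div_def using assms by (intro someI_ex[of "has_weak_div U r"]) (simp add: Hdiv_def)
  then show "weak_div U r \<in> L2 U" by (simp add: has_weak_div_def)
qed

lemma H1I: "v \<in> L2 U \<Longrightarrow> has_weak_grad U v g \<Longrightarrow> v \<in> H1 U"
  by (auto simp: H1_def)

lemma HdivI: "r \<in> L2 U \<Longrightarrow> has_weak_div U r g \<Longrightarrow> r \<in> Hdiv U"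
  by (auto simp: Hdiv_def)

lemma weak_grad_ae: "v \<in> L2 U \<Longrightarrow> has_weak_grad U v g \<Longrightarrow> ae_eq U (weak_grad U v) g"
  by (metis H1D(2) H1I has_weak_grad_unique)

lemma weak_div_ae: "r \<in> L2 U \<Longrightarrow> has_weak_div U r g \<Longrightarrow> ae_eq U (weak_div U r) g"
  by (metis HdivD(2) HdivI has_weak_div_unique)

lemma H1_comb: "v \<in> H1 U \<Longrightarrow> w \<in> H1 U \<Longrightarrow> comb a v b w \<in> H1 U"
  by (meson H1D H1I L2_comb has_weak_grad_comb)

lemma Hdiv_comb: "v \<in> Hdiv U \<Longrightarrow> w \<in> Hdiv U \<Longrightarrow> comb a v b w \<in> Hdiv U"
  by (meson HdivD HdivI L2_comb has_weak_div_comb)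

lemma weak_grad_comb:
  "v \<in> H1 U \<Longrightarrow> w \<in> H1 U \<Longrightarrow> ae_eq U (weak_grad U (comb a v b w)) (comb a (weak_grad U v) b (weak_grad U w))"
  by (meson H1D L2_comb has_weak_grad_comb weak_grad_ae)

lemma weak_div_comb:
  "v \<in> Hdiv U \<Longrightarrow> w \<in> Hdiv U \<Longrightarrow> ae_eq U (weak_div U (comb a v b w)) (comb a (weak_div U v) b (weak_div U w))"
  by (meson HdivD L2_comb has_weak_div_comb weak_div_ae)

lemma smooth_has_weak_grad:
  assumes f: "smooth f"
  shows "has_weak_grad U f (grad f)"
  unfolding has_weak_grad_def
proof (intro conjI ballI)
  show "grad f \<in> L2 U" using f by (rule smooth_L2)
  fix \<phi> assume \<phi>: "\<phi> \<in> test_functions U"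
  have "integrable (lebesgue_on U) (\<lambda>x. f x *\<^sub>R grad \<phi> x)" "integrable (lebesgue_on U) (\<lambda>x. \<phi> x *\<^sub>R grad f x)"
    by (rule L2_scaleR_integrable; intro smooth_L2 test_L2 f \<phi>)+
  then have "(LINT x|lebesgue_on U. f x *\<^sub>R grad \<phi> x) + (LINT x|lebesgue_on U. \<phi> x *\<^sub>R grad f x)
      = (LINT x|lebesgue_on U. grad (\<lambda>x. f x * \<phi> x) x)"
    using grad_mult[OF f test_functionsD(1)[OF \<phi>]] by simp
  also have "\<dots> = 0"
    by (intro integral_grad_test_function test_functions_mult \<phi> f open_U bounded_U)
  finally show "(LINT x|lebesgue_on U. f x *\<^sub>R grad \<phi> x) = - (LINT x|lebesgue_on U. \<phi> x *\<^sub>R grad f x)"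
    by (simp add: add_eq_0_iff2)
qed

lemma smooth_axis_has_weak_div:
  assumes f: "smooth f"
  shows "has_weak_div U (\<lambda>x. f x *\<^sub>R axis i 1) (\<lambda>x. grad f x $ i)"
  unfolding has_weak_div_iff
proof (intro conjI ballI)
  show "(\<lambda>x. grad f x $ i) \<in> L2 U" using f by (intro L2_component smooth_L2)
  fix \<phi> assume \<phi>: "\<phi> \<in> test_functions U"
  have "L2_ip U f (\<lambda>x. grad \<phi> x $ i) = - L2_ip U (grad f) (\<lambda>x. \<phi> x *\<^sub>R axis i 1)"
    using smooth_has_weak_grad[OF f] \<phi> unfolding has_weak_grad_iff[OF smooth_L2(1)[OF f]] by blast
  then show "L2_ip U (\<lambda>x. f x *\<^sub>R axis i 1) (grad \<phi>) = - L2_ip U (\<lambda>x. grad f x $ i) \<phi>"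
    unfolding L2_ip_axis by (simp add: L2_ip_sym[of U _ "grad \<phi>"] L2_ip_axis L2_ip_sym[of U _ f])
qed

end

lemma has_weak_grad_restrict:
  assumes "bounded_open U" "bounded_open V" "U \<subseteq> V" "v \<in> L2 V" "has_weak_grad V v g"
  shows "has_weak_grad U v g"
proof -
  interpret U: bounded_open U by fact
  interpret V: bounded_open V by fact
  have vU: "v \<in> L2 U" using assms(3,4) U.open_U V.open_U by (auto intro: L2_subset[of v V U])
  have gV: "g \<in> L2 V" using assms(5) by (simp add: has_weak_grad_def)
  show ?thesis
    unfolding U.has_weak_grad_iff[OF vU]
  proof (intro conjI ballI allI)
    show "g \<in> L2 U" using gV assms(3) U.open_U V.open_U by (auto intro: L2_subset[of g V U])
    fix \<phi> i assume \<phi>: "\<phi> \<in> test_functions U"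
    have 0: "\<phi> x = 0" "grad \<phi> x = 0" if "x \<in> V - U" for x
      using test_function_outside[OF \<phi>] that by auto
    have "L2_ip V v (\<lambda>x. grad \<phi> x $ i) = - L2_ip V g (\<lambda>x. \<phi> x *\<^sub>R axis i 1)"
      using assms(5) test_functions_mono[OF \<phi> assms(3)] unfolding V.has_weak_grad_iff[OF assms(4)] by blast
    moreover have "L2_ip V v (\<lambda>x. grad \<phi> x $ i) = L2_ip U v (\<lambda>x. grad \<phi> x $ i)"
      using assms(3) U.open_U V.open_U by (rule L2_ip_restrict) (simp add: 0)
    moreover have "L2_ip V g (\<lambda>x. \<phi> x *\<^sub>R axis i 1) = L2_ip U g (\<lambda>x. \<phi> x *\<^sub>R axis i 1)"
      using assms(3) U.open_U V.open_U by (rule L2_ip_restrict) (simp add: 0)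
    ultimately show "L2_ip U v (\<lambda>x. grad \<phi> x $ i) = - L2_ip U g (\<lambda>x. \<phi> x *\<^sub>R axis i 1)" by simp
  qed
qed

lemma has_weak_div_restrict:
  assumes "bounded_open U" "bounded_open V" "U \<subseteq> V" "has_weak_div V q g"
  shows "has_weak_div U q g"
proof -
  interpret U: bounded_open U by fact
  interpret V: bounded_open V by fact
  have gV: "g \<in> L2 V" using assms(4) by (simp add: has_weak_div_def)
  show ?thesis
    unfolding U.has_weak_div_iff
  proof (intro conjI ballI)
    show "g \<in> L2 U" using gV assms(3) U.open_U V.open_U by (auto intro: L2_subset[of g V U])
    fix \<phi> assume \<phi>: "\<phi> \<in> test_functions U"
    have 0: "\<phi> x = 0" "grad \<phi> x = 0" if "x \<in> V - U" for x
      using test_function_outside[OF \<phi>] that by auto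
    have "L2_ip V q (grad \<phi>) = - L2_ip V g \<phi>"
      using assms(4) test_functions_mono[OF \<phi> assms(3)] unfolding V.has_weak_div_iff by blast
    moreover have "L2_ip V q (grad \<phi>) = L2_ip U q (grad \<phi>)" "L2_ip V g \<phi> = L2_ip U g \<phi>"
      using assms(3) U.open_U V.open_U by (auto intro!: L2_ip_restrict simp: 0)
    ultimately show "L2_ip U q (grad \<phi>) = - L2_ip U g \<phi>" by simp
  qed
qed

section \<open>Zero boundary values and Green's formula\<close>

text \<open>
  The duality pairing of the normal trace of \<open>r\<close> with the trace of \<open>v\<close>, written by Green's formula.
\<close>

definition green :: "(real ^ 'd) set \<Rightarrow> (real ^ 'd \<Rightarrow> real ^ 'd) \<Rightarrow> (real ^ 'd \<Rightarrow> real) \<Rightarrow> real" where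
  "green U r v = L2_ip U r (weak_grad U v) + L2_ip U (weak_div U r) v"

definition H1_ip :: "(real ^ 'd) set \<Rightarrow> (real ^ 'd \<Rightarrow> real) \<Rightarrow> (real ^ 'd \<Rightarrow> real) \<Rightarrow> real" where
  "H1_ip U v w = L2_ip U v w + L2_ip U (weak_grad U v) (weak_grad U w)"

lemma H1_norm_eq: "H1_norm U v = sqrt (H1_ip U v v)"
  by (simp add: H1_norm_def H1_ip_def L2_norm_power2)

text \<open>
  The derivative of the truncation \<open>t * exp_bump 0 (k\<^sup>2 * t\<^sup>2 - 1)\<close>, which vanishes for \<open>\<bar>t\<bar> \<le> 1/k\<close> and
  tends to \<open>t\<close> as \<open>k\<close> grows.
\<close>

definition trunc_coeff :: "real \<Rightarrow> real \<Rightarrow> real" where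
  "trunc_coeff k t = exp_bump 0 (k\<^sup>2 * t\<^sup>2 - 1) + 2 * (k\<^sup>2 * t\<^sup>2) * exp_bump 2 (k\<^sup>2 * t\<^sup>2 - 1)"

text \<open>
  In terms of \<open>x = 1 / (k\<^sup>2 * t\<^sup>2 - 1)\<close> the coefficient is \<open>(1 + 2 * (x + x\<^sup>2)) * exp (- x)\<close>, so the bound
  is uniform in \<open>k\<close>.
\<close>

lemma trunc_coeff_bound: "\<bar>trunc_coeff k t\<bar> \<le> 7"
proof (cases "0 < k\<^sup>2 * t\<^sup>2 - 1")
  case True
  define x where "x = inverse (k\<^sup>2 * t\<^sup>2 - 1)"
  have x: "0 < x" using True by (simp add: x_def)
  have kt: "k\<^sup>2 * t\<^sup>2 = inverse x + 1" using True by (simp add: x_def)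
  have eq: "trunc_coeff k t = (1 + 2 * (x + x\<^sup>2)) * exp (- x)"
    using True x unfolding trunc_coeff_def exp_bump_def x_def[symmetric] kt
    by (simp add: field_simps power2_eq_square)
  have "1 + x + x\<^sup>2 / 2 \<le> exp x" using exp_lower_Taylor_quadratic x by simp
  then have "2 + 2 * x + x\<^sup>2 \<le> 2 * exp x" by simp
  then have "1 + 2 * x + 2 * x\<^sup>2 \<le> 7 * exp x" using x zero_le_power2[of x] by linarith
  then have "1 + 2 * (x + x\<^sup>2) \<le> 7 * exp x" by (simp add: distrib_left)
  then have "(1 + 2 * (x + x\<^sup>2)) * exp (- x) \<le> 7" by (simp add: exp_minus field_simps)
  then show ?thesis using x by (simp add: eq)
next
  case False
  then show ?thesis by (simp add: trunc_coeff_def exp_bump_def)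
qed

lemma exp_bump_at_top: "((\<lambda>s. exp_bump 0 s) \<longlongrightarrow> 1) at_top" "((\<lambda>s. (s + 1) * exp_bump 2 s) \<longlongrightarrow> 0) at_top"
proof -
  have inv: "((\<lambda>s::real. inverse s) \<longlongrightarrow> 0) at_top" by (rule tendsto_inverse_0_at_top) (rule filterlim_ident)
  have "((\<lambda>s::real. exp (- inverse s)) \<longlongrightarrow> exp (- 0)) at_top" by (intro tendsto_intros inv)
  then have "((\<lambda>s::real. exp (- inverse s)) \<longlongrightarrow> 1) at_top" by simp
  then show "((\<lambda>s. exp_bump 0 s) \<longlongrightarrow> 1) at_top"
  proof (rule Lim_transform_eventually)
    show "\<forall>\<^sub>F s in at_top. exp (- inverse s) = exp_bump 0 s"
      using eventually_gt_at_top[of "0::real"] by eventually_elim (simp add: exp_bump_def)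
  qed
  have "((\<lambda>s::real. (inverse s + (inverse s)\<^sup>2) * exp (- inverse s)) \<longlongrightarrow> (0 + 0\<^sup>2) * exp (- 0)) at_top"
    by (intro tendsto_intros inv)
  then have "((\<lambda>s::real. (inverse s + (inverse s)\<^sup>2) * exp (- inverse s)) \<longlongrightarrow> 0) at_top" by simp
  then show "((\<lambda>s. (s + 1) * exp_bump 2 s) \<longlongrightarrow> 0) at_top"
  proof (rule Lim_transform_eventually)
    show "\<forall>\<^sub>F s in at_top. (inverse s + (inverse s)\<^sup>2) * exp (- inverse s) = (s + 1) * exp_bump 2 s"
      using eventually_gt_at_top[of "0::real"]
      by eventually_elim (simp add: exp_bump_def power2_eq_square distrib_right)
  qed
qed

lemma filterlim_square_scale:
  assumes "t \<noteq> 0"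
  shows "filterlim (\<lambda>n. (real (Suc n))\<^sup>2 * t\<^sup>2 - 1) at_top sequentially"
proof -
  have "filterlim (\<lambda>n. real (Suc n)) at_top sequentially"
    using filterlim_compose[OF filterlim_real_sequentially filterlim_Suc] .
  then have "filterlim (\<lambda>n. (real (Suc n))\<^sup>2) at_top sequentially"
    by (intro filterlim_pow_at_top) auto
  then have "filterlim (\<lambda>n. (real (Suc n))\<^sup>2 * t\<^sup>2) at_top sequentially"
    using assms by (intro filterlim_at_top_mult_tendsto_pos[OF tendsto_const]) auto
  then show ?thesis
    using filterlim_tendsto_add_at_top[OF tendsto_const[of "-1"]] by (simp add: add.commute)
qed

lemma trunc_coeff_tendsto: "(\<lambda>n. trunc_coeff (real (Suc n)) t) \<longlonglongrightarrow> (if t = 0 then 0 else 1)"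
proof (cases "t = 0")
  case True
  then show ?thesis by (simp add: trunc_coeff_def exp_bump_def)
next
  case False
  note f = filterlim_square_scale[OF False]
  have "(\<lambda>n. exp_bump 0 ((real (Suc n))\<^sup>2 * t\<^sup>2 - 1) + 2 * (((real (Suc n))\<^sup>2 * t\<^sup>2 - 1 + 1) *
      exp_bump 2 ((real (Suc n))\<^sup>2 * t\<^sup>2 - 1))) \<longlonglongrightarrow> 1 + 2 * 0"
    by (intro tendsto_intros filterlim_compose[OF exp_bump_at_top(1) f] filterlim_compose[OF exp_bump_at_top(2) f])
  then show ?thesis using False by (simp add: trunc_coeff_def mult.assoc)
qed

definition trunc :: "real \<Rightarrow> (real ^ 'd \<Rightarrow> real) \<Rightarrow> real ^ 'd \<Rightarrow> real" where
  "trunc k \<phi> x = \<phi> x * exp_bump 0 (k\<^sup>2 * (\<phi> x)\<^sup>2 - 1)"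

lemma smooth_trunc:
  assumes "smooth \<phi>" shows "smooth (trunc k \<phi>)"
proof -
  have "smooth (\<lambda>x. k\<^sup>2 * (\<phi> x * \<phi> x) + (-1))"
    by (rule smooth_add[OF smooth_mult[OF smooth_const smooth_mult[OF assms assms]] smooth_const])
  then have "smooth (\<lambda>x. \<phi> x * exp_bump 0 (k\<^sup>2 * (\<phi> x * \<phi> x) + (-1)))"
    by (rule smooth_mult[OF assms smooth_exp_bump])
  then show ?thesis by (simp add: trunc_def[abs_def] power2_eq_square)
qed

lemma grad_trunc:
  assumes \<phi>: "smooth \<phi>"
  shows "grad (trunc k \<phi>) x = trunc_coeff k (\<phi> x) *\<^sub>R grad \<phi> x"
proof (rule grad_unique)
  have "((\<lambda>t. t * exp_bump 0 (k\<^sup>2 * t\<^sup>2 - 1)) has_real_derivative trunc_coeff k t) (at t)" for t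
  proof -
    have "((\<lambda>t. k\<^sup>2 * t\<^sup>2 - 1) has_real_derivative k\<^sup>2 * (2 * t)) (at t)"
      by (auto intro!: derivative_eq_intros)
    from DERIV_chain2[OF exp_bump_has_derivative this, of 0]
    have "((\<lambda>t. exp_bump 0 (k\<^sup>2 * t\<^sup>2 - 1)) has_real_derivative
        exp_bump 2 (k\<^sup>2 * t\<^sup>2 - 1) * (k\<^sup>2 * (2 * t))) (at t)" by (simp add: numeral_2_eq_2)
    from DERIV_mult[OF DERIV_ident this] show ?thesis
      by (simp add: trunc_coeff_def power2_eq_square mult_ac)
  qed
  from DERIV_compose_FDERIV[OF this smooth_has_derivative_inner[OF \<phi>]]
  show "(trunc k \<phi> has_derivative (\<lambda>h. (trunc_coeff k (\<phi> x) *\<^sub>R grad \<phi> x) \<bullet> h)) (at x)"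
    by (simp add: trunc_def[abs_def] mult.commute)
qed

text \<open>
  Locally the function equals either \<open>\<psi>\<close> or zero, and so do all its derivatives.
\<close>

lemma smooth_cutoff:
  assumes "smooth \<psi>" and U: "open U" and S: "closed S" "S \<subseteq> U" and 0: "\<And>x. x \<in> U - S \<Longrightarrow> \<psi> x = 0"
  shows "smooth (\<lambda>x. if x \<in> U then \<psi> x else 0)"
proof (rule smooth_coinduct[of _ "{\<lambda>x. if x \<in> U then f x else 0 | f. smooth f \<and> (\<forall>x\<in>U - S. f x = 0)}"])
  show "(\<lambda>x. if x \<in> U then \<psi> x else 0) \<in> {\<lambda>x. if x \<in> U then f x else 0 | f. smooth f \<and> (\<forall>x\<in>U - S. f x = 0)}"
    using assms by blast
next
  fix g assume "g \<in> {\<lambda>x. if x \<in> U then f x else 0 | f. smooth f \<and> (\<forall>x\<in>U - S. f x = 0)}"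
  then obtain f where g: "g = (\<lambda>x. if x \<in> U then f x else 0)" and f: "smooth f" "\<And>x. x \<in> U - S \<Longrightarrow> f x = 0"
    by blast
  let ?G = "\<lambda>i x. if x \<in> U then grad f x $ i else 0"
  have gr0: "grad f x = 0" if "x \<in> U - S" for x
    by (rule grad_eq_0[of "U - S"]) (use that f U S in auto)
  have der: "(g has_derivative (\<lambda>h. \<Sum>i\<in>UNIV. ?G i x * h $ i)) (at x)" for x
  proof (cases "x \<in> S")
    case True
    have "(g has_derivative (\<lambda>h. \<Sum>i\<in>UNIV. grad f x $ i * h $ i)) (at x)"
      by (rule has_derivative_transform_within_open[OF smooth_grad(2)[OF f(1)] U]) (use True S in \<open>auto simp: g\<close>)
    moreover have "x \<in> U" using True S(2) by blast
    ultimately show ?thesis by simp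
  next
    case False
    have "((\<lambda>x. 0) has_derivative (\<lambda>h. 0)) (at x)" by simp
    then have "(g has_derivative (\<lambda>h. 0)) (at x)"
      by (rule has_derivative_transform_within_open[of _ _ _ _ "- S"]) (use False S f(2) in \<open>auto simp: g\<close>)
    then show ?thesis using gr0[of x] False by (cases "x \<in> U") auto
  qed
  have "?G i \<in> {\<lambda>x. if x \<in> U then f x else 0 | f. smooth f \<and> (\<forall>x\<in>U - S. f x = 0)}" for i
    using smooth_grad(1)[OF f(1), of i] gr0 by (intro CollectI exI[of _ "\<lambda>x. grad f x $ i"]) auto
  with der show "\<exists>g'. (\<forall>i. g' i \<in> {\<lambda>x. if x \<in> U then f x else 0 | f. smooth f \<and> (\<forall>x\<in>U - S. f x = 0)}) \<and>
      (\<forall>x. (g has_derivative (\<lambda>h. \<Sum>i\<in>UNIV. g' i x * h $ i)) (at x))"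
    by (intro exI[of _ ?G] conjI allI)
qed

context bounded_open
begin

text \<open>
  On the closure of \<open>U\<close> the set where \<open>\<bar>\<phi>\<bar> \<ge> 1/k\<close> is compact and does not meet the boundary.
\<close>

lemma trunc_test_function:
  assumes \<phi>: "smooth \<phi>" and 0: "\<And>x. x \<in> frontier U \<Longrightarrow> \<phi> x = 0" and k: "0 < k"
  shows "(\<lambda>x. if x \<in> U then trunc k \<phi> x else 0) \<in> test_functions U"
proof -
  define S where "S = closure U \<inter> {x. 1 \<le> k\<^sup>2 * (\<phi> x)\<^sup>2}"
  have clS: "closed S"
    unfolding S_def
    by (intro closed_Int closed_closure closed_Collect_le continuous_intros smooth_continuous \<phi>)
  have SU: "S \<subseteq> U"
  proof
    fix x assume x: "x \<in> S"
    show "x \<in> U"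
    proof (rule ccontr)
      assume "x \<notin> U"
      then have "x \<in> frontier U" using x open_U by (simp add: S_def frontier_def interior_open)
      then show False using 0 x by (simp add: S_def)
    qed
  qed
  have out: "trunc k \<phi> x = 0" if "x \<in> U - S" for x
  proof -
    have "x \<in> closure U" using that closure_subset by blast
    then have "k\<^sup>2 * (\<phi> x)\<^sup>2 < 1" using that by (simp add: S_def)
    then show ?thesis by (simp add: trunc_def exp_bump_def)
  qed
  have sub: "{x. (if x \<in> U then trunc k \<phi> x else 0) \<noteq> 0} \<subseteq> S"
    using out by auto
  have "bounded {x. (if x \<in> U then trunc k \<phi> x else 0) \<noteq> 0}"
    using bounded_subset[OF bounded_U subset_trans[OF sub SU]] .
  moreover have "closure {x. (if x \<in> U then trunc k \<phi> x else 0) \<noteq> 0} \<subseteq> U"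
    using closure_minimal[OF sub clS] SU by blast
  moreover have "smooth (\<lambda>x. if x \<in> U then trunc k \<phi> x else 0)"
    using smooth_trunc[OF \<phi>] open_U clS SU out by (rule smooth_cutoff)
  ultimately show ?thesis unfolding test_functions_def mem_Collect_eq compact_closure by blast
qed

lemma green_eq:
  assumes "r \<in> L2 U" "has_weak_div U r d" "v \<in> L2 U" "has_weak_grad U v g"
  shows "green U r v = L2_ip U r g + L2_ip U d v"
proof -
  have g: "g \<in> L2 U" and d: "d \<in> L2 U"
    using assms(2,4) by (simp_all add: has_weak_grad_def has_weak_div_def)
  have "L2_ip U r (weak_grad U v) = L2_ip U r g"
    by (rule L2_cong_ae[OF assms(1,1) H1D(3)[OF H1I[OF assms(3,4)]] g ae_eq_refl weak_grad_ae[OF assms(3,4)]])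
  moreover have "L2_ip U (weak_div U r) v = L2_ip U d v"
    by (rule L2_cong_ae[OF HdivD(3)[OF HdivI[OF assms(1,2)]] d assms(3,3) weak_div_ae[OF assms(1,2)] ae_eq_refl])
  ultimately show ?thesis by (simp add: green_def)
qed

lemma green_comb_right:
  assumes r: "r \<in> Hdiv U" and v: "v \<in> H1 U" and w: "w \<in> H1 U"
  shows "green U r (comb a v b w) = a * green U r v + b * green U r w"
proof -
  note r = HdivD(1,3,2)[OF r] and v = H1D(1,3,2)[OF v] and w = H1D(1,3,2)[OF w]
  have "green U r (comb a v b w) = L2_ip U r (comb a (weak_grad U v) b (weak_grad U w))
      + L2_ip U (weak_div U r) (comb a v b w)"
    using r v w by (intro green_eq L2_comb has_weak_grad_comb)
  then show ?thesis using r v w by (simp add: green_def L2_ip_comb_right algebra_simps)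
qed

lemma green_comb_left:
  assumes r: "r \<in> Hdiv U" and s: "s \<in> Hdiv U" and v: "v \<in> H1 U"
  shows "green U (comb a r b s) v = a * green U r v + b * green U s v"
proof -
  note r = HdivD(1,3,2)[OF r] and v = H1D(1,3,2)[OF v] and s = HdivD(1,3,2)[OF s]
  have "green U (comb a r b s) v = L2_ip U (comb a r b s) (weak_grad U v)
      + L2_ip U (comb a (weak_div U r) b (weak_div U s)) v"
    using r v s by (intro green_eq L2_comb has_weak_div_comb)
  then show ?thesis using r v s by (simp add: green_def L2_ip_comb_left algebra_simps)
qed

text \<open>
  Passing to the limit in the definition of the weak divergence, tested with truncations of \<open>\<phi>\<close> at
  height \<open>1/k\<close>.  The set where \<open>\<phi>\<close> vanishes is lost in the limit of the gradients.
\<close>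

lemma truncation_limit:
  assumes \<phi>: "smooth \<phi>" and 0: "\<And>x. x \<in> frontier U \<Longrightarrow> \<phi> x = 0"
    and r: "r \<in> L2 U" "has_weak_div U r d"
  shows "(\<lambda>x. if \<phi> x = 0 then 0 else grad \<phi> x) \<in> L2 U"
    and "L2_ip U r (\<lambda>x. if \<phi> x = 0 then 0 else grad \<phi> x) = - L2_ip U d \<phi>"
proof -
  have d: "d \<in> L2 U" using r(2) by (simp add: has_weak_div_def)
  define cut where "cut n x = (if x \<in> U then trunc (real (Suc n)) \<phi> x else 0)" for n x
  have cut: "cut n \<in> test_functions U" for n
    unfolding cut_def[abs_def] using \<phi> 0 by (rule trunc_test_function) auto
  have gr: "grad (cut n) x = trunc_coeff (real (Suc n)) (\<phi> x) *\<^sub>R grad \<phi> x" if x: "x \<in> U" for n x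
  proof (rule grad_unique)
    have "(trunc (real (Suc n)) \<phi> has_derivative
        (\<lambda>h. (trunc_coeff (real (Suc n)) (\<phi> x) *\<^sub>R grad \<phi> x) \<bullet> h)) (at x)"
      using smooth_has_derivative_inner[OF smooth_trunc[OF \<phi>], of "real (Suc n)" x] by (simp only: grad_trunc[OF \<phi>])
    then show "(cut n has_derivative (\<lambda>h. (trunc_coeff (real (Suc n)) (\<phi> x) *\<^sub>R grad \<phi> x) \<bullet> h)) (at x)"
      by (rule has_derivative_transform_within_open[OF _ open_U x]) (simp add: cut_def)
  qed
  let ?nz = "\<lambda>x. if \<phi> x = 0 then 0 else grad \<phi> x"
  have lim_gr: "(\<lambda>n. grad (cut n) x) \<longlonglongrightarrow> ?nz x" if "x \<in> U" for x
    using tendsto_scaleR[OF trunc_coeff_tendsto[of "\<phi> x"] tendsto_const[of "grad \<phi> x"]]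
    by (auto simp: gr[OF that])
  have lim: "(\<lambda>n. cut n x) \<longlonglongrightarrow> \<phi> x" if "x \<in> U" for x
  proof (cases "\<phi> x = 0")
    case True
    then show ?thesis using that by (simp add: cut_def trunc_def)
  next
    case False
    show ?thesis
      using tendsto_mult[OF tendsto_const[of "\<phi> x"] filterlim_compose[OF exp_bump_at_top(1) filterlim_square_scale[OF False]]] that
      by (simp add: cut_def trunc_def)
  qed
  have bd: "\<bar>cut n x\<bar> \<le> \<bar>\<phi> x\<bar>" for n x
    using exp_bump_0_range by (auto simp: cut_def trunc_def abs_mult intro: mult_right_le_one_le)
  have bd_gr: "norm (grad (cut n) x) \<le> 7 * norm (grad \<phi> x)" if "x \<in> U" for n x
    unfolding gr[OF that] using trunc_coeff_bound by (simp add: mult_right_mono)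
  have nzm: "?nz \<in> borel_measurable (lebesgue_on U)"
    by (rule borel_measurable_LIMSEQ_metric[where f="\<lambda>n. grad (cut n)"])
      (use L2D(1)[OF test_L2(2)[OF cut]] lim_gr in auto)
  show nz: "?nz \<in> L2 U"
  proof (rule L2_bound[OF nzm])
    show "integrable (lebesgue_on U) (\<lambda>x. (norm (grad \<phi> x))\<^sup>2)"
      using L2D(2)[OF smooth_L2(2)[OF \<phi>]] .
  qed auto
  have "(\<lambda>n. L2_ip U r (grad (cut n))) \<longlonglongrightarrow> L2_ip U r ?nz"
    unfolding L2_ip_def
  proof (rule integral_dominated_convergence[where w="\<lambda>x. 7 * (norm (grad \<phi> x) * norm (r x))"])
    have [measurable]: "grad (cut n) \<in> borel_measurable (lebesgue_on U)" for n using L2D(1)[OF test_L2(2)[OF cut]] .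
    note [measurable] = nzm L2D(1)[OF r(1)]
    show "(\<lambda>x. r x \<bullet> ?nz x) \<in> borel_measurable (lebesgue_on U)" by measurable
    show "(\<lambda>x. r x \<bullet> grad (cut n) x) \<in> borel_measurable (lebesgue_on U)" for n by measurable
    have nn: "f \<in> L2 U \<Longrightarrow> (\<lambda>x. norm (f x)) \<in> L2 U" for f :: "real ^ 'd \<Rightarrow> real ^ 'd"
      by (auto simp: L2_def)
    show "integrable (lebesgue_on U) (\<lambda>x. 7 * (norm (grad \<phi> x) * norm (r x)))"
      using L2_inner_integrable[OF nn[OF smooth_L2(2)[OF \<phi>]] nn[OF r(1)]] by simp
    show "AE x in lebesgue_on U. (\<lambda>n. r x \<bullet> grad (cut n) x) \<longlonglongrightarrow> r x \<bullet> ?nz x"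
      by (intro AE_I2 tendsto_inner tendsto_const lim_gr) simp
    show "AE x in lebesgue_on U. norm (r x \<bullet> grad (cut n) x) \<le> 7 * (norm (grad \<phi> x) * norm (r x))" for n
    proof (intro AE_I2)
      fix x assume "x \<in> space (lebesgue_on U)"
      then have x: "x \<in> U" by simp
      have "norm (r x \<bullet> grad (cut n) x) \<le> norm (r x) * norm (grad (cut n) x)"
        using Cauchy_Schwarz_ineq2 by simp
      also have "\<dots> \<le> norm (r x) * (7 * norm (grad \<phi> x))" by (intro mult_left_mono bd_gr x) simp
      finally show "norm (r x \<bullet> grad (cut n) x) \<le> 7 * (norm (grad \<phi> x) * norm (r x))" by (simp add: mult_ac)
    qed
  qed
  moreover have "(\<lambda>n. L2_ip U d (cut n)) \<longlonglongrightarrow> L2_ip U d \<phi>"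
    unfolding L2_ip_def
  proof (rule integral_dominated_convergence[where w="\<lambda>x. \<bar>d x * \<phi> x\<bar>"])
    have [measurable]: "cut n \<in> borel_measurable (lebesgue_on U)" for n using L2D(1)[OF test_L2(1)[OF cut]] .
    note [measurable] = L2D(1)[OF d] L2D(1)[OF smooth_L2(1)[OF \<phi>]]
    show "(\<lambda>x. d x \<bullet> \<phi> x) \<in> borel_measurable (lebesgue_on U)" by measurable
    show "(\<lambda>x. d x \<bullet> cut n x) \<in> borel_measurable (lebesgue_on U)" for n by measurable
    show "integrable (lebesgue_on U) (\<lambda>x. \<bar>d x * \<phi> x\<bar>)"
      using L2_inner_integrable[OF d smooth_L2(1)[OF \<phi>]] by simp
    show "AE x in lebesgue_on U. (\<lambda>n. d x \<bullet> cut n x) \<longlonglongrightarrow> d x \<bullet> \<phi> x"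
      by (intro AE_I2 tendsto_inner tendsto_const lim) simp
    show "AE x in lebesgue_on U. norm (d x \<bullet> cut n x) \<le> \<bar>d x * \<phi> x\<bar>" for n
      using bd by (intro AE_I2) (simp add: abs_mult mult_left_mono)
  qed
  then have "(\<lambda>n. - L2_ip U d (cut n)) \<longlonglongrightarrow> - L2_ip U d \<phi>" by (rule tendsto_minus)
  moreover have "L2_ip U r (grad (cut n)) = - L2_ip U d (cut n)" for n
    using r(2) cut unfolding has_weak_div_iff by blast
  ultimately show "L2_ip U r ?nz = - L2_ip U d \<phi>" using LIMSEQ_unique by simp
qed

text \<open>
  By the truncation argument, applied to the fields \<open>\<eta> e\<^sub>i\<close>, the gradient of \<open>\<phi>\<close> restricted to
  \<open>\<phi> \<noteq> 0\<close> is a weak gradient of \<open>\<phi>\<close>.  So it is almost everywhere equal to the gradient itself.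
\<close>

lemma green_smooth_zero_boundary:
  assumes \<phi>: "smooth \<phi>" and 0: "\<And>x. x \<in> frontier U \<Longrightarrow> \<phi> x = 0" and r: "r \<in> Hdiv U"
  shows "green U r \<phi> = 0"
proof -
  let ?nz = "\<lambda>x. if \<phi> x = 0 then 0 else grad \<phi> x"
  have \<phi>2: "\<phi> \<in> L2 U" using \<phi> by (rule smooth_L2)
  have wg: "has_weak_grad U \<phi> ?nz"
    unfolding has_weak_grad_iff[OF \<phi>2]
  proof (intro conjI ballI allI)
    show "?nz \<in> L2 U" using truncation_limit(1)[OF \<phi> 0 HdivD(1,2)[OF r]] .
    fix \<eta> i assume \<eta>: "\<eta> \<in> test_functions U"
    have "L2_ip U (\<lambda>x. \<eta> x *\<^sub>R axis i 1) ?nz = - L2_ip U (\<lambda>x. grad \<eta> x $ i) \<phi>"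
      using \<phi> 0 test_axis_L2(1)[OF \<eta>] smooth_axis_has_weak_div[OF test_functionsD(1)[OF \<eta>]]
      by (rule truncation_limit(2))
    then show "L2_ip U \<phi> (\<lambda>x. grad \<eta> x $ i) = - L2_ip U ?nz (\<lambda>x. \<eta> x *\<^sub>R axis i 1)"
      by (simp add: L2_ip_sym)
  qed
  have "green U r \<phi> = L2_ip U r ?nz + L2_ip U (weak_div U r) \<phi>"
    using HdivD[OF r] \<phi>2 wg by (intro green_eq)
  then show ?thesis using truncation_limit(2)[OF \<phi> 0 HdivD(1,2)[OF r]] by simp
qed

end

lemma tendsto_0_squeeze:
  fixes a b :: "nat \<Rightarrow> real"
  assumes "\<And>n. 0 \<le> a n" "\<And>n. a n \<le> b n" "b \<longlonglongrightarrow> 0"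
  shows "a \<longlonglongrightarrow> 0"
  using assms by (intro real_tendsto_sandwich[OF _ _ tendsto_const assms(3)]) auto

context bounded_open
begin

lemma H1_ip_comb_left:
  assumes "u \<in> H1 U" "v \<in> H1 U" "w \<in> H1 U"
  shows "H1_ip U (comb a u b v) w = a * H1_ip U u w + b * H1_ip U v w"
proof -
  note u = H1D(1,3)[OF assms(1)] and v = H1D(1,3)[OF assms(2)] and w = H1D(1,3)[OF assms(3)]
  have "L2_ip U (weak_grad U (comb a u b v)) (weak_grad U w)
      = L2_ip U (comb a (weak_grad U u) b (weak_grad U v)) (weak_grad U w)"
    by (rule L2_cong_ae[OF H1D(3)[OF H1_comb[OF assms(1,2)]] L2_comb[OF u(2) v(2)] w(2) w(2)
          weak_grad_comb[OF assms(1,2)] ae_eq_refl])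
  then show ?thesis using u v w by (simp add: H1_ip_def L2_ip_comb_left algebra_simps)
qed

lemma H1_semi_inner: "semi_inner (H1 U) (H1_ip U)"
  by unfold_locales (auto simp: H1_comb H1_ip_comb_left, auto simp: H1_ip_def L2_ip_nonneg L2_ip_sym)

lemma weak_grad_diff_ip:
  assumes "u \<in> H1 U" "v \<in> L2 U" "has_weak_grad U v g"
  shows "L2_ip U (weak_grad U (comb 1 u (-1) v)) (weak_grad U (comb 1 u (-1) v))
    = L2_dist2 U (weak_grad U u) g"
proof -
  have g: "g \<in> L2 U" using assms(3) by (simp add: has_weak_grad_def)
  note u = H1D[OF assms(1)]
  have hg: "has_weak_grad U (comb 1 u (-1) v) (comb 1 (weak_grad U u) (-1) g)"
    by (rule has_weak_grad_comb[OF u(1) assms(2) u(2) assms(3)])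
  have L: "comb 1 u (-1) v \<in> L2 U" "comb 1 (weak_grad U u) (-1) g \<in> L2 U"
    by (rule L2_comb[OF u(1) assms(2)], rule L2_comb[OF u(3) g])
  note ae = weak_grad_ae[OF L(1) hg] and W = H1D(3)[OF H1I[OF L(1) hg]]
  show ?thesis by (rule L2_cong_ae[OF W L(2) W L(2) ae ae])
qed

text \<open>
  Completeness of \<open>H1\<close> combines completeness of \<open>L2\<close> with closedness of the weak gradient.
\<close>

lemma H1_semi_hilbert: "semi_hilbert (H1 U) (H1_ip U)"
proof -
  interpret semi_inner "H1 U" "H1_ip U" by (rule H1_semi_inner)
  have zero: "(\<lambda>x. 0) \<in> H1 U"
    by (rule H1I[OF smooth_L2(1)[OF smooth_const] smooth_has_weak_grad[OF smooth_const]])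
  show ?thesis
  proof unfold_locales
    show "H1 U \<noteq> {}" using zero by blast
    fix X :: "nat \<Rightarrow> real ^ 'd \<Rightarrow> real"
    assume X: "\<And>n. X n \<in> H1 U" and Cauchy: "\<And>e. 0 < e \<Longrightarrow> \<exists>N. \<forall>m\<ge>N. \<forall>n\<ge>N.
      H1_ip U (comb 1 (X m) (-1) (X n)) (comb 1 (X m) (-1) (X n)) < e"
    note XD = H1D[OF X]
    have split: "H1_ip U (comb 1 (X m) (-1) (X n)) (comb 1 (X m) (-1) (X n))
        = L2_dist2 U (X m) (X n)
        + L2_dist2 U (weak_grad U (X m)) (weak_grad U (X n))" for m n
      unfolding H1_ip_def by (simp add: weak_grad_diff_ip[OF X XD(1,2)])
    have lm: "U \<in> lmeasurable" by (intro lmeasurable_open open_U bounded_U)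
    have "\<exists>N. \<forall>m\<ge>N. \<forall>n\<ge>N. L2_dist2 U (X m) (X n) < e" if "0 < e" for e
      using Cauchy[OF that] unfolding split
      by (meson L2_ip_nonneg le_add_same_cancel1 order_le_less_trans)
    from L2_complete[OF lm XD(1) this] obtain x where x: "x \<in> L2 U"
      "(\<lambda>n. L2_dist2 U (X n) x) \<longlonglongrightarrow> 0" by blast
    have "\<exists>N. \<forall>m\<ge>N. \<forall>n\<ge>N. L2_dist2 U (weak_grad U (X m)) (weak_grad U (X n)) < e" if "0 < e" for e
      using Cauchy[OF that] unfolding split
      by (meson L2_ip_nonneg le_add_same_cancel2 order_le_less_trans)
    from L2_complete[OF lm XD(3) this] obtain g where g: "g \<in> L2 U"
      "(\<lambda>n. L2_dist2 U (weak_grad U (X n)) g) \<longlonglongrightarrow> 0" by blast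
    have xg: "has_weak_grad U x g" by (rule has_weak_grad_limit[OF XD(1,3,2) x(1) g(1) x(2) g(2)])
    have "H1_ip U (comb 1 (X n) (-1) x) (comb 1 (X n) (-1) x) = L2_dist2 U (X n) x
        + L2_dist2 U (weak_grad U (X n)) g" for n
      unfolding H1_ip_def by (simp add: weak_grad_diff_ip[OF X x(1) xg])
    then have "(\<lambda>n. H1_ip U (comb 1 (X n) (-1) x) (comb 1 (X n) (-1) x)) \<longlonglongrightarrow> 0"
      using tendsto_add[OF x(2) g(2)] by simp
    then show "\<exists>x\<in>H1 U. (\<lambda>n. H1_ip U (comb 1 (X n) (-1) x) (comb 1 (X n) (-1) x)) \<longlonglongrightarrow> 0"
      using H1I[OF x(1) xg] by blast
  qed
qed

definition smooth_vanishing :: "(real ^ 'd \<Rightarrow> real) set" where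
  "smooth_vanishing = {\<phi>. smooth \<phi> \<and> \<phi> \<in> H1 U \<and> (\<forall>x \<in> frontier U. \<phi> x = 0)}"

lemma zbv_iff_approximable:
  "v \<in> zero_boundary_values U \<longleftrightarrow> v \<in> H1 U \<and> (\<forall>e>0. \<exists>\<phi>\<in>smooth_vanishing. H1_norm U (comb 1 v (-1) \<phi>) < e)"
  unfolding zero_boundary_values_def smooth_vanishing_def diff_eq_comb by blast

lemma smooth_vanishing_comb: "\<phi> \<in> smooth_vanishing \<Longrightarrow> \<psi> \<in> smooth_vanishing \<Longrightarrow> comb a \<phi> b \<psi> \<in> smooth_vanishing"
  by (auto simp: smooth_vanishing_def H1_comb)
    (auto simp: comb_def intro!: smooth_add smooth_mult smooth_const)

lemma H1_norm_comb:
  assumes "v \<in> H1 U" "w \<in> H1 U"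
  shows "H1_norm U (comb a v b w) \<le> \<bar>a\<bar> * H1_norm U v + \<bar>b\<bar> * H1_norm U w"
proof -
  interpret semi_inner "H1 U" "H1_ip U" by (rule H1_semi_inner)
  show ?thesis unfolding H1_norm_eq by (rule triangle[OF assms])
qed

lemma H1_norm_nonneg: "0 \<le> H1_norm U v"
  by (simp add: H1_norm_def)

lemma zbv_H1: "v \<in> zero_boundary_values U \<Longrightarrow> v \<in> H1 U"
  by (simp add: zbv_iff_approximable)

lemma zbv_comb:
  assumes v: "v \<in> zero_boundary_values U" and w: "w \<in> zero_boundary_values U"
  shows "comb a v b w \<in> zero_boundary_values U"
  unfolding zbv_iff_approximable
proof (intro conjI allI impI)
  show "comb a v b w \<in> H1 U" using v w by (intro H1_comb zbv_H1)
  fix e :: real assume e: "0 < e"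
  let ?d = "e / (\<bar>a\<bar> + \<bar>b\<bar> + 1)"
  have d: "0 < ?d" using e by (intro divide_pos_pos) auto
  obtain \<phi> where \<phi>: "\<phi> \<in> smooth_vanishing" "H1_norm U (comb 1 v (-1) \<phi>) < ?d"
    using v d unfolding zbv_iff_approximable by blast
  obtain \<psi> where \<psi>: "\<psi> \<in> smooth_vanishing" "H1_norm U (comb 1 w (-1) \<psi>) < ?d"
    using w d unfolding zbv_iff_approximable by blast
  have eq: "comb 1 (comb a v b w) (-1) (comb a \<phi> b \<psi>) = comb a (comb 1 v (-1) \<phi>) b (comb 1 w (-1) \<psi>)"
    by (simp add: comb_def fun_eq_iff algebra_simps)
  have "H1_norm U (comb a (comb 1 v (-1) \<phi>) b (comb 1 w (-1) \<psi>))
      \<le> \<bar>a\<bar> * H1_norm U (comb 1 v (-1) \<phi>) + \<bar>b\<bar> * H1_norm U (comb 1 w (-1) \<psi>)"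
    using \<phi>(1) \<psi>(1) by (intro H1_norm_comb H1_comb zbv_H1[OF v] zbv_H1[OF w]) (auto simp: smooth_vanishing_def)
  also have "\<dots> \<le> \<bar>a\<bar> * ?d + \<bar>b\<bar> * ?d"
    using \<phi>(2) \<psi>(2) by (intro add_mono mult_left_mono) auto
  also have "\<dots> < (\<bar>a\<bar> + \<bar>b\<bar> + 1) * ?d" using d by (simp only: distrib_right)
  also have "\<dots> = e" by simp
  finally show "\<exists>\<phi>\<in>smooth_vanishing. H1_norm U (comb 1 (comb a v b w) (-1) \<phi>) < e"
    using smooth_vanishing_comb[OF \<phi>(1) \<psi>(1)] eq by (intro bexI[of _ "comb a \<phi> b \<psi>"]) simp_all
qed

lemma zbv_closed:
  assumes x: "x \<in> H1 U" and lim: "\<And>e. 0 < e \<Longrightarrow> \<exists>v\<in>zero_boundary_values U. H1_norm U (comb 1 x (-1) v) < e"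
  shows "x \<in> zero_boundary_values U"
  unfolding zbv_iff_approximable
proof (intro conjI allI impI x)
  fix e :: real assume e: "0 < e"
  obtain v where v: "v \<in> zero_boundary_values U" "H1_norm U (comb 1 x (-1) v) < e / 2"
    using lim[of "e/2"] e by auto
  obtain \<phi> where \<phi>: "\<phi> \<in> smooth_vanishing" "H1_norm U (comb 1 v (-1) \<phi>) < e / 2"
    using v(1) e unfolding zbv_iff_approximable by (metis half_gt_zero)
  have eq: "comb 1 x (-1) \<phi> = comb 1 (comb 1 x (-1) v) 1 (comb 1 v (-1) \<phi>)"
    by (simp add: comb_def fun_eq_iff)
  have "H1_norm U (comb 1 x (-1) \<phi>) \<le> \<bar>1\<bar> * H1_norm U (comb 1 x (-1) v) + \<bar>1\<bar> * H1_norm U (comb 1 v (-1) \<phi>)"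
    unfolding eq using \<phi>(1) by (intro H1_norm_comb H1_comb x zbv_H1[OF v(1)]) (auto simp: smooth_vanishing_def)
  also have "\<dots> < e" using v(2) \<phi>(2) by simp
  finally show "\<exists>\<phi>\<in>smooth_vanishing. H1_norm U (comb 1 x (-1) \<phi>) < e" using \<phi>(1) by blast
qed

lemma test_function_smooth_vanishing:
  assumes "\<phi> \<in> test_functions U"
  shows "\<phi> \<in> smooth_vanishing"
proof -
  note \<phi> = test_functionsD[OF assms]
  have "\<phi> x = 0" if "x \<in> frontier U" for x
    using test_function_outside(1)[OF assms, of x] that open_U by (auto simp: frontier_def interior_open)
  then show ?thesis
    using \<phi>(1) H1I[OF smooth_L2(1)[OF \<phi>(1)] smooth_has_weak_grad[OF \<phi>(1)]] by (simp add: smooth_vanishing_def)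
qed

lemma smooth_vanishing_zbv:
  assumes "\<phi> \<in> smooth_vanishing"
  shows "\<phi> \<in> zero_boundary_values U"
proof -
  have H: "\<phi> \<in> H1 U" using assms by (simp add: smooth_vanishing_def)
  interpret semi_inner "H1 U" "H1_ip U" by (rule H1_semi_inner)
  have "H1_norm U (comb 1 \<phi> (-1) \<phi>) = 0" unfolding H1_norm_eq by (simp add: comb_square[OF H H])
  then show ?thesis unfolding zbv_iff_approximable using assms H by (auto intro!: bexI[of _ \<phi>])
qed

lemma zbv_semi_hilbert: "semi_hilbert (zero_boundary_values U) (H1_ip U)"
proof -
  interpret H: semi_hilbert "H1 U" "H1_ip U" by (rule H1_semi_hilbert)
  show ?thesis
  proof unfold_locales
    show "zero_boundary_values U \<noteq> {}"
      using smooth_vanishing_zbv[of "\<lambda>x. 0"] H1I[OF smooth_L2(1)[OF smooth_const] smooth_has_weak_grad[OF smooth_const]]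
      by (auto simp: smooth_vanishing_def smooth_const)
    fix X :: "nat \<Rightarrow> real ^ 'd \<Rightarrow> real"
    assume X: "\<And>n. X n \<in> zero_boundary_values U" and Cauchy: "\<And>e. 0 < e \<Longrightarrow> \<exists>N. \<forall>m\<ge>N. \<forall>n\<ge>N.
      H1_ip U (comb 1 (X m) (-1) (X n)) (comb 1 (X m) (-1) (X n)) < e"
    obtain x where x: "x \<in> H1 U" "(\<lambda>n. H1_ip U (comb 1 (X n) (-1) x) (comb 1 (X n) (-1) x)) \<longlonglongrightarrow> 0"
      using H.complete[OF zbv_H1[OF X] Cauchy] by blast
    have "x \<in> zero_boundary_values U"
    proof (rule zbv_closed[OF x(1)])
      fix e :: real assume "0 < e"
      have "(\<lambda>n. sqrt (H1_ip U (comb 1 (X n) (-1) x) (comb 1 (X n) (-1) x))) \<longlonglongrightarrow> 0"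
        using tendsto_real_sqrt[OF x(2)] by simp
      then have "\<forall>\<^sub>F n in sequentially. H1_norm U (comb 1 (X n) (-1) x) < e"
        using order_tendstoD(2) \<open>0 < e\<close> unfolding H1_norm_eq by blast
      then obtain n where n: "H1_norm U (comb 1 (X n) (-1) x) < e" by (auto simp: eventually_sequentially)
      have "H1_ip U (comb 1 x (-1) (X n)) (comb 1 x (-1) (X n)) = H1_ip U (comb 1 (X n) (-1) x) (comb 1 (X n) (-1) x)"
        using x(1) zbv_H1[OF X[of n]] by (simp add: H.comb_square H.sym)
      then show "\<exists>v\<in>zero_boundary_values U. H1_norm U (comb 1 x (-1) v) < e"
        using n X[of n] unfolding H1_norm_eq by (metis (no_types, lifting))
    qed
    then show "\<exists>x\<in>zero_boundary_values U. (\<lambda>n. H1_ip U (comb 1 (X n) (-1) x) (comb 1 (X n) (-1) x)) \<longlonglongrightarrow> 0"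
      using x(2) by blast
  qed (auto simp: zbv_comb zbv_H1 H.comb_left H.nonneg intro: H.sym)
qed

lemma green_bound:
  assumes "r \<in> Hdiv U" "v \<in> H1 U"
  shows "\<bar>green U r v\<bar> \<le> (sqrt (L2_ip U r r) + sqrt (L2_ip U (weak_div U r) (weak_div U r))) * H1_norm U v"
proof -
  note r = HdivD[OF assms(1)] and v = H1D[OF assms(2)]
  have "\<bar>green U r v\<bar> \<le> \<bar>L2_ip U r (weak_grad U v)\<bar> + \<bar>L2_ip U (weak_div U r) v\<bar>"
    by (simp add: green_def)
  also have "\<dots> \<le> sqrt (L2_ip U r r) * sqrt (L2_ip U (weak_grad U v) (weak_grad U v))
      + sqrt (L2_ip U (weak_div U r) (weak_div U r)) * sqrt (L2_ip U v v)"
    by (intro add_mono L2.Cauchy_Schwarz_sqrt r v)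
  also have "\<dots> \<le> sqrt (L2_ip U r r) * H1_norm U v + sqrt (L2_ip U (weak_div U r) (weak_div U r)) * H1_norm U v"
    unfolding H1_norm_eq H1_ip_def
    by (intro add_mono mult_left_mono real_sqrt_le_mono) (auto simp: L2_ip_nonneg)
  finally show ?thesis by (simp add: distrib_right)
qed

text \<open>
  By density, since the pairing is continuous in the \<open>H1\<close> norm.
\<close>

lemma green_zero_boundary:
  assumes z: "v \<in> zero_boundary_values U" and r: "r \<in> Hdiv U"
  shows "green U r v = 0"
proof -
  have v: "v \<in> H1 U" using z by (rule zbv_H1)
  define C where "C = sqrt (L2_ip U r r) + sqrt (L2_ip U (weak_div U r) (weak_div U r)) + 1"
  have C: "0 < C" by (simp add: C_def L2_ip_nonneg add_nonneg_pos)
  have "\<bar>green U r v\<bar> \<le> e" if e: "0 < e" for e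
  proof -
    have "0 < e / C" using e C by simp
    then obtain \<phi> where \<phi>: "\<phi> \<in> smooth_vanishing" "H1_norm U (comb 1 v (-1) \<phi>) < e / C"
      using z unfolding zbv_iff_approximable by blast
    have \<phi>H: "\<phi> \<in> H1 U" using \<phi>(1) by (simp add: smooth_vanishing_def)
    have "green U r \<phi> = 0"
      by (rule green_smooth_zero_boundary[OF _ _ r]) (use \<phi>(1) in \<open>auto simp: smooth_vanishing_def\<close>)
    then have "green U r v = green U r (comb 1 v (-1) \<phi>)" using green_comb_right[OF r v \<phi>H] by simp
    then have "\<bar>green U r v\<bar> \<le> (C - 1) * H1_norm U (comb 1 v (-1) \<phi>)"
      using green_bound[OF r H1_comb[OF v \<phi>H], of 1 "-1"] by (simp add: C_def)
    also have "\<dots> \<le> C * H1_norm U (comb 1 v (-1) \<phi>)"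
      by (intro mult_right_mono H1_norm_nonneg) simp
    also have "\<dots> \<le> C * (e / C)" using \<phi>(2) C by (intro mult_left_mono) auto
    finally show ?thesis using C by simp
  qed
  then have "\<bar>green U r v\<bar> \<le> 0" by (rule field_le_epsilon[of _ 0, simplified])
  then show "green U r v = 0" by simp
qed

text \<open>
  Zero boundary values imply Green's formula without boundary term by density.  Conversely, let \<open>v0\<close> be the orthogonal projection of \<open>v\<close> onto the functions with zero boundary
  values in \<open>H1\<close>.  Orthogonality of \<open>w = v - v0\<close> to the test functions says that \<open>div (grad w) = w\<close>, so
  Green's formula for \<open>w\<close> and the field \<open>grad w\<close> says that the \<open>H1\<close> norm of \<open>w\<close> vanishes.
\<close>

theorem zero_boundary_values_iff_green:
  assumes v: "v \<in> H1 U"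
  shows "v \<in> zero_boundary_values U \<longleftrightarrow> (\<forall>r\<in>Hdiv U. green U r v = 0)"
proof
  assume "v \<in> zero_boundary_values U"
  then show "\<forall>r\<in>Hdiv U. green U r v = 0" using green_zero_boundary by blast
next
  assume g: "\<forall>r\<in>Hdiv U. green U r v = 0"
  interpret H: semi_inner "H1 U" "H1_ip U" by (rule H1_semi_inner)
  interpret Z: semi_hilbert "zero_boundary_values U" "H1_ip U" by (rule zbv_semi_hilbert)
  have "\<exists>v0\<in>zero_boundary_values U. \<forall>\<phi>\<in>zero_boundary_values U. H1_ip U v0 \<phi> = H1_ip U v \<phi>"
  proof (rule Z.Riesz_representation[where C="sqrt (H1_ip U v v)"])
    show "\<bar>H1_ip U v y\<bar> \<le> sqrt (H1_ip U v v) * sqrt (H1_ip U y y)" if "y \<in> zero_boundary_values U" for y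
      using H.Cauchy_Schwarz_sqrt v zbv_H1[OF that] by blast
  qed (use v in \<open>auto simp: H.comb_right zbv_H1\<close>)
  then obtain v0 where v0: "v0 \<in> zero_boundary_values U"
    "\<And>\<phi>. \<phi> \<in> zero_boundary_values U \<Longrightarrow> H1_ip U v0 \<phi> = H1_ip U v \<phi>" by blast
  define w where "w = comb 1 v (-1) v0"
  have v0H: "v0 \<in> H1 U" using zbv_H1[OF v0(1)] .
  have wH: "w \<in> H1 U" unfolding w_def by (rule H1_comb[OF v v0H])
  note w = H1D[OF wH]
  have div: "has_weak_div U (weak_grad U w) w"
    unfolding has_weak_div_iff
  proof (intro conjI ballI w)
    fix \<phi> assume \<phi>: "\<phi> \<in> test_functions U"
    have \<phi>z: "\<phi> \<in> zero_boundary_values U" using \<phi> by (intro smooth_vanishing_zbv test_function_smooth_vanishing)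
    have "H1_ip U w \<phi> = 0" unfolding w_def using H.comb_left[OF v v0H zbv_H1[OF \<phi>z]] v0(2)[OF \<phi>z] by simp
    moreover have "L2_ip U (weak_grad U w) (weak_grad U \<phi>) = L2_ip U (weak_grad U w) (grad \<phi>)"
      by (rule L2_cong_ae[OF w(3) w(3) H1D(3)[OF zbv_H1[OF \<phi>z]] test_L2(2)[OF \<phi>] ae_eq_refl
            weak_grad_ae[OF test_L2(1)[OF \<phi>] smooth_has_weak_grad[OF test_functionsD(1)[OF \<phi>]]]])
    ultimately show "L2_ip U (weak_grad U w) (grad \<phi>) = - L2_ip U w \<phi>" by (simp add: H1_ip_def)
  qed
  have rH: "weak_grad U w \<in> Hdiv U" by (rule HdivI[OF w(3) div])
  have "green U (weak_grad U w) v0 = 0" by (rule green_zero_boundary[OF v0(1) rH])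
  then have "green U (weak_grad U w) w = 0"
    unfolding w_def using g rH green_comb_right[OF _ v v0H, of "weak_grad U w" 1 "-1"] unfolding w_def by simp
  then have "H1_ip U w w = 0"
    using green_eq[OF w(3) div w(1,2)] by (simp add: H1_ip_def)
  show "v \<in> zero_boundary_values U"
  proof (rule zbv_closed[OF v])
    fix e :: real assume "0 < e"
    then show "\<exists>v'\<in>zero_boundary_values U. H1_norm U (comb 1 v (-1) v') < e"
      using v0(1) \<open>H1_ip U w w = 0\<close> unfolding H1_norm_eq w_def by (intro bexI[of _ v0]) simp_all
  qed
qed

end

section \<open>Broken spaces on a mesh\<close>

definition zext :: "(real ^ 'd) set \<Rightarrow> (real ^ 'd \<Rightarrow> 'b::euclidean_space) \<Rightarrow> real ^ 'd \<Rightarrow> 'b" where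
  "zext U f x = (if x \<in> U then f x else 0)"

lemma zext_L2_iff:
  fixes f :: "real ^ 'd \<Rightarrow> 'b::euclidean_space"
  assumes "open U"
  shows "f \<in> L2 U \<longleftrightarrow> zext U f \<in> L2 UNIV"
proof -
  have U: "U \<in> sets lebesgue" using assms by auto
  have "f \<in> borel_measurable (lebesgue_on U) \<longleftrightarrow> zext U f \<in> borel_measurable lebesgue"
    unfolding zext_def[abs_def] using borel_measurable_if[OF U, of f] by simp
  moreover have "integrable (lebesgue_on U) (\<lambda>x. (norm (f x))\<^sup>2) \<longleftrightarrow> integrable lebesgue (\<lambda>x. (norm (zext U f x))\<^sup>2)"
    unfolding Lebesgue_Measure.integrable_restrict_UNIV[OF U, symmetric]
    by (intro Bochner_Integration.integrable_cong) (auto simp: zext_def)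
  ultimately show ?thesis by (simp add: L2_def lebesgue_on_UNIV_eq)
qed

lemma L2_ip_zext:
  fixes f g :: "real ^ 'd \<Rightarrow> 'b::euclidean_space"
  assumes "open U"
  shows "L2_ip U f g = L2_ip UNIV (zext U f) (zext U g)"
proof -
  have U: "U \<in> sets lebesgue" using assms by auto
  show ?thesis
    unfolding L2_ip_def lebesgue_on_UNIV_eq Lebesgue_Measure.integral_restrict_UNIV[OF U, symmetric]
    by (intro Bochner_Integration.integral_cong) (auto simp: zext_def)
qed

lemma L2_sum: "finite I \<Longrightarrow> (\<And>i. i \<in> I \<Longrightarrow> f i \<in> L2 U) \<Longrightarrow> (\<lambda>x. \<Sum>i\<in>I. f i x) \<in> L2 U"
proof (induction I rule: finite_induct)
  case (insert i I)
  then have "comb 1 (f i) 1 (\<lambda>x. \<Sum>i\<in>I. f i x) \<in> L2 U" by (intro L2_comb) auto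
  then show ?case using insert by (simp add: comb_def)
qed (simp add: L2_zero)

lemma L2_ip_sum_left:
  "finite I \<Longrightarrow> (\<And>i. i \<in> I \<Longrightarrow> f i \<in> L2 U) \<Longrightarrow> g \<in> L2 U \<Longrightarrow>
    L2_ip U (\<lambda>x. \<Sum>i\<in>I. f i x) g = (\<Sum>i\<in>I. L2_ip U (f i) g)"
proof (induction I rule: finite_induct)
  case (insert i I)
  have "L2_ip U (comb 1 (f i) 1 (\<lambda>x. \<Sum>i\<in>I. f i x)) g = L2_ip U (f i) g + (\<Sum>i\<in>I. L2_ip U (f i) g)"
    using insert by (subst L2_ip_comb_left) (auto intro: L2_sum)
  then show ?case using insert by (simp add: comb_def)
qed (simp add: L2_ip_def)

text \<open>
  The Lebesgue measure is complete, so changes on a negligible set preserve measurability.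
\<close>

lemma L2_UNIV_negligible:
  fixes f g :: "real ^ 'd \<Rightarrow> 'b::euclidean_space"
  assumes f: "f \<in> L2 UNIV" and N: "negligible N" "\<And>x. x \<notin> N \<Longrightarrow> g x = f x"
  shows "g \<in> L2 UNIV"
proof (rule L2_bound)
  have meas: "h \<in> borel_measurable lebesgue" if h: "\<And>x. x \<notin> N \<Longrightarrow> h x = 0" for h :: "real ^ 'd \<Rightarrow> 'b"
  proof (rule measurableI)
    fix A :: "'b set" assume "A \<in> sets borel"
    have n: "S \<in> sets lebesgue" if "S \<subseteq> N" for S
      using negligible_subset[OF N(1) that] negligible_imp_measurable by blast
    have eq: "h -` A = (h -` A \<inter> N) \<union> (if 0 \<in> A then - N else {})"
    proof (rule set_eqI)
      fix x show "x \<in> h -` A \<longleftrightarrow> x \<in> (h -` A \<inter> N) \<union> (if 0 \<in> A then - N else {})"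
        by (cases "x \<in> N") (simp_all add: h)
    qed
    have "h -` A \<inter> N \<in> sets lebesgue" "- N \<in> sets lebesgue" using n by (simp_all add: Compl_in_sets_lebesgue)
    then have "h -` A \<in> sets lebesgue" by (subst eq, intro sets.Un) auto
    then show "h -` A \<inter> space lebesgue \<in> sets lebesgue" by simp
  qed simp
  have "(\<lambda>x. f x + (g x - f x)) \<in> borel_measurable lebesgue"
    using L2D(1)[OF f] N(2) by (intro borel_measurable_add[OF _ meas]) (auto simp: lebesgue_on_UNIV_eq)
  then show "g \<in> borel_measurable (lebesgue_on UNIV)" by (simp add: lebesgue_on_UNIV_eq)
  show "integrable (lebesgue_on UNIV) (\<lambda>x. (norm (f x))\<^sup>2)" using L2D(2)[OF f] .
  have "AE x in lebesgue. x \<notin> N" using N(1) by (intro AE_not_in) (simp add: negligible_iff_null_sets)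
  then show "AE x in lebesgue_on UNIV. (norm (g x))\<^sup>2 \<le> (norm (f x))\<^sup>2"
    unfolding lebesgue_on_UNIV_eq by eventually_elim (simp add: N(2))
qed

text \<open>
  The interfaces form a null set, so integrals over \<open>\<Omega>\<close> are sums of integrals over the open elements.
\<close>

locale mesh =
  fixes \<Omega> :: "(real ^ 'd) set" and M :: "(real ^ 'd) set set"
  assumes Omega: "bounded_open \<Omega>" and finite_M: "finite M"
    and elem: "K \<in> M \<Longrightarrow> open K" "K \<in> M \<Longrightarrow> K \<subseteq> \<Omega>"
    and disj: "K \<in> M \<Longrightarrow> K' \<in> M \<Longrightarrow> x \<in> K \<Longrightarrow> x \<in> K' \<Longrightarrow> K = K'"
    and negl: "negligible (\<Omega> - \<Union>M)"
begin

abbreviation W :: "(real ^ 'd) set" where "W \<equiv> \<Union>M"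

sublocale Om: bounded_open \<Omega> by (rule Omega)

lemma W_sub: "W \<subseteq> \<Omega>" using elem(2) by blast

sublocale W: bounded_open "\<Union>M"
  by unfold_locales (use elem(1) W_sub bounded_subset[OF Om.bounded_U] in auto)

lemma bounded_open_elem: "K \<in> M \<Longrightarrow> bounded_open K"
  by (intro bounded_open.intro elem(1) bounded_subset[OF Om.bounded_U elem(2)])

lemma elem_sub: "K \<in> M \<Longrightarrow> K \<subseteq> W" by blast

lemma zext_sum_elem:
  assumes K: "K \<in> M" and x: "x \<in> K"
  shows "(\<Sum>K\<in>M. zext K (h K) x) = h K x"
proof -
  have "zext K' (h K') x = (if K' = K then h K x else 0)" if "K' \<in> M" for K'
  proof (cases "K' = K")
    case False
    then have "x \<notin> K'" using disj[OF that K _ x] by blast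
    then show ?thesis using False by (simp add: zext_def)
  qed (simp add: zext_def x)
  then have "(\<Sum>K'\<in>M. zext K' (h K') x) = (\<Sum>K'\<in>M. if K' = K then h K x else 0)"
    by (rule sum.cong[OF refl])
  also have "\<dots> = h K x" using K finite_M by simp
  finally show ?thesis .
qed

lemma zext_W: "zext W f = (\<lambda>x. \<Sum>K\<in>M. zext K f x)"
proof
  fix x
  show "zext W f x = (\<Sum>K\<in>M. zext K f x)"
  proof (cases "x \<in> W")
    case True
    then obtain K where "K \<in> M" "x \<in> K" by blast
    then show ?thesis using zext_sum_elem[of K x "\<lambda>_. f"] True by (simp add: zext_def)
  qed (auto simp: zext_def)
qed

lemma L2_W_iff: "f \<in> L2 W \<longleftrightarrow> (\<forall>K\<in>M. f \<in> L2 K)"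
proof
  assume "f \<in> L2 W"
  then show "\<forall>K\<in>M. f \<in> L2 K" using L2_subset elem_sub elem(1) W.open_U by blast
next
  assume "\<forall>K\<in>M. f \<in> L2 K"
  then show "f \<in> L2 W"
    unfolding zext_L2_iff[OF W.open_U] zext_W
    by (intro L2_sum finite_M) (simp add: zext_L2_iff[symmetric] elem(1))
qed

lemma L2_Om: "f \<in> L2 \<Omega> \<longleftrightarrow> f \<in> L2 W"
proof
  assume "f \<in> L2 \<Omega>"
  then show "f \<in> L2 W" by (rule L2_subset[OF _ W_sub W.open_U Om.open_U])
next
  assume "f \<in> L2 W"
  then have "zext W f \<in> L2 UNIV" by (simp add: zext_L2_iff[OF W.open_U])
  then have "zext \<Omega> f \<in> L2 UNIV"
    by (rule L2_UNIV_negligible[OF _ negl]) (use W_sub in \<open>auto simp: zext_def\<close>)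
  then show "f \<in> L2 \<Omega>" by (simp add: zext_L2_iff[OF Om.open_U])
qed

lemma ip_W:
  assumes "f \<in> L2 W" "g \<in> L2 W"
  shows "L2_ip W f g = (\<Sum>K\<in>M. L2_ip K f g)"
proof -
  have K: "f \<in> L2 K" if "K \<in> M" for K using assms(1) that L2_W_iff by blast
  have "L2_ip W f g = L2_ip UNIV (\<lambda>x. \<Sum>K\<in>M. zext K f x) (zext W g)"
    by (simp add: L2_ip_zext[OF W.open_U] zext_W[of f])
  also have "\<dots> = (\<Sum>K\<in>M. L2_ip UNIV (zext K f) (zext W g))"
    using assms K by (intro L2_ip_sum_left finite_M) (simp_all add: zext_L2_iff[symmetric] elem(1) W.open_U)
  also have "\<dots> = (\<Sum>K\<in>M. L2_ip K f g)"
  proof (rule sum.cong[OF refl])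
    fix K assume K: "K \<in> M"
    have "L2_ip UNIV (zext K f) (zext W g) = L2_ip UNIV (zext K f) (zext K g)"
      unfolding L2_ip_def using K by (intro Bochner_Integration.integral_cong) (auto simp: zext_def)
    then show "L2_ip UNIV (zext K f) (zext W g) = L2_ip K f g" by (simp add: L2_ip_zext[OF elem(1)[OF K]])
  qed
  finally show ?thesis .
qed

lemma ae_Om: "ae_eq W f g \<Longrightarrow> ae_eq \<Omega> f g"
proof -
  assume "ae_eq W f g"
  then have "AE x in lebesgue. x \<in> W \<longrightarrow> f x = g x"
    using W.open_U by (simp add: ae_eq_def AE_restrict_space_iff)
  moreover have "AE x in lebesgue. x \<notin> \<Omega> - W" using negl by (intro AE_not_in) (simp add: negligible_iff_null_sets)
  ultimately have "AE x in lebesgue. x \<in> \<Omega> \<longrightarrow> f x = g x" by eventually_elim auto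
  then show ?thesis using Om.open_U by (simp add: ae_eq_def AE_restrict_space_iff)
qed

lemma ip_Om:
  assumes "f \<in> L2 W" "g \<in> L2 W"
  shows "L2_ip \<Omega> f g = L2_ip W f g"
proof -
  have L: "zext W f \<in> L2 \<Omega>" "zext W g \<in> L2 \<Omega>" "f \<in> L2 \<Omega>" "g \<in> L2 \<Omega>"
  proof -
    have "zext W f \<in> L2 UNIV" "zext W g \<in> L2 UNIV" using assms by (simp_all add: zext_L2_iff[OF W.open_U, symmetric])
    then show "zext W f \<in> L2 \<Omega>" "zext W g \<in> L2 \<Omega>" using L2_subset[OF _ subset_UNIV Om.open_U open_UNIV] by blast+
  qed (use assms L2_Om in auto)
  have ae: "ae_eq \<Omega> f (zext W f)" "ae_eq \<Omega> g (zext W g)"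
    by (rule ae_Om, simp add: ae_eq_def zext_def[abs_def] cong: AE_cong_simp)+
  have "L2_ip \<Omega> f g = L2_ip \<Omega> (zext W f) (zext W g)"
    by (rule L2_cong_ae[OF L(3,1,4,2) ae])
  also have "\<dots> = L2_ip W (zext W f) (zext W g)"
    by (rule L2_ip_restrict[OF W_sub W.open_U Om.open_U]) (simp add: zext_def)
  also have "\<dots> = L2_ip W f g"
    unfolding L2_ip_def by (intro Bochner_Integration.integral_cong) (auto simp: zext_def)
  finally show ?thesis .
qed

lemma L2_ip_Om:
  assumes "f \<in> L2 \<Omega>" "g \<in> L2 \<Omega>"
  shows "L2_ip \<Omega> f g = L2_ip W f g"
  using ip_Om assms L2_Om by blast

text \<open>
  The elements are open and disjoint, so a test function on their union splits into its parts.
\<close>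

lemma test_function_part:
  assumes \<phi>: "\<phi> \<in> test_functions W" and K: "K \<in> M"
  shows "zext K \<phi> \<in> test_functions K" and "x \<in> K \<Longrightarrow> grad (zext K \<phi>) x = grad \<phi> x"
proof -
  let ?S = "closure {x. \<phi> x \<noteq> 0}"
  define S where "S = ?S \<inter> - \<Union>(M - {K})"
  have oth: "open (\<Union>(M - {K}))" using elem(1) by (intro open_Union) auto
  have S: "closed S" unfolding S_def using oth by (intro closed_Int closed_closure closed_Compl)
  have sub: "?S \<subseteq> W" by (rule test_functionsD(3)[OF \<phi>])
  have SK: "S \<subseteq> K" unfolding S_def using sub by blast
  have out: "\<phi> x = 0" if "x \<in> K - S" for x
  proof -
    have "x \<notin> \<Union>(M - {K})" using that K disj by blast
    then have "x \<notin> ?S" using that by (simp add: S_def)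
    then show ?thesis by (rule test_function_vanish(1))
  qed
  have "smooth (\<lambda>x. if x \<in> K then \<phi> x else 0)"
    using test_functionsD(1)[OF \<phi>] elem(1)[OF K] S SK out by (rule smooth_cutoff)
  then have sm: "smooth (zext K \<phi>)" by (simp add: zext_def[abs_def])
  have nz: "{x. zext K \<phi> x \<noteq> 0} \<subseteq> S" using out by (auto simp: zext_def)
  have "bounded {x. zext K \<phi> x \<noteq> 0}"
    by (rule bounded_subset[OF bounded_open.bounded_U[OF bounded_open_elem[OF K]] subset_trans[OF nz SK]])
  moreover have "closure {x. zext K \<phi> x \<noteq> 0} \<subseteq> K" using closure_minimal[OF nz S] SK by blast
  ultimately show "zext K \<phi> \<in> test_functions K"
    using sm unfolding test_functions_def mem_Collect_eq compact_closure by blast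
  show "grad (zext K \<phi>) x = grad \<phi> x" if x: "x \<in> K"
  proof (rule grad_unique)
    show "(zext K \<phi> has_derivative (\<lambda>h. grad \<phi> x \<bullet> h)) (at x)"
      by (rule has_derivative_transform_within_open[OF smooth_has_derivative_inner[OF test_functionsD(1)[OF \<phi>]] elem(1)[OF K] x])
        (simp add: zext_def)
  qed
qed

lemma L2_ip_cong: "(\<And>x. x \<in> U \<Longrightarrow> f x \<bullet> g x = f' x \<bullet> g' x) \<Longrightarrow> L2_ip U f g = L2_ip U f' g'"
  unfolding L2_ip_def by (intro Bochner_Integration.integral_cong) auto

text \<open>
  Broken spaces are the spaces on the union of the open elements: a test function on the union does not
  see the interfaces.
\<close>

lemma has_weak_grad_W_iff:
  assumes v: "v \<in> L2 W"
  shows "has_weak_grad W v g \<longleftrightarrow> (\<forall>K\<in>M. has_weak_grad K v g)"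
proof
  assume "has_weak_grad W v g"
  then show "\<forall>K\<in>M. has_weak_grad K v g"
    using has_weak_grad_restrict[OF bounded_open_elem W.bounded_open_axioms elem_sub v] by blast
next
  assume g: "\<forall>K\<in>M. has_weak_grad K v g"
  have vK: "v \<in> L2 K" if "K \<in> M" for K using v that L2_W_iff by blast
  have gW: "g \<in> L2 W" using g by (simp add: L2_W_iff has_weak_grad_def)
  show "has_weak_grad W v g"
    unfolding W.has_weak_grad_iff[OF v]
  proof (intro conjI ballI allI gW)
    fix \<phi> i assume \<phi>: "\<phi> \<in> test_functions W"
    have "L2_ip W v (\<lambda>x. grad \<phi> x $ i) = (\<Sum>K\<in>M. L2_ip K v (\<lambda>x. grad \<phi> x $ i))"
      by (rule ip_W[OF v W.test_axis_L2(2)[OF \<phi>]])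
    also have "\<dots> = (\<Sum>K\<in>M. - L2_ip K g (\<lambda>x. \<phi> x *\<^sub>R axis i 1))"
    proof (rule sum.cong[OF refl])
      fix K assume K: "K \<in> M"
      interpret K: bounded_open K using K by (rule bounded_open_elem)
      have "L2_ip K v (\<lambda>x. grad \<phi> x $ i) = L2_ip K v (\<lambda>x. grad (zext K \<phi>) x $ i)"
        by (rule L2_ip_cong) (simp add: test_function_part(2)[OF \<phi> K])
      also have "\<dots> = - L2_ip K g (\<lambda>x. zext K \<phi> x *\<^sub>R axis i 1)"
        using bspec[OF g K] test_function_part(1)[OF \<phi> K] unfolding K.has_weak_grad_iff[OF vK[OF K]] by blast
      also have "L2_ip K g (\<lambda>x. zext K \<phi> x *\<^sub>R axis i 1) = L2_ip K g (\<lambda>x. \<phi> x *\<^sub>R axis i 1)"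
        by (rule L2_ip_cong) (simp add: zext_def)
      finally show "L2_ip K v (\<lambda>x. grad \<phi> x $ i) = - L2_ip K g (\<lambda>x. \<phi> x *\<^sub>R axis i 1)" .
    qed
    also have "\<dots> = - L2_ip W g (\<lambda>x. \<phi> x *\<^sub>R axis i 1)"
      by (simp add: sum_negf ip_W[OF gW W.test_axis_L2(1)[OF \<phi>]])
    finally show "L2_ip W v (\<lambda>x. grad \<phi> x $ i) = - L2_ip W g (\<lambda>x. \<phi> x *\<^sub>R axis i 1)" .
  qed
qed

lemma has_weak_div_W_iff:
  assumes q: "q \<in> L2 W"
  shows "has_weak_div W q g \<longleftrightarrow> (\<forall>K\<in>M. has_weak_div K q g)"
proof
  assume "has_weak_div W q g"
  then show "\<forall>K\<in>M. has_weak_div K q g"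
    using has_weak_div_restrict[OF bounded_open_elem W.bounded_open_axioms elem_sub] by blast
next
  assume g: "\<forall>K\<in>M. has_weak_div K q g"
  have gW: "g \<in> L2 W" using g by (simp add: L2_W_iff has_weak_div_def)
  show "has_weak_div W q g"
    unfolding W.has_weak_div_iff
  proof (intro conjI ballI allI gW)
    fix \<phi> assume \<phi>: "\<phi> \<in> test_functions W"
    have "L2_ip W q (grad \<phi>) = (\<Sum>K\<in>M. L2_ip K q (grad \<phi>))"
      by (rule ip_W[OF q W.test_L2(2)[OF \<phi>]])
    also have "\<dots> = (\<Sum>K\<in>M. - L2_ip K g \<phi>)"
    proof (rule sum.cong[OF refl])
      fix K assume K: "K \<in> M"
      interpret K: bounded_open K using K by (rule bounded_open_elem)
      have "L2_ip K q (grad \<phi>) = L2_ip K q (grad (zext K \<phi>))"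
        by (rule L2_ip_cong) (simp add: test_function_part(2)[OF \<phi> K])
      also have "\<dots> = - L2_ip K g (zext K \<phi>)"
        using bspec[OF g K] test_function_part(1)[OF \<phi> K] unfolding K.has_weak_div_iff by blast
      also have "L2_ip K g (zext K \<phi>) = L2_ip K g \<phi>"
        by (rule L2_ip_cong) (simp add: zext_def)
      finally show "L2_ip K q (grad \<phi>) = - L2_ip K g \<phi>" .
    qed
    also have "\<dots> = - L2_ip W g \<phi>"
      by (simp add: sum_negf ip_W[OF gW W.test_L2(1)[OF \<phi>]])
    finally show "L2_ip W q (grad \<phi>) = - L2_ip W g \<phi>" .
  qed
qed

end

lemma L2_cong:
  assumes U: "open U" and eq: "\<And>x. x \<in> U \<Longrightarrow> f x = g x"
  shows "f \<in> L2 U \<longleftrightarrow> g \<in> L2 U"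
proof -
  have "zext U f = zext U g" by (rule ext) (simp add: zext_def eq)
  then show ?thesis by (simp only: zext_L2_iff[OF U])
qed

lemma has_weak_grad_cong:
  assumes "\<And>x. x \<in> U \<Longrightarrow> v x = w x" "\<And>x. x \<in> U \<Longrightarrow> g x = h x" "open U"
  shows "has_weak_grad U v g \<longleftrightarrow> has_weak_grad U w h"
proof -
  have "(LINT x | lebesgue_on U. v x *\<^sub>R grad \<phi> x) = (LINT x | lebesgue_on U. w x *\<^sub>R grad \<phi> x)"
    "(LINT x | lebesgue_on U. \<phi> x *\<^sub>R g x) = (LINT x | lebesgue_on U. \<phi> x *\<^sub>R h x)" for \<phi>
    by (intro Bochner_Integration.integral_cong refl, simp add: assms)+
  then show ?thesis using L2_cong[OF assms(3,2)] by (simp add: has_weak_grad_def)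
qed

lemma has_weak_div_cong:
  assumes "\<And>x. x \<in> U \<Longrightarrow> v x = w x" "\<And>x. x \<in> U \<Longrightarrow> g x = h x" "open U"
  shows "has_weak_div U v g \<longleftrightarrow> has_weak_div U w h"
proof -
  have "(LINT x | lebesgue_on U. v x \<bullet> grad \<phi> x) = (LINT x | lebesgue_on U. w x \<bullet> grad \<phi> x)"
    "(LINT x | lebesgue_on U. \<phi> x * g x) = (LINT x | lebesgue_on U. \<phi> x * h x)" for \<phi>
    by (intro Bochner_Integration.integral_cong refl, simp add: assms)+
  then show ?thesis using L2_cong[OF assms(3,2)] by (simp add: has_weak_div_def)
qed

lemma comb_fst: "fst \<circ> comb a z b z' = comb a (fst \<circ> z) b (fst \<circ> z')"
  by (simp add: comb_def fun_eq_iff)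

lemma comb_snd: "snd \<circ> comb a z b z' = comb a (snd \<circ> z) b (snd \<circ> z')"
  by (simp add: comb_def fun_eq_iff)

context bounded_open
begin

lemma zero_H1: "(\<lambda>x. 0) \<in> H1 U"
  by (rule H1I[OF smooth_L2(1)[OF smooth_const] smooth_has_weak_grad[OF smooth_const]])

lemma has_weak_grad_zero: "has_weak_grad U (\<lambda>x. 0) (\<lambda>x. 0)"
  by (simp add: has_weak_grad_def L2_zero)

lemma has_weak_div_zero: "has_weak_div U (\<lambda>x. 0) (\<lambda>x. 0)"
  by (simp add: has_weak_div_def L2_zero)

lemma zero_Hdiv: "(\<lambda>x. 0) \<in> Hdiv U"
  by (rule HdivI[OF L2_zero has_weak_div_zero])

lemma green_zero: "v \<in> H1 U \<Longrightarrow> green U (\<lambda>x. 0) v = 0" "r \<in> Hdiv U \<Longrightarrow> green U r (\<lambda>x. 0) = 0"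
  using green_eq[OF L2_zero has_weak_div_zero H1D(1,2)] green_eq[OF HdivD(1,2) L2_zero has_weak_grad_zero]
  by (simp_all add: L2_ip_def)

lemma zero_zbv: "(\<lambda>x. 0) \<in> zero_boundary_values U"
  by (simp add: zero_boundary_values_iff_green zero_H1 green_zero)

lemma trace_eq_iff:
  assumes v: "v \<in> H1 U" and w: "w \<in> H1 U"
  shows "trace U v = trace U w \<longleftrightarrow> comb 1 v (-1) w \<in> zero_boundary_values U"
proof
  assume eq: "trace U v = trace U w"
  have "comb 1 v (-1) v = (\<lambda>x. 0)" by (simp add: comb_def)
  then have "v \<in> trace U v" using v zero_zbv by (simp add: trace_def diff_eq_comb)
  then have "v \<in> trace U w" by (simp only: eq)
  then show "comb 1 v (-1) w \<in> zero_boundary_values U" by (simp add: trace_def diff_eq_comb)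
next
  assume z: "comb 1 v (-1) w \<in> zero_boundary_values U"
  have 1: "comb 1 x (-1) w = comb 1 (comb 1 x (-1) v) 1 (comb 1 v (-1) w)"
    and 2: "comb 1 x (-1) v = comb 1 (comb 1 x (-1) w) (-1) (comb 1 v (-1) w)" for x
    by (simp_all add: comb_def fun_eq_iff)
  have "comb 1 x (-1) v \<in> zero_boundary_values U \<longleftrightarrow> comb 1 x (-1) w \<in> zero_boundary_values U" for x
    using zbv_comb[OF _ z, of "comb 1 x (-1) v" 1 1, folded 1[of x]]
      zbv_comb[OF _ z, of "comb 1 x (-1) w" 1 "-1", folded 2[of x]] by blast
  then show "trace U v = trace U w" by (simp add: trace_def diff_eq_comb)
qed

lemma in_trace: "v \<in> H1 U \<Longrightarrow> v \<in> trace U v"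
  using zero_zbv by (simp add: trace_def diff_eq_comb) (simp add: comb_def)

lemma in_trace_iff: "v \<in> H1 U \<Longrightarrow> w \<in> trace U v \<longleftrightarrow> w \<in> H1 U \<and> comb 1 w (-1) v \<in> zero_boundary_values U"
  by (simp add: trace_def diff_eq_comb)

lemma H10_eq: "H10 U = zero_boundary_values U"
proof -
  have eq: "comb 1 v (-1) (\<lambda>x. 0) = v" for v :: "real ^ 'd \<Rightarrow> real" by (simp add: comb_def)
  show ?thesis
  proof (rule set_eqI)
    fix v show "v \<in> H10 U \<longleftrightarrow> v \<in> zero_boundary_values U"
    proof (cases "v \<in> H1 U")
      case True
      then show ?thesis by (simp add: H10_def trace_eq_iff zero_H1 eq)
    next
      case False
      then show ?thesis using zbv_H1 by (auto simp: H10_def)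
    qed
  qed
qed

text \<open>
  The normal trace does not depend on the extension chosen to evaluate it.
\<close>

lemma normal_trace_trace:
  assumes r: "r \<in> Hdiv U" and v: "v \<in> H1 U"
  shows "normal_trace U r (trace U v) = green U r v"
proof -
  define w where "w = (SOME w. w \<in> trace U v)"
  have "w \<in> trace U v" 
    using someI[of "\<lambda>w. w \<in> trace U v", OF in_trace[OF v]] by (simp add: w_def)
  then have w: "w \<in> H1 U" "comb 1 w (-1) v \<in> zero_boundary_values U" using in_trace_iff[OF v] by auto
  have "green U r (comb 1 w (-1) v) = 0" by (rule green_zero_boundary[OF w(2) r])
  then have "green U r w = green U r v" using green_comb_right[OF r w(1) v] by simp
  moreover have "trace U v \<in> Hhalf U" using v by (simp add: Hhalf_def)
  ultimately show ?thesis by (simp add: normal_trace_def w_def green_def Let_def)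
qed

lemma normal_trace_eq_iff:
  assumes r: "r \<in> Hdiv U" and s: "s \<in> Hdiv U"
  shows "normal_trace U r = normal_trace U s \<longleftrightarrow> (\<forall>v\<in>H1 U. green U (comb 1 r (-1) s) v = 0)"
proof -
  have "normal_trace U r = normal_trace U s \<longleftrightarrow> (\<forall>g\<in>Hhalf U. normal_trace U r g = normal_trace U s g)"
  proof
    assume eq: "\<forall>g\<in>Hhalf U. normal_trace U r g = normal_trace U s g"
    show "normal_trace U r = normal_trace U s"
    proof
      fix g show "normal_trace U r g = normal_trace U s g"
        using eq by (cases "g \<in> Hhalf U") (simp_all add: normal_trace_def)
    qed
  qed simp
  also have "\<dots> \<longleftrightarrow> (\<forall>v\<in>H1 U. green U r v = green U s v)"
    by (simp add: Hhalf_def normal_trace_trace r s)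
  also have "\<dots> \<longleftrightarrow> (\<forall>v\<in>H1 U. green U (comb 1 r (-1) s) v = 0)"
    using green_comb_left[OF r s] by simp
  finally show ?thesis .
qed

lemma trace_diff:
  assumes v: "v \<in> H1 U" and w: "w \<in> H1 U"
  shows "{v' - w' | v' w'. v' \<in> trace U v \<and> w' \<in> trace U w} = trace U (comb 1 v (-1) w)"
proof (intro equalityI subsetI)
  fix x assume "x \<in> {v' - w' | v' w'. v' \<in> trace U v \<and> w' \<in> trace U w}"
  then obtain v' w' where x: "x = comb 1 v' (-1) w'" "v' \<in> trace U v" "w' \<in> trace U w"
    unfolding diff_eq_comb by blast
  have v': "v' \<in> H1 U" "comb 1 v' (-1) v \<in> zero_boundary_values U" using x(2) in_trace_iff[OF v] by auto
  have w': "w' \<in> H1 U" "comb 1 w' (-1) w \<in> zero_boundary_values U" using x(3) in_trace_iff[OF w] by auto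
  have "comb 1 x (-1) (comb 1 v (-1) w) = comb 1 (comb 1 v' (-1) v) (-1) (comb 1 w' (-1) w)"
    unfolding x(1) by (simp add: comb_def fun_eq_iff)
  then show "x \<in> trace U (comb 1 v (-1) w)"
    unfolding in_trace_iff[OF H1_comb[OF v w]]
    using zbv_comb[OF v'(2) w'(2)] H1_comb[OF v'(1) w'(1)] x(1) by simp
next
  fix x assume "x \<in> trace U (comb 1 v (-1) w)"
  then have x: "x \<in> H1 U" "comb 1 x (-1) (comb 1 v (-1) w) \<in> zero_boundary_values U"
    unfolding in_trace_iff[OF H1_comb[OF v w]] by auto
  have "comb 1 (comb 1 x 1 w) (-1) v = comb 1 x (-1) (comb 1 v (-1) w)" by (simp add: comb_def fun_eq_iff)
  then have "comb 1 x 1 w \<in> trace U v" unfolding in_trace_iff[OF v] using x H1_comb[OF x(1) w] by simp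
  moreover have "x = comb 1 x 1 w - w" by (simp add: comb_def fun_eq_iff)
  ultimately show "x \<in> {v' - w' | v' w'. v' \<in> trace U v \<and> w' \<in> trace U w}" using in_trace[OF w] by blast
qed

end

context mesh
begin

lemma H1_W_iff: "v \<in> H1 W \<longleftrightarrow> (\<forall>K\<in>M. v \<in> H1 K)"
proof
  assume v: "v \<in> H1 W"
  show "\<forall>K\<in>M. v \<in> H1 K"
  proof
    fix K assume K: "K \<in> M"
    interpret K: bounded_open K using K by (rule bounded_open_elem)
    show "v \<in> H1 K"
      using W.H1D(1,2)[OF v] K L2_W_iff has_weak_grad_W_iff by (auto intro: K.H1I)
  qed
next
  assume v: "\<forall>K\<in>M. v \<in> H1 K"
  then have vK: "v \<in> L2 K" "has_weak_grad K v (weak_grad K v)" if "K \<in> M" for K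
    using bounded_open.H1D[OF bounded_open_elem] that by blast+
  have vW: "v \<in> L2 W" using vK L2_W_iff by blast
  have "has_weak_grad K v (\<lambda>x. \<Sum>K\<in>M. zext K (weak_grad K v) x)" if "K \<in> M" for K
    using vK(2)[OF that] by (subst has_weak_grad_cong[OF refl zext_sum_elem[OF that] elem(1)[OF that]])
  then show "v \<in> H1 W" using vW by (intro W.H1I) (auto simp: has_weak_grad_W_iff)
qed

lemma Hdiv_W_iff: "r \<in> Hdiv W \<longleftrightarrow> (\<forall>K\<in>M. r \<in> Hdiv K)"
proof
  assume r: "r \<in> Hdiv W"
  show "\<forall>K\<in>M. r \<in> Hdiv K"
  proof
    fix K assume K: "K \<in> M"
    interpret K: bounded_open K using K by (rule bounded_open_elem)
    show "r \<in> Hdiv K"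
      using W.HdivD(1,2)[OF r] K L2_W_iff has_weak_div_W_iff by (auto intro: K.HdivI)
  qed
next
  assume r: "\<forall>K\<in>M. r \<in> Hdiv K"
  then have rK: "r \<in> L2 K" "has_weak_div K r (weak_div K r)" if "K \<in> M" for K
    using bounded_open.HdivD[OF bounded_open_elem] that by blast+
  have rW: "r \<in> L2 W" using rK L2_W_iff by blast
  have "has_weak_div K r (\<lambda>x. \<Sum>K\<in>M. zext K (weak_div K r) x)" if "K \<in> M" for K
    using rK(2)[OF that] by (subst has_weak_div_cong[OF refl zext_sum_elem[OF that] elem(1)[OF that]])
  then show "r \<in> Hdiv W" using rW by (intro W.HdivI) (auto simp: has_weak_div_W_iff)
qed

lemma Y_dpg_eq: "Y_dpg M = {y. fst \<circ> y \<in> Hdiv W \<and> snd \<circ> y \<in> H1 W}"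
  by (auto simp: Y_dpg_def H1_W_iff Hdiv_W_iff)

lemma weak_grad_local:
  assumes "v \<in> H1 W" "K \<in> M" shows "has_weak_grad K v (weak_grad W v)" "ae_eq K (weak_grad W v) (weak_grad K v)"
proof -
  interpret K: bounded_open K using assms(2) by (rule bounded_open_elem)
  show h: "has_weak_grad K v (weak_grad W v)"
    using W.H1D(1,2)[OF assms(1)] assms(2) has_weak_grad_W_iff by blast
  have "v \<in> L2 K" using W.H1D(1)[OF assms(1)] assms(2) L2_W_iff by blast
  from K.weak_grad_ae[OF this h] show "ae_eq K (weak_grad W v) (weak_grad K v)" by (rule ae_eq_sym)
qed

lemma weak_div_local:
  assumes "r \<in> Hdiv W" "K \<in> M" shows "has_weak_div K r (weak_div W r)" "ae_eq K (weak_div W r) (weak_div K r)"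
proof -
  interpret K: bounded_open K using assms(2) by (rule bounded_open_elem)
  show h: "has_weak_div K r (weak_div W r)"
    using W.HdivD(1,2)[OF assms(1)] assms(2) has_weak_div_W_iff by blast
  have "r \<in> L2 K" using W.HdivD(1)[OF assms(1)] assms(2) L2_W_iff by blast
  from K.weak_div_ae[OF this h] show "ae_eq K (weak_div W r) (weak_div K r)" by (rule ae_eq_sym)
qed

lemma L2_K: "f \<in> L2 W \<Longrightarrow> K \<in> M \<Longrightarrow> f \<in> L2 K"
  using L2_W_iff by blast

lemma green_W:
  assumes r: "r \<in> Hdiv W" and v: "v \<in> H1 W"
  shows "green W r v = (\<Sum>K\<in>M. green K r v)"
proof -
  note rD = W.HdivD[OF r] and vD = W.H1D[OF v]
  have "green K r v = L2_ip K r (weak_grad W v) + L2_ip K (weak_div W r) v" if K: "K \<in> M" for K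
    by (rule bounded_open.green_eq[OF bounded_open_elem[OF K] L2_K[OF rD(1) K] weak_div_local(1)[OF r K]
          L2_K[OF vD(1) K] weak_grad_local(1)[OF v K]])
  then show ?thesis
    by (simp add: green_def[of W] ip_W[OF rD(1) vD(3)] ip_W[OF rD(3) vD(1)] sum.distrib)
qed

lemma zext_L2: "K \<in> M \<Longrightarrow> f \<in> L2 K \<Longrightarrow> zext K f \<in> L2 U" if "open U"
  using L2_subset[OF _ subset_UNIV that open_UNIV] zext_L2_iff[OF elem(1)] by blast

lemma L2_ip_zext_left:
  assumes K: "K \<in> M" shows "L2_ip W (zext K f) g = L2_ip K f g"
proof -
  have "L2_ip W (zext K f) g = L2_ip K (zext K f) g"
    by (rule L2_ip_restrict[OF elem_sub[OF K] elem(1)[OF K] W.open_U]) (simp add: zext_def)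
  then show ?thesis by (simp add: L2_ip_cong[of K "zext K f" g f g] zext_def)
qed

text \<open>
  Extension by zero stays in the broken space and restricts the pairing to a single element.
\<close>

lemma Hdiv_zext:
  assumes K: "K \<in> M" and r: "r \<in> Hdiv K"
  shows "zext K r \<in> Hdiv W" and "v \<in> H1 W \<Longrightarrow> green W (zext K r) v = green K r v"
proof -
  interpret K: bounded_open K using K by (rule bounded_open_elem)
  note rD = K.HdivD[OF r]
  have L: "zext K r \<in> L2 W" using W.open_U K rD(1) by (rule zext_L2)
  have div: "has_weak_div W (zext K r) (zext K (weak_div K r))"
    unfolding has_weak_div_W_iff[OF L]
  proof
    fix K' assume K': "K' \<in> M"
    interpret K': bounded_open K' using K' by (rule bounded_open_elem)
    show "has_weak_div K' (zext K r) (zext K (weak_div K r))"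
    proof (cases "K' = K")
      case True
      then show ?thesis
        using rD(2) K.open_U by (subst has_weak_div_cong[of K' _ r _ "weak_div K r"]) (simp_all add: zext_def)
    next
      case False
      then have "x \<notin> K" if "x \<in> K'" for x using disj K K' that by blast
      then show ?thesis
        using K'.has_weak_div_zero K'.open_U
        by (subst has_weak_div_cong[of K' _ "\<lambda>x. 0" _ "\<lambda>x. 0"]) (simp_all add: zext_def)
    qed
  qed
  show "zext K r \<in> Hdiv W" by (rule W.HdivI[OF L div])
  assume v: "v \<in> H1 W"
  note vD = W.H1D[OF v]
  have "green W (zext K r) v = L2_ip W (zext K r) (weak_grad W v) + L2_ip W (zext K (weak_div K r)) v"
    by (rule W.green_eq[OF L div vD(1,2)])
  also have "\<dots> = green K r v"
    using K.green_eq[OF rD(1,2) L2_K[OF vD(1) K] weak_grad_local(1)[OF v K]] by (simp add: L2_ip_zext_left[OF K])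
  finally show "green W (zext K r) v = green K r v" .
qed

lemma H1_zext:
  assumes K: "K \<in> M" and v: "v \<in> H1 K"
  shows "zext K v \<in> H1 W" and "r \<in> Hdiv W \<Longrightarrow> green W r (zext K v) = green K r v"
proof -
  interpret K: bounded_open K using K by (rule bounded_open_elem)
  note vD = K.H1D[OF v]
  have L: "zext K v \<in> L2 W" using W.open_U K vD(1) by (rule zext_L2)
  have gr: "has_weak_grad W (zext K v) (zext K (weak_grad K v))"
    unfolding has_weak_grad_W_iff[OF L]
  proof
    fix K' assume K': "K' \<in> M"
    interpret K': bounded_open K' using K' by (rule bounded_open_elem)
    show "has_weak_grad K' (zext K v) (zext K (weak_grad K v))"
    proof (cases "K' = K")
      case True
      then show ?thesis
        using vD(2) K.open_U by (subst has_weak_grad_cong[of K' _ v _ "weak_grad K v"]) (simp_all add: zext_def)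
    next
      case False
      then have "x \<notin> K" if "x \<in> K'" for x using disj K K' that by blast
      then show ?thesis
        using K'.has_weak_grad_zero K'.open_U
        by (subst has_weak_grad_cong[of K' _ "\<lambda>x. 0" _ "\<lambda>x. 0"]) (simp_all add: zext_def)
    qed
  qed
  show "zext K v \<in> H1 W" by (rule W.H1I[OF L gr])
  assume r: "r \<in> Hdiv W"
  note rD = W.HdivD[OF r]
  have "green W r (zext K v) = L2_ip W r (zext K (weak_grad K v)) + L2_ip W (weak_div W r) (zext K v)"
    by (rule W.green_eq[OF rD(1,2) L gr])
  also have "\<dots> = L2_ip K r (weak_grad K v) + L2_ip K (weak_div W r) v"
    by (simp add: L2_ip_sym[of W _ "zext K _"] L2_ip_zext_left[OF K] L2_ip_sym[of K r] L2_ip_sym[of K "weak_div W r"])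
  also have "\<dots> = green K r v"
    using K.green_eq[OF L2_K[OF rD(1) K] weak_div_local(1)[OF r K] vD(1,2)] by simp
  finally show "green W r (zext K v) = green K r v" .
qed

end

section \<open>The operator and its adjoint on the broken test space\<close>

lemma L2_ip_pair:
  assumes "f \<in> L2 U" "g \<in> L2 U"
  shows "L2_ip U f g = L2_ip U (fst \<circ> f) (fst \<circ> g) + L2_ip U (snd \<circ> f) (snd \<circ> g)"
  using L2_inner_integrable[OF L2_fst[OF assms(1)] L2_fst[OF assms(2)]]
    L2_inner_integrable[OF L2_snd[OF assms(1)] L2_snd[OF assms(2)]]
  by (simp add: L2_ip_def inner_prod_def)

lemma restrict_eq_iff: "(\<lambda>x\<in>A. f x) = (\<lambda>x\<in>A. g x) \<longleftrightarrow> (\<forall>x\<in>A. f x = g x)"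
  by (metis restrict_apply' restrict_ext)

context mesh
begin

definition hat :: "'d field \<Rightarrow> 'd interface" where
  "hat z = (tr M (snd \<circ> z), tr_n M (fst \<circ> z))"

text \<open>
  The interface terms of the bilinear form for the interface values of \<open>z\<close>, summed over the mesh.
\<close>

definition bd :: "'d field \<Rightarrow> 'd field \<Rightarrow> real" where
  "bd z y = green W (fst \<circ> y) (snd \<circ> z) + green W (fst \<circ> z) (snd \<circ> y)"

lemma H1_Om:
  assumes "v \<in> H1 \<Omega>"
  shows "has_weak_grad W v (weak_grad \<Omega> v)" "v \<in> H1 W" "ae_eq W (weak_grad W v) (weak_grad \<Omega> v)"
proof -
  note v = Om.H1D[OF assms]
  have vW: "v \<in> L2 W" using v(1) L2_Om by blast
  show h: "has_weak_grad W v (weak_grad \<Omega> v)"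
    by (rule has_weak_grad_restrict[OF W.bounded_open_axioms Omega W_sub v(1,2)])
  show "v \<in> H1 W" by (rule W.H1I[OF vW h])
  show "ae_eq W (weak_grad W v) (weak_grad \<Omega> v)" by (rule W.weak_grad_ae[OF vW h])
qed

lemma Hdiv_Om:
  assumes "r \<in> Hdiv \<Omega>"
  shows "has_weak_div W r (weak_div \<Omega> r)" "r \<in> Hdiv W" "ae_eq W (weak_div W r) (weak_div \<Omega> r)"
proof -
  note r = Om.HdivD[OF assms]
  have rW: "r \<in> L2 W" using r(1) L2_Om by blast
  show h: "has_weak_div W r (weak_div \<Omega> r)"
    by (rule has_weak_div_restrict[OF W.bounded_open_axioms Omega W_sub r(2)])
  show "r \<in> Hdiv W" by (rule W.HdivI[OF rW h])
  show "ae_eq W (weak_div W r) (weak_div \<Omega> r)" by (rule W.weak_div_ae[OF rW h])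
qed

lemma green_Om:
  assumes r: "r \<in> Hdiv \<Omega>" and v: "v \<in> H1 \<Omega>"
  shows "green \<Omega> r v = green W r v"
proof -
  note rD = Om.HdivD[OF r] and vD = Om.H1D[OF v]
  have "green W r v = L2_ip W r (weak_grad \<Omega> v) + L2_ip W (weak_div \<Omega> r) v"
    using rD(1) vD(1) Hdiv_Om(1)[OF r] H1_Om(1)[OF v] by (intro W.green_eq) (simp_all add: L2_Om)
  then show ?thesis by (simp add: green_def[of \<Omega>] L2_ip_Om rD vD)
qed

lemma DomD:
  assumes "z \<in> Hdiv_H10 \<Omega>"
  shows "fst \<circ> z \<in> Hdiv \<Omega>" "snd \<circ> z \<in> zero_boundary_values \<Omega>" "snd \<circ> z \<in> H1 \<Omega>"
    "fst \<circ> z \<in> Hdiv W" "snd \<circ> z \<in> H1 W" "z \<in> L2 \<Omega>" "z \<in> L2 W"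
proof -
  show 1: "fst \<circ> z \<in> Hdiv \<Omega>" "snd \<circ> z \<in> zero_boundary_values \<Omega>"
    using assms by (simp_all add: Hdiv_H10_def Om.H10_eq)
  show 2: "snd \<circ> z \<in> H1 \<Omega>" using Om.zbv_H1[OF 1(2)] .
  show "fst \<circ> z \<in> Hdiv W" "snd \<circ> z \<in> H1 W" using Hdiv_Om(2)[OF 1(1)] H1_Om(2)[OF 2] .
  show z: "z \<in> L2 \<Omega>" using L2_pair[OF Om.HdivD(1)[OF 1(1)] Om.H1D(1)[OF 2]] by simp
  then show "z \<in> L2 W" by (simp add: L2_Om)
qed

lemma Dom_comb: "z \<in> Hdiv_H10 \<Omega> \<Longrightarrow> z' \<in> Hdiv_H10 \<Omega> \<Longrightarrow> comb a z b z' \<in> Hdiv_H10 \<Omega>"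
  by (simp add: Hdiv_H10_def Om.H10_eq comb_fst comb_snd Om.Hdiv_comb Om.zbv_comb)

lemma zero_Dom: "(\<lambda>x. 0) \<in> Hdiv_H10 \<Omega>"
  by (simp add: Hdiv_H10_def Om.H10_eq comp_def Om.zero_Hdiv Om.zero_zbv)

lemma YD:
  assumes "y \<in> Y_dpg M"
  shows "fst \<circ> y \<in> Hdiv W" "snd \<circ> y \<in> H1 W" "y \<in> L2 W"
proof -
  show 1: "fst \<circ> y \<in> Hdiv W" "snd \<circ> y \<in> H1 W" using assms by (simp_all add: Y_dpg_eq)
  show "y \<in> L2 W" using L2_pair[OF W.HdivD(1)[OF 1(1)] W.H1D(1)[OF 1(2)]] by simp
qed

lemma YI: "\<tau> \<in> Hdiv W \<Longrightarrow> \<nu> \<in> H1 W \<Longrightarrow> (\<lambda>x. (\<tau> x, \<nu> x)) \<in> Y_dpg M"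
  by (simp add: Y_dpg_eq comp_def)

lemma Y_comb: "y \<in> Y_dpg M \<Longrightarrow> y' \<in> Y_dpg M \<Longrightarrow> comb a y b y' \<in> Y_dpg M"
  by (simp add: Y_dpg_eq comb_fst comb_snd W.Hdiv_comb W.H1_comb)

lemma zero_Y: "(\<lambda>x. 0) \<in> Y_dpg M"
  by (simp add: Y_dpg_eq comp_def W.zero_Hdiv W.zero_H1)

lemma bd_comb:
  assumes "z \<in> Hdiv_H10 \<Omega>" "z' \<in> Hdiv_H10 \<Omega>" "y \<in> Y_dpg M"
  shows "bd (comb a z b z') y = a * bd z y + b * bd z' y"
  using DomD(4,5)[OF assms(1)] DomD(4,5)[OF assms(2)] YD(1,2)[OF assms(3)]
  by (simp add: bd_def comb_fst comb_snd W.green_comb_left W.green_comb_right algebra_simps)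

text \<open>
  Broken test functions separate interface values: those supported on one element express equality of
  the traces (by \<open>zero_boundary_values_iff_green\<close>) and of the normal traces there.
\<close>

lemma hat_eq_iff:
  assumes z: "z \<in> Hdiv_H10 \<Omega>" and z': "z' \<in> Hdiv_H10 \<Omega>"
  shows "hat z = hat z' \<longleftrightarrow> (\<forall>y\<in>Y_dpg M. bd (comb 1 z (-1) z') y = 0)"
proof -
  define r where "r = comb 1 (fst \<circ> z) (-1) (fst \<circ> z')"
  define v where "v = comb 1 (snd \<circ> z) (-1) (snd \<circ> z')"
  have rW: "r \<in> Hdiv W" and vW: "v \<in> H1 W"
    unfolding r_def v_def using DomD[OF z] DomD[OF z'] by (simp_all add: W.Hdiv_comb W.H1_comb)
  have bd: "bd (comb 1 z (-1) z') y = green W (fst \<circ> y) v + green W r (snd \<circ> y)" for y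
    by (simp add: bd_def r_def v_def comb_fst comb_snd)
  have "hat z = hat z' \<longleftrightarrow> (\<forall>K\<in>M. trace K (snd \<circ> z) = trace K (snd \<circ> z')) \<and>
      (\<forall>K\<in>M. normal_trace K (fst \<circ> z) = normal_trace K (fst \<circ> z'))"
    by (simp add: hat_def tr_def tr_n_def restrict_eq_iff)
  also have "\<dots> \<longleftrightarrow> (\<forall>K\<in>M. (\<forall>\<tau>\<in>Hdiv K. green K \<tau> v = 0)) \<and> (\<forall>K\<in>M. \<forall>\<nu>\<in>H1 K. green K r \<nu> = 0)"
  proof -
    have "trace K (snd \<circ> z) = trace K (snd \<circ> z') \<longleftrightarrow> (\<forall>\<tau>\<in>Hdiv K. green K \<tau> v = 0)"
      "normal_trace K (fst \<circ> z) = normal_trace K (fst \<circ> z') \<longleftrightarrow> (\<forall>\<nu>\<in>H1 K. green K r \<nu> = 0)" if K: "K \<in> M" for K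
    proof -
      interpret K: bounded_open K using K by (rule bounded_open_elem)
      have H: "snd \<circ> z \<in> H1 K" "snd \<circ> z' \<in> H1 K" "fst \<circ> z \<in> Hdiv K" "fst \<circ> z' \<in> Hdiv K"
        using DomD(4,5)[OF z] DomD(4,5)[OF z'] K H1_W_iff Hdiv_W_iff by blast+
      show "trace K (snd \<circ> z) = trace K (snd \<circ> z') \<longleftrightarrow> (\<forall>\<tau>\<in>Hdiv K. green K \<tau> v = 0)"
        unfolding v_def K.trace_eq_iff[OF H(1,2)] by (rule K.zero_boundary_values_iff_green[OF K.H1_comb[OF H(1,2)]])
      show "normal_trace K (fst \<circ> z) = normal_trace K (fst \<circ> z') \<longleftrightarrow> (\<forall>\<nu>\<in>H1 K. green K r \<nu> = 0)"
        unfolding r_def by (rule K.normal_trace_eq_iff[OF H(3,4)])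
    qed
    then show ?thesis by simp
  qed
  also have "\<dots> \<longleftrightarrow> (\<forall>y\<in>Y_dpg M. green W (fst \<circ> y) v + green W r (snd \<circ> y) = 0)"
  proof (intro iffI conjI ballI)
    fix y assume g: "(\<forall>K\<in>M. (\<forall>\<tau>\<in>Hdiv K. green K \<tau> v = 0)) \<and> (\<forall>K\<in>M. \<forall>\<nu>\<in>H1 K. green K r \<nu> = 0)"
      and y: "y \<in> Y_dpg M"
    have "fst \<circ> y \<in> Hdiv K" "snd \<circ> y \<in> H1 K" if "K \<in> M" for K using y that by (simp_all add: Y_dpg_def)
    then show "green W (fst \<circ> y) v + green W r (snd \<circ> y) = 0"
      using g by (simp add: green_W[OF YD(1)[OF y] vW] green_W[OF rW YD(2)[OF y]])
  next
    fix K \<tau> assume g: "\<forall>y\<in>Y_dpg M. green W (fst \<circ> y) v + green W r (snd \<circ> y) = 0" and K: "K \<in> M" and \<tau>: "\<tau> \<in> Hdiv K"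
    have "green W (zext K \<tau>) v + green W r (\<lambda>x. 0) = 0"
      using bspec[OF g YI[OF Hdiv_zext(1)[OF K \<tau>] W.zero_H1]] by (simp add: comp_def)
    then show "green K \<tau> v = 0" using Hdiv_zext(2)[OF K \<tau> vW] W.green_zero(2)[OF rW] by simp
  next
    fix K \<nu> assume g: "\<forall>y\<in>Y_dpg M. green W (fst \<circ> y) v + green W r (snd \<circ> y) = 0" and K: "K \<in> M" and \<nu>: "\<nu> \<in> H1 K"
    have "green W (\<lambda>x. 0) v + green W r (zext K \<nu>) = 0"
      using bspec[OF g YI[OF W.zero_Hdiv H1_zext(1)[OF K \<nu>]]] by (simp add: comp_def)
    then show "green K r \<nu> = 0" using H1_zext(2)[OF K \<nu> rW] W.green_zero(1)[OF vW] by simp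
  qed
  finally show ?thesis by (simp add: bd)
qed

lemma hat_diff_eq:
  assumes z: "z \<in> Hdiv_H10 \<Omega>" and z': "z' \<in> Hdiv_H10 \<Omega>"
  shows "hat_diff M (hat z) (hat z') = hat (comb 1 z (-1) z')"
proof -
  have "{v - w | v w. v \<in> trace K (snd \<circ> z) \<and> w \<in> trace K (snd \<circ> z')} = trace K (snd \<circ> comb 1 z (-1) z')"
    "(\<lambda>g\<in>Hhalf K. normal_trace K (fst \<circ> z) g - normal_trace K (fst \<circ> z') g) = normal_trace K (fst \<circ> comb 1 z (-1) z')"
    if K: "K \<in> M" for K
  proof -
    interpret K: bounded_open K using K by (rule bounded_open_elem)
    have H: "snd \<circ> z \<in> H1 K" "snd \<circ> z' \<in> H1 K" "fst \<circ> z \<in> Hdiv K" "fst \<circ> z' \<in> Hdiv K"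
      using DomD(4,5)[OF z] DomD(4,5)[OF z'] K H1_W_iff Hdiv_W_iff by blast+
    show "{v - w | v w. v \<in> trace K (snd \<circ> z) \<and> w \<in> trace K (snd \<circ> z')} = trace K (snd \<circ> comb 1 z (-1) z')"
      unfolding comb_snd by (rule K.trace_diff[OF H(1,2)])
    show "(\<lambda>g\<in>Hhalf K. normal_trace K (fst \<circ> z) g - normal_trace K (fst \<circ> z') g) = normal_trace K (fst \<circ> comb 1 z (-1) z')"
    proof
      fix g
      show "(\<lambda>g\<in>Hhalf K. normal_trace K (fst \<circ> z) g - normal_trace K (fst \<circ> z') g) g = normal_trace K (fst \<circ> comb 1 z (-1) z') g"
      proof (cases "g \<in> Hhalf K")
        case True
        then obtain v where v: "v \<in> H1 K" "g = trace K v" by (auto simp: Hhalf_def)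
        show ?thesis
          using True unfolding v(2) comb_fst
          by (simp add: K.normal_trace_trace[OF _ v(1)] H K.Hdiv_comb K.green_comb_left[OF H(3,4) v(1)])
      qed (simp add: normal_trace_def)
    qed
  qed
  then show ?thesis
    by (simp add: hat_diff_def hat_def tr_def tr_n_def restrict_eq_iff)
qed

lemma hat_zero_eq: "hat_zero M = hat (\<lambda>x. 0)"
proof -
  have "(\<lambda>g\<in>Hhalf K. 0) = normal_trace K (\<lambda>x. 0)" if K: "K \<in> M" for K
  proof
    fix g
    interpret K: bounded_open K using K by (rule bounded_open_elem)
    show "(\<lambda>g\<in>Hhalf K. 0) g = normal_trace K (\<lambda>x. 0) g"
    proof (cases "g \<in> Hhalf K")
      case True
      then obtain v where v: "v \<in> H1 K" "g = trace K v" by (auto simp: Hhalf_def)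
      show ?thesis using True unfolding v(2) by (simp add: K.normal_trace_trace[OF K.zero_Hdiv v(1)] K.green_zero(1)[OF v(1)])
    qed (simp add: normal_trace_def)
  qed
  then show ?thesis by (simp add: hat_zero_def hat_def tr_def tr_n_def restrict_eq_iff comp_def)
qed

lemma Z_set_iff: "z \<in> Z_set \<Omega> M (hat z') \<longleftrightarrow> z \<in> Hdiv_H10 \<Omega> \<and> hat z = hat z'"
  by (simp add: Z_set_def hat_def)

lemma kernel_iff:
  "z \<in> Z_set \<Omega> M (hat_zero M) \<longleftrightarrow> z \<in> Hdiv_H10 \<Omega> \<and> (\<forall>y\<in>Y_dpg M. bd z y = 0)"
proof -
  have "comb 1 z (-1) (\<lambda>x. 0) = z" by (simp add: comb_def)
  then show ?thesis unfolding hat_zero_eq Z_set_iff using hat_eq_iff[OF _ zero_Dom, of z] by auto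
qed

lemma Z_set_kernel_iff:
  assumes z': "z' \<in> Hdiv_H10 \<Omega>"
  shows "z \<in> Z_set \<Omega> M (hat z') \<longleftrightarrow> z \<in> Hdiv_H10 \<Omega> \<and> comb 1 z (-1) z' \<in> Z_set \<Omega> M (hat_zero M)"
  unfolding Z_set_iff kernel_iff using hat_eq_iff[OF _ z'] Dom_comb[OF _ z'] by blast

lemma Xhat_obtain:
  assumes "what \<in> Xhat \<Omega> M"
  obtains z where "z \<in> Hdiv_H10 \<Omega>" "what = hat z"
proof -
  obtain v r where v: "v \<in> H10 \<Omega>" "r \<in> Hdiv \<Omega>" "what = (tr M v, tr_n M r)"
    using assms by (auto simp: Xhat_def)
  show thesis
    by (rule that[of "\<lambda>x. (r x, v x)"]) (use v in \<open>simp_all add: Hdiv_H10_def hat_def comp_def\<close>)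
qed

end

locale dpg = mesh \<Omega> M for \<Omega> :: "(real ^ 'd) set" and M :: "(real ^ 'd) set set" +
  fixes \<alpha> :: "real ^ 'd \<Rightarrow> real" and C :: real
  assumes alpha_measurable: "\<alpha> \<in> borel_measurable borel" and alpha_bound: "\<bar>\<alpha> x\<bar> \<le> C"
begin

lemma alpha_L2: "f \<in> L2 U \<Longrightarrow> (\<lambda>x. \<alpha> x *\<^sub>R f x) \<in> L2 U"
proof (rule L2_multiplier[OF _ alpha_bound])
  have "\<alpha> \<in> borel_measurable lebesgue" using alpha_measurable by (intro measurable_completion) simp
  then show "\<alpha> \<in> borel_measurable (lebesgue_on U)" by (rule measurable_restrict_space1)
qed

lemma alpha_ip: "L2_ip U (\<lambda>x. \<alpha> x *\<^sub>R f x) g = L2_ip U f (\<lambda>x. \<alpha> x *\<^sub>R g x)"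
  by (simp add: L2_ip_def)

lemma A_op_parts:
  "fst \<circ> A_op \<Omega> \<alpha> z = comb 1 (\<lambda>x. \<alpha> x *\<^sub>R (fst \<circ> z) x) 1 (weak_grad \<Omega> (snd \<circ> z))"
  "snd \<circ> A_op \<Omega> \<alpha> z = weak_div \<Omega> (fst \<circ> z)"
  by (simp_all add: A_op_def comb_def fun_eq_iff)

lemma A_adj_parts:
  "fst \<circ> A_adj U \<alpha> z = comb 1 (\<lambda>x. \<alpha> x *\<^sub>R (fst \<circ> z) x) (-1) (weak_grad U (snd \<circ> z))"
  "snd \<circ> A_adj U \<alpha> z = (\<lambda>x. - weak_div U (fst \<circ> z) x)"
  by (simp_all add: A_adj_def comb_def fun_eq_iff)

lemma L2_pairI: "fst \<circ> f \<in> L2 U \<Longrightarrow> snd \<circ> f \<in> L2 U \<Longrightarrow> f \<in> L2 U"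
  using L2_pair[of "fst \<circ> f" U "snd \<circ> f"] by simp

lemma L2_minus: "f \<in> L2 U \<Longrightarrow> (\<lambda>x. - f x) \<in> L2 U"
  using L2_comb[of f U f "-1" 0] by (simp add: comb_def)

lemma L2_ip_minus: "L2_ip U f (\<lambda>x. - g x) = - L2_ip U f g"
  by (simp add: L2_ip_def)

lemma A_op_L2:
  assumes "z \<in> Hdiv_H10 \<Omega>" shows "A_op \<Omega> \<alpha> z \<in> L2 \<Omega>" "A_op \<Omega> \<alpha> z \<in> L2 W"
proof -
  note z = DomD[OF assms]
  show "A_op \<Omega> \<alpha> z \<in> L2 \<Omega>"
    by (rule L2_pairI; unfold A_op_parts)
      (intro L2_comb alpha_L2 Om.HdivD(1)[OF z(1)] Om.H1D(3)[OF z(3)] Om.HdivD(3)[OF z(1)])+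
  then show "A_op \<Omega> \<alpha> z \<in> L2 W" by (simp add: L2_Om)
qed

lemma A_adj_L2:
  assumes "y \<in> Y_dpg M" shows "A_adj W \<alpha> y \<in> L2 W"
proof -
  note y = YD[OF assms]
  show ?thesis
    by (rule L2_pairI; unfold A_adj_parts)
      (intro L2_comb alpha_L2 L2_minus W.HdivD(1)[OF y(1)] W.H1D(3)[OF y(2)] W.HdivD(3)[OF y(1)])+
qed

lemma A_op_comb:
  assumes "z \<in> Hdiv_H10 \<Omega>" "z' \<in> Hdiv_H10 \<Omega>"
  shows "ae_eq \<Omega> (A_op \<Omega> \<alpha> (comb a z b z')) (comb a (A_op \<Omega> \<alpha> z) b (A_op \<Omega> \<alpha> z'))"
  using Om.weak_grad_comb[OF DomD(3)[OF assms(1)] DomD(3)[OF assms(2)], of a b]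
    Om.weak_div_comb[OF DomD(1)[OF assms(1)] DomD(1)[OF assms(2)], of a b]
  unfolding ae_eq_def
  by eventually_elim (simp add: A_op_def comb_fst comb_snd, simp add: comb_def scaleR_add_right mult.commute)

lemma A_adj_comb:
  assumes "y \<in> Y_dpg M" "y' \<in> Y_dpg M"
  shows "ae_eq W (A_adj W \<alpha> (comb a y b y')) (comb a (A_adj W \<alpha> y) b (A_adj W \<alpha> y'))"
  using W.weak_grad_comb[OF YD(2)[OF assms(1)] YD(2)[OF assms(2)], of a b]
    W.weak_div_comb[OF YD(1)[OF assms(1)] YD(1)[OF assms(2)], of a b]
  unfolding ae_eq_def
  by eventually_elim (simp add: A_adj_def comb_fst comb_snd, simp add: comb_def scaleR_add_right scaleR_diff_right mult.commute)

lemma A_adj_local: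
  assumes "y \<in> Y_dpg M" "K \<in> M"
  shows "ae_eq K (A_adj W \<alpha> y) (A_adj K \<alpha> y)"
  using weak_grad_local(2)[OF YD(2)[OF assms(1)] assms(2)] weak_div_local(2)[OF YD(1)[OF assms(1)] assms(2)]
  unfolding ae_eq_def by eventually_elim (simp add: A_adj_def)

lemma A_adj_L2_K:
  assumes "y \<in> Y_dpg M" "K \<in> M"
  shows "A_adj K \<alpha> y \<in> L2 K"
proof -
  interpret K: bounded_open K using assms(2) by (rule bounded_open_elem)
  have y: "fst \<circ> y \<in> Hdiv K" "snd \<circ> y \<in> H1 K" using assms by (simp_all add: Y_dpg_def)
  show ?thesis
    by (rule L2_pairI; unfold A_adj_parts)
      (intro L2_comb alpha_L2 L2_minus K.HdivD(1)[OF y(1)] K.H1D(3)[OF y(2)] K.HdivD(3)[OF y(1)])+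
qed

lemma ip_A_adj:
  assumes "f \<in> L2 W" "y \<in> Y_dpg M"
  shows "(\<Sum>K\<in>M. L2_ip K f (A_adj K \<alpha> y)) = L2_ip W f (A_adj W \<alpha> y)"
proof -
  have "L2_ip K f (A_adj K \<alpha> y) = L2_ip K f (A_adj W \<alpha> y)" if K: "K \<in> M" for K
    by (rule L2_cong_ae[OF L2_K[OF assms(1) K] L2_K[OF assms(1) K] A_adj_L2_K[OF assms(2) K]
          L2_K[OF A_adj_L2[OF assms(2)] K] ae_eq_refl ae_eq_sym[OF A_adj_local[OF assms(2) K]]])
  then show ?thesis by (simp add: ip_W[OF assms(1) A_adj_L2[OF assms(2)]])
qed

text \<open>
  Green's formula on the broken test space: the interface terms are the defect of adjointness.
\<close>

lemma bd_eq:
  assumes z: "z \<in> Hdiv_H10 \<Omega>" and y: "y \<in> Y_dpg M"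
  shows "bd z y = L2_ip W (A_op \<Omega> \<alpha> z) y - L2_ip W z (A_adj W \<alpha> y)"
proof -
  note zD = DomD[OF z] and yD = YD[OF y]
  note r = W.HdivD[OF zD(4)] and v = W.H1D[OF zD(5)] and t = W.HdivD[OF yD(1)] and n = W.H1D[OF yD(2)]
  note g = H1_Om(1)[OF zD(3)] and d = Hdiv_Om(1)[OF zD(1)]
  have gL: "weak_grad \<Omega> (snd \<circ> z) \<in> L2 W" and dL: "weak_div \<Omega> (fst \<circ> z) \<in> L2 W"
    using g d by (simp_all add: has_weak_grad_def has_weak_div_def)
  have 1: "green W (fst \<circ> y) (snd \<circ> z) = L2_ip W (fst \<circ> y) (weak_grad \<Omega> (snd \<circ> z)) + L2_ip W (weak_div W (fst \<circ> y)) (snd \<circ> z)"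
    by (rule W.green_eq[OF t(1,2) v(1) g])
  have 2: "green W (fst \<circ> z) (snd \<circ> y) = L2_ip W (fst \<circ> z) (weak_grad W (snd \<circ> y)) + L2_ip W (weak_div \<Omega> (fst \<circ> z)) (snd \<circ> y)"
    by (rule W.green_eq[OF r(1) d n(1,2)])
  have 3: "L2_ip W (A_op \<Omega> \<alpha> z) y = L2_ip W (\<lambda>x. \<alpha> x *\<^sub>R (fst \<circ> z) x) (fst \<circ> y)
      + L2_ip W (weak_grad \<Omega> (snd \<circ> z)) (fst \<circ> y) + L2_ip W (weak_div \<Omega> (fst \<circ> z)) (snd \<circ> y)"
    unfolding L2_ip_pair[OF A_op_L2(2)[OF z] yD(3)] A_op_parts
    using L2_ip_comb_left[OF alpha_L2[OF r(1)] gL t(1), of 1 1] by simp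
  have 4: "L2_ip W z (A_adj W \<alpha> y) = L2_ip W (fst \<circ> z) (\<lambda>x. \<alpha> x *\<^sub>R (fst \<circ> y) x)
      - L2_ip W (fst \<circ> z) (weak_grad W (snd \<circ> y)) - L2_ip W (snd \<circ> z) (weak_div W (fst \<circ> y))"
    unfolding L2_ip_pair[OF zD(7) A_adj_L2[OF y]] A_adj_parts
    using L2_ip_comb_right[OF alpha_L2[OF t(1)] n(3) r(1), of 1 "-1"] by (simp add: L2_ip_minus)
  show ?thesis
    unfolding bd_def 1 2 3 4 alpha_ip[of W "fst \<circ> z"]
    by (simp add: L2_ip_sym[of W "fst \<circ> y"] L2_ip_sym[of W "weak_div W (fst \<circ> y)"])
qed

lemma b_dpg_eq:
  assumes w0: "w0 \<in> L2 \<Omega>" and z: "z \<in> Hdiv_H10 \<Omega>" and y: "y \<in> Y_dpg M"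
  shows "b_dpg M \<alpha> (w0, hat z) y = L2_ip W w0 (A_adj W \<alpha> y) + bd z y"
proof -
  have "normal_trace K (fst \<circ> y) (tr M (snd \<circ> z) K) = green K (fst \<circ> y) (snd \<circ> z)"
    "tr_n M (fst \<circ> z) K (trace K (snd \<circ> y)) = green K (fst \<circ> z) (snd \<circ> y)" if K: "K \<in> M" for K
  proof -
    interpret K: bounded_open K using K by (rule bounded_open_elem)
    have H: "snd \<circ> z \<in> H1 K" "fst \<circ> z \<in> Hdiv K" "fst \<circ> y \<in> Hdiv K" "snd \<circ> y \<in> H1 K"
      using DomD(4,5)[OF z] YD(1,2)[OF y] K H1_W_iff Hdiv_W_iff by blast+
    show "normal_trace K (fst \<circ> y) (tr M (snd \<circ> z) K) = green K (fst \<circ> y) (snd \<circ> z)"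
      using K by (simp add: tr_def K.normal_trace_trace[OF H(3,1)])
    show "tr_n M (fst \<circ> z) K (trace K (snd \<circ> y)) = green K (fst \<circ> z) (snd \<circ> y)"
      using K by (simp add: tr_n_def K.normal_trace_trace[OF H(2,4)])
  qed
  then have "b_dpg M \<alpha> (w0, hat z) y = (\<Sum>K\<in>M. L2_ip K w0 (A_adj K \<alpha> y))
      + (\<Sum>K\<in>M. green K (fst \<circ> y) (snd \<circ> z)) + (\<Sum>K\<in>M. green K (fst \<circ> z) (snd \<circ> y))"
    by (simp add: b_dpg_def hat_def sum.distrib)
  then show ?thesis
    using w0 ip_A_adj[OF _ y, of w0] DomD(4,5)[OF z] YD(1,2)[OF y]
    by (simp add: bd_def green_W L2_Om)
qed

lemma Y_ip_eq:
  assumes "y \<in> Y_dpg M" "y' \<in> Y_dpg M"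
  shows "Y_ip M \<alpha> s y y' = L2_ip W (A_adj W \<alpha> y) (A_adj W \<alpha> y') + L2_ip W y y' / s\<^sup>2"
proof -
  have "L2_ip K (A_adj K \<alpha> y) (A_adj K \<alpha> y') = L2_ip K (A_adj W \<alpha> y) (A_adj K \<alpha> y')" if K: "K \<in> M" for K
    by (rule L2_cong_ae[OF A_adj_L2_K[OF assms(1) K] L2_K[OF A_adj_L2[OF assms(1)] K] A_adj_L2_K[OF assms(2) K]
          A_adj_L2_K[OF assms(2) K] ae_eq_sym[OF A_adj_local[OF assms(1) K]] ae_eq_refl])
  then have "(\<Sum>K\<in>M. L2_ip K (A_adj K \<alpha> y) (A_adj K \<alpha> y')) = L2_ip W (A_adj W \<alpha> y) (A_adj W \<alpha> y')"
    using ip_A_adj[OF A_adj_L2[OF assms(1)] assms(2)] by simp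
  then show ?thesis
    by (simp add: Y_ip_def sum.distrib ip_W[OF YD(3)[OF assms(1)] YD(3)[OF assms(2)]] sum_divide_distrib)
qed

end

section \<open>Error representation and minimal extension\<close>

lemma L2_ip_diff_le:
  assumes "f \<in> L2 U" "h \<in> L2 U"
  shows "L2_dist2 U f h \<le> 2 * L2_ip U f f + 2 * L2_ip U h h"
  using L2.comb_square[OF assms, of 1 1] L2.comb_square[OF assms, of 1 "-1"] L2_ip_nonneg[of U "comb 1 f 1 h"]
  by simp

context dpg
begin

lemma A_adj_comb_ip:
  assumes "y \<in> Y_dpg M" "y' \<in> Y_dpg M" "f \<in> L2 W"
  shows "L2_ip W f (A_adj W \<alpha> (comb a y b y')) = a * L2_ip W f (A_adj W \<alpha> y) + b * L2_ip W f (A_adj W \<alpha> y')"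
proof -
  have "L2_ip W f (A_adj W \<alpha> (comb a y b y')) = L2_ip W f (comb a (A_adj W \<alpha> y) b (A_adj W \<alpha> y'))"
    by (rule L2_cong_ae[OF assms(3,3) A_adj_L2[OF Y_comb[OF assms(1,2)]]
          L2_comb[OF A_adj_L2[OF assms(1)] A_adj_L2[OF assms(2)]] ae_eq_refl A_adj_comb[OF assms(1,2)]])
  then show ?thesis by (simp add: L2_ip_comb_right A_adj_L2 assms)
qed

lemma Y_semi_inner: "semi_inner (Y_dpg M) (Y_ip M \<alpha> s)"
proof
  fix u v w :: "'d field" and a b
  assume u: "u \<in> Y_dpg M" and v: "v \<in> Y_dpg M"
  show c: "comb a u b v \<in> Y_dpg M" by (rule Y_comb[OF u v])
  show "Y_ip M \<alpha> s u v = Y_ip M \<alpha> s v u" by (simp add: Y_ip_eq u v L2_ip_sym)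
  assume w: "w \<in> Y_dpg M"
  have "L2_ip W (A_adj W \<alpha> (comb a u b v)) (A_adj W \<alpha> w)
      = a * L2_ip W (A_adj W \<alpha> u) (A_adj W \<alpha> w) + b * L2_ip W (A_adj W \<alpha> v) (A_adj W \<alpha> w)"
    using A_adj_comb_ip[OF u v A_adj_L2[OF w], of a b] by (simp add: L2_ip_sym)
  then show "Y_ip M \<alpha> s (comb a u b v) w = a * Y_ip M \<alpha> s u w + b * Y_ip M \<alpha> s v w"
    by (simp add: Y_ip_eq c u v w L2_ip_comb_left YD(3) add_divide_distrib algebra_simps)
next
  fix u assume "u \<in> Y_dpg M"
  then show "0 \<le> Y_ip M \<alpha> s u u" by (simp add: Y_ip_eq L2_ip_nonneg)
qed

text \<open>
  The test norm is the graph norm of the closed operator \<open>A_adj\<close>.  The weak derivatives of the limit are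
  read off from the limits of \<open>y\<close> and \<open>A_adj y\<close>.
\<close>

lemma Y_semi_hilbert:
  assumes s: "0 < s"
  shows "semi_hilbert (Y_dpg M) (Y_ip M \<alpha> s)"
proof -
  interpret semi_inner "Y_dpg M" "Y_ip M \<alpha> s" by (rule Y_semi_inner)
  show ?thesis
  proof unfold_locales
    show "Y_dpg M \<noteq> {}" using zero_Y by blast
    fix X :: "nat \<Rightarrow> 'd field"
    assume X: "\<And>n. X n \<in> Y_dpg M" and Cauchy: "\<And>e. 0 < e \<Longrightarrow> \<exists>N. \<forall>m\<ge>N. \<forall>n\<ge>N.
      Y_ip M \<alpha> s (comb 1 (X m) (-1) (X n)) (comb 1 (X m) (-1) (X n)) < e"
    let ?A = "\<lambda>n. A_adj W \<alpha> (X n)"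
    have lm: "W \<in> lmeasurable" by (intro lmeasurable_open W.open_U W.bounded_U)
    have XL: "X n \<in> L2 W" and AL: "?A n \<in> L2 W" for n using YD(3)[OF X] A_adj_L2[OF X] .
    have split: "Y_ip M \<alpha> s (comb 1 (X m) (-1) (X n)) (comb 1 (X m) (-1) (X n))
        = L2_dist2 W (?A m) (?A n)
        + L2_dist2 W (X m) (X n) / s\<^sup>2" for m n
    proof -
      note ae = A_adj_comb[OF X X, of 1 m "-1" n] and L = A_adj_L2[OF Y_comb[OF X X], of 1 m "-1" n]
      show ?thesis
        using L2_cong_ae[OF L L2_comb[OF AL AL] L L2_comb[OF AL AL] ae ae] by (simp add: Y_ip_eq Y_comb X)
    qed
    have nn: "0 \<le> L2_ip W f f / s\<^sup>2" for f :: "'d field" by (simp add: L2_ip_nonneg)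
    have "\<exists>N. \<forall>m\<ge>N. \<forall>n\<ge>N. L2_dist2 W (?A m) (?A n) < e" if "0 < e" for e
      using Cauchy[OF that] unfolding split by (meson nn le_add_same_cancel1 order_le_less_trans)
    from L2_complete[OF lm AL this] obtain g where g: "g \<in> L2 W"
      "(\<lambda>n. L2_dist2 W (?A n) g) \<longlonglongrightarrow> 0" by blast
    have "\<exists>N. \<forall>m\<ge>N. \<forall>n\<ge>N. L2_dist2 W (X m) (X n) < e" if "0 < e" for e
    proof -
      have "0 < e / s\<^sup>2" using that s by simp
      from Cauchy[OF this] obtain N where N: "\<And>m n. m \<ge> N \<Longrightarrow> n \<ge> N \<Longrightarrow>
        L2_dist2 W (?A m) (?A n)
        + L2_dist2 W (X m) (X n) / s\<^sup>2 < e / s\<^sup>2"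
        unfolding split by blast
      have "L2_dist2 W (X m) (X n) < e" if "m \<ge> N" "n \<ge> N" for m n
      proof -
        have "L2_dist2 W (X m) (X n) / s\<^sup>2 < e / s\<^sup>2"
          using N[OF that] L2_ip_nonneg[of W "comb 1 (?A m) (-1) (?A n)"] by linarith
        then show ?thesis using s by (simp add: divide_less_cancel)
      qed
      then show ?thesis by blast
    qed
    from L2_complete[OF lm XL this] obtain x where x: "x \<in> L2 W"
      "(\<lambda>n. L2_dist2 W (X n) x) \<longlonglongrightarrow> 0" by blast
    have xp: "fst \<circ> x \<in> L2 W" "snd \<circ> x \<in> L2 W" and gp: "fst \<circ> g \<in> L2 W" "snd \<circ> g \<in> L2 W"
      using L2_fst L2_snd x(1) g(1) by blast+
    have lim_parts: "(\<lambda>n. L2_ip W (fst \<circ> comb 1 (F n) (-1) f) (fst \<circ> comb 1 (F n) (-1) f)) \<longlonglongrightarrow> 0"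
      "(\<lambda>n. L2_ip W (snd \<circ> comb 1 (F n) (-1) f) (snd \<circ> comb 1 (F n) (-1) f)) \<longlonglongrightarrow> 0"
      if F: "\<And>n. F n \<in> L2 W" "f \<in> L2 W" "(\<lambda>n. L2_dist2 W (F n) f) \<longlonglongrightarrow> 0"
      for F :: "nat \<Rightarrow> 'd field" and f
    proof -
      have sp: "L2_dist2 W (F n) f
        = L2_ip W (fst \<circ> comb 1 (F n) (-1) f) (fst \<circ> comb 1 (F n) (-1) f)
        + L2_ip W (snd \<circ> comb 1 (F n) (-1) f) (snd \<circ> comb 1 (F n) (-1) f)" for n
        by (rule L2_ip_pair; rule L2_comb[OF F(1,2)])
      show "(\<lambda>n. L2_ip W (fst \<circ> comb 1 (F n) (-1) f) (fst \<circ> comb 1 (F n) (-1) f)) \<longlonglongrightarrow> 0"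
        by (rule tendsto_0_squeeze[OF _ _ F(3)]) (unfold sp, simp_all add: L2_ip_nonneg)
      show "(\<lambda>n. L2_ip W (snd \<circ> comb 1 (F n) (-1) f) (snd \<circ> comb 1 (F n) (-1) f)) \<longlonglongrightarrow> 0"
        by (rule tendsto_0_squeeze[OF _ _ F(3)]) (unfold sp, simp_all add: L2_ip_nonneg)
    qed
    have r: "fst \<circ> x \<in> Hdiv W" "has_weak_div W (fst \<circ> x) (\<lambda>y. - (snd \<circ> g) y)"
    proof -
      have L: "fst \<circ> X n \<in> L2 W" "weak_div W (fst \<circ> X n) \<in> L2 W" "has_weak_div W (fst \<circ> X n) (weak_div W (fst \<circ> X n))" for n
        using W.HdivD[OF YD(1)[OF X]] by blast+
      have eq: "L2_dist2 W (weak_div W (fst \<circ> X n)) (\<lambda>y. - (snd \<circ> g) y)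
          = L2_ip W (snd \<circ> comb 1 (?A n) (-1) g) (snd \<circ> comb 1 (?A n) (-1) g)" for n
        by (rule L2_ip_cong) (simp add: A_adj_def comb_def algebra_simps)
      show h: "has_weak_div W (fst \<circ> x) (\<lambda>y. - (snd \<circ> g) y)"
        by (rule W.has_weak_div_limit[OF L(1,2,3) xp(1) L2_minus[OF gp(2)]])
          (use lim_parts(1)[OF XL x] lim_parts(2)[OF AL g] in \<open>simp_all only: eq comb_fst\<close>)
      show "fst \<circ> x \<in> Hdiv W" by (rule W.HdivI[OF xp(1) h])
    qed
    have v: "snd \<circ> x \<in> H1 W" "has_weak_grad W (snd \<circ> x) (comb 1 (\<lambda>y. \<alpha> y *\<^sub>R (fst \<circ> x) y) (-1) (fst \<circ> g))"
    proof -
      have L: "snd \<circ> X n \<in> L2 W" "weak_grad W (snd \<circ> X n) \<in> L2 W" "has_weak_grad W (snd \<circ> X n) (weak_grad W (snd \<circ> X n))" for n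
        using W.H1D[OF YD(2)[OF X]] by blast+
      let ?G = "comb 1 (\<lambda>y. \<alpha> y *\<^sub>R (fst \<circ> x) y) (-1) (fst \<circ> g)"
      let ?p = "\<lambda>n. comb 1 (X n) (-1) x" and ?q = "\<lambda>n. comb 1 (?A n) (-1) g"
      have GL: "?G \<in> L2 W" by (intro L2_comb alpha_L2 xp gp)
      have pL: "fst \<circ> ?p n \<in> L2 W" and qL: "fst \<circ> ?q n \<in> L2 W" for n
        by (rule L2_fst[OF L2_comb[OF XL x(1)]], rule L2_fst[OF L2_comb[OF AL g(1)]])
      have eq: "comb 1 (weak_grad W (snd \<circ> X n)) (-1) ?G
          = comb 1 (\<lambda>y. \<alpha> y *\<^sub>R (fst \<circ> ?p n) y) (-1) (fst \<circ> ?q n)" for n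
        by (simp add: A_adj_def comb_def fun_eq_iff algebra_simps)
      have alim: "(\<lambda>n. L2_ip W (\<lambda>y. \<alpha> y *\<^sub>R (fst \<circ> ?p n) y) (\<lambda>y. \<alpha> y *\<^sub>R (fst \<circ> ?p n) y)) \<longlonglongrightarrow> 0"
      proof (rule tendsto_0_squeeze[where b="\<lambda>n. C\<^sup>2 * L2_ip W (fst \<circ> ?p n) (fst \<circ> ?p n)"])
        show "(\<lambda>n. C\<^sup>2 * L2_ip W (fst \<circ> ?p n) (fst \<circ> ?p n)) \<longlonglongrightarrow> 0"
          using tendsto_mult_left[OF lim_parts(1)[OF XL x], of "C\<^sup>2"] by simp
        show "L2_ip W (\<lambda>y. \<alpha> y *\<^sub>R (fst \<circ> ?p n) y) (\<lambda>y. \<alpha> y *\<^sub>R (fst \<circ> ?p n) y) \<le> C\<^sup>2 * L2_ip W (fst \<circ> ?p n) (fst \<circ> ?p n)" for n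
        proof -
          have "(norm (\<alpha> y *\<^sub>R (fst \<circ> ?p n) y))\<^sup>2 \<le> C\<^sup>2 * (norm ((fst \<circ> ?p n) y))\<^sup>2" for y
            using power_mono[OF alpha_bound abs_ge_zero, of y 2] by (simp add: power_mult_distrib mult_right_mono)
          then have "(LINT y|lebesgue_on W. (norm (\<alpha> y *\<^sub>R (fst \<circ> ?p n) y))\<^sup>2) \<le> (LINT y|lebesgue_on W. C\<^sup>2 * (norm ((fst \<circ> ?p n) y))\<^sup>2)"
            using L2D(2)[OF alpha_L2[OF pL]] L2D(2)[OF pL] by (intro integral_mono) auto
          then show ?thesis by (simp add: L2_ip_self)
        qed
      qed (rule L2_ip_nonneg)
      have glim: "(\<lambda>n. L2_dist2 W (weak_grad W (snd \<circ> X n)) ?G) \<longlonglongrightarrow> 0"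
      proof (rule tendsto_0_squeeze[OF L2_ip_nonneg])
        show "L2_dist2 W (weak_grad W (snd \<circ> X n)) ?G
            \<le> 2 * L2_ip W (\<lambda>y. \<alpha> y *\<^sub>R (fst \<circ> ?p n) y) (\<lambda>y. \<alpha> y *\<^sub>R (fst \<circ> ?p n) y) + 2 * L2_ip W (fst \<circ> ?q n) (fst \<circ> ?q n)" for n
          unfolding eq by (rule L2_ip_diff_le[OF alpha_L2[OF pL] qL])
        show "(\<lambda>n. 2 * L2_ip W (\<lambda>y. \<alpha> y *\<^sub>R (fst \<circ> ?p n) y) (\<lambda>y. \<alpha> y *\<^sub>R (fst \<circ> ?p n) y) + 2 * L2_ip W (fst \<circ> ?q n) (fst \<circ> ?q n)) \<longlonglongrightarrow> 0"
          using tendsto_add[OF tendsto_mult_left[OF alim, of 2] tendsto_mult_left[OF lim_parts(1)[OF AL g], of 2]] by simp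
      qed
      show h: "has_weak_grad W (snd \<circ> x) ?G"
        by (rule W.has_weak_grad_limit[OF L(1,2,3) xp(2) GL _ glim])
          (use lim_parts(2)[OF XL x] in \<open>simp only: comb_snd\<close>)
      show "snd \<circ> x \<in> H1 W" by (rule W.H1I[OF xp(2) h])
    qed
    have xY: "x \<in> Y_dpg M" using r(1) v(1) by (simp add: Y_dpg_eq)
    have Ax: "ae_eq W (A_adj W \<alpha> x) g"
      using W.weak_div_ae[OF xp(1) r(2)] W.weak_grad_ae[OF xp(2) v(2)]
      unfolding ae_eq_def by eventually_elim (simp add: A_adj_def comb_def prod_eq_iff)
    have "Y_ip M \<alpha> s (comb 1 (X n) (-1) x) (comb 1 (X n) (-1) x)
        = L2_dist2 W (?A n) g
        + L2_dist2 W (X n) x / s\<^sup>2" for n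
    proof -
      have ae: "ae_eq W (A_adj W \<alpha> (comb 1 (X n) (-1) x)) (comb 1 (?A n) (-1) g)"
        by (rule ae_eq_trans[OF A_adj_comb[OF X xY] ae_eq_comb[OF ae_eq_refl Ax]])
      note L = A_adj_L2[OF Y_comb[OF X xY], of 1 n "-1"]
      show ?thesis
        using L2_cong_ae[OF L L2_comb[OF AL g(1)] L L2_comb[OF AL g(1)] ae ae] by (simp add: Y_ip_eq Y_comb X xY)
    qed
    then have "(\<lambda>n. Y_ip M \<alpha> s (comb 1 (X n) (-1) x) (comb 1 (X n) (-1) x)) \<longlonglongrightarrow> 0"
      using tendsto_add[OF g(2) tendsto_divide[OF x(2) tendsto_const[of "s\<^sup>2"]]] s by simp
    then show "\<exists>x\<in>Y_dpg M. (\<lambda>n. Y_ip M \<alpha> s (comb 1 (X n) (-1) x) (comb 1 (X n) (-1) x)) \<longlonglongrightarrow> 0"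
      using xY by blast
  qed
qed

text \<open>
  The adjoint of the elementwise operator on the broken test space is \<open>A_op\<close> with the zero interface
  values as boundary conditions.  Testing with smooth functions gives the weak derivatives on the whole
  domain; testing with functions supported on one element then gives the interface values.
\<close>

theorem broken_adjoint:
  assumes p: "p \<in> L2 W" and g: "g \<in> L2 W"
    and eq: "\<And>y. y \<in> Y_dpg M \<Longrightarrow> L2_ip W p (A_adj W \<alpha> y) = L2_ip W g y"
  shows "p \<in> Z_set \<Omega> M (hat_zero M)" and "ae_eq \<Omega> (A_op \<Omega> \<alpha> p) g"
proof -
  define r where "r = fst \<circ> p"
  define v where "v = snd \<circ> p"
  define G where "G = comb 1 (fst \<circ> g) (-1) (\<lambda>x. \<alpha> x *\<^sub>R r x)"
  have rv: "r \<in> L2 W" "v \<in> L2 W" and gp: "fst \<circ> g \<in> L2 W" "snd \<circ> g \<in> L2 W"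
    unfolding r_def v_def using L2_fst L2_snd p g by blast+
  have GL: "G \<in> L2 W" unfolding G_def by (intro L2_comb alpha_L2 rv gp)
  have Om: "r \<in> L2 \<Omega>" "v \<in> L2 \<Omega>" "G \<in> L2 \<Omega>" "snd \<circ> g \<in> L2 \<Omega>" using rv GL gp by (simp_all add: L2_Om)
  have test1: "L2_ip W v d = - L2_ip W G \<tau>" if t: "\<tau> \<in> L2 W" "has_weak_div W \<tau> d" for \<tau> d
  proof -
    have tH: "\<tau> \<in> Hdiv W" by (rule W.HdivI[OF t])
    have dL: "d \<in> L2 W" using t(2) by (simp add: has_weak_div_def)
    let ?y = "\<lambda>x. (\<tau> x, 0::real)"
    have y: "?y \<in> Y_dpg M" by (rule YI[OF tH W.zero_H1])
    let ?B = "\<lambda>x. (\<alpha> x *\<^sub>R \<tau> x, - d x)"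
    have BL: "?B \<in> L2 W" by (intro L2_pair alpha_L2 L2_minus t dL)
    have ae: "ae_eq W (A_adj W \<alpha> ?y) ?B"
      using W.weak_div_ae[OF t] W.weak_grad_ae[OF L2_zero W.has_weak_grad_zero]
      unfolding ae_eq_def by eventually_elim (simp add: A_adj_def comp_def)
    have "L2_ip W g ?y = L2_ip W p ?B"
      using eq[OF y] L2_cong_ae[OF p p A_adj_L2[OF y] BL ae_eq_refl ae] by simp
    then have "L2_ip W (fst \<circ> g) \<tau> = L2_ip W r (\<lambda>x. \<alpha> x *\<^sub>R \<tau> x) - L2_ip W v d"
      unfolding L2_ip_pair[OF p BL] L2_ip_pair[OF g YD(3)[OF y]]
      by (simp add: r_def v_def comp_def L2_ip_minus) (simp add: L2_ip_def)
    then show ?thesis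
      using L2_ip_comb_left[OF gp(1) alpha_L2[OF rv(1)] t(1), of 1 "-1"] by (simp add: G_def alpha_ip)
  qed
  have test2: "L2_ip W r d = - L2_ip W (snd \<circ> g) \<nu>" if t: "\<nu> \<in> L2 W" "has_weak_grad W \<nu> d" for \<nu> d
  proof -
    have tH: "\<nu> \<in> H1 W" by (rule W.H1I[OF t])
    have dL: "d \<in> L2 W" using t(2) by (simp add: has_weak_grad_def)
    let ?y = "\<lambda>x. (0 :: real ^ 'd, \<nu> x)"
    have y: "?y \<in> Y_dpg M" by (rule YI[OF W.zero_Hdiv tH])
    let ?B = "\<lambda>x. (- d x, 0 :: real)"
    have BL: "?B \<in> L2 W" by (intro L2_pair L2_minus dL L2_zero)
    have ae: "ae_eq W (A_adj W \<alpha> ?y) ?B"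
      using W.weak_grad_ae[OF t] W.weak_div_ae[OF L2_zero W.has_weak_div_zero]
      unfolding ae_eq_def by eventually_elim (simp add: A_adj_def comp_def)
    have "L2_ip W g ?y = L2_ip W p ?B"
      using eq[OF y] L2_cong_ae[OF p p A_adj_L2[OF y] BL ae_eq_refl ae] by simp
    then show ?thesis
      unfolding L2_ip_pair[OF p BL] L2_ip_pair[OF g YD(3)[OF y]]
      by (simp add: r_def v_def comp_def L2_ip_minus) (simp add: L2_ip_def)
  qed
  have grad: "has_weak_grad \<Omega> v G"
    unfolding Om.has_weak_grad_iff[OF Om(2)]
  proof (intro conjI ballI allI Om(3))
    fix \<phi> i assume \<phi>: "\<phi> \<in> test_functions \<Omega>"
    note L = Om.test_axis_L2[OF \<phi>]
    have "L2_ip W v (\<lambda>x. grad \<phi> x $ i) = - L2_ip W G (\<lambda>x. \<phi> x *\<^sub>R axis i 1)"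
      using L(1) by (intro test1 W.smooth_axis_has_weak_div test_functionsD(1)[OF \<phi>]) (simp add: L2_Om)
    then show "L2_ip \<Omega> v (\<lambda>x. grad \<phi> x $ i) = - L2_ip \<Omega> G (\<lambda>x. \<phi> x *\<^sub>R axis i 1)"
      by (simp add: L2_ip_Om Om L)
  qed
  have div: "has_weak_div \<Omega> r (snd \<circ> g)"
    unfolding Om.has_weak_div_iff
  proof (intro conjI ballI Om(4))
    fix \<phi> assume \<phi>: "\<phi> \<in> test_functions \<Omega>"
    note L = Om.test_L2[OF \<phi>]
    have "L2_ip W r (grad \<phi>) = - L2_ip W (snd \<circ> g) \<phi>"
      using L(1) by (intro test2 W.smooth_has_weak_grad test_functionsD(1)[OF \<phi>]) (simp add: L2_Om)
    then show "L2_ip \<Omega> r (grad \<phi>) = - L2_ip \<Omega> (snd \<circ> g) \<phi>"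
      by (simp only: L2_ip_Om Om L)
  qed
  have rH: "r \<in> Hdiv \<Omega>" and vH: "v \<in> H1 \<Omega>" using Om.HdivI[OF Om(1) div] Om.H1I[OF Om(2) grad] .
  have rW: "r \<in> Hdiv W" and vW: "v \<in> H1 W" using Hdiv_Om(2)[OF rH] H1_Om(2)[OF vH] .
  have gradW: "has_weak_grad W v G" by (rule has_weak_grad_restrict[OF W.bounded_open_axioms Omega W_sub Om(2) grad])
  have divW: "has_weak_div W r (snd \<circ> g)" by (rule has_weak_div_restrict[OF W.bounded_open_axioms Omega W_sub div])
  have 1: "green W \<tau> v = 0" if "\<tau> \<in> Hdiv W" for \<tau>
    using W.green_eq[OF W.HdivD(1,2)[OF that] rv(2) gradW] test1[OF W.HdivD(1,2)[OF that]]
    by (simp add: L2_ip_sym[of W \<tau>] L2_ip_sym[of W _ v])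
  have 2: "green W r \<nu> = 0" if "\<nu> \<in> H1 W" for \<nu>
    using W.green_eq[OF rv(1) divW W.H1D(1,2)[OF that]] test2[OF W.H1D(1,2)[OF that]] by simp
  have "green \<Omega> \<tau> v = 0" if "\<tau> \<in> Hdiv \<Omega>" for \<tau>
    using green_Om[OF that vH] 1[OF Hdiv_Om(2)[OF that]] by simp
  then have "v \<in> zero_boundary_values \<Omega>" by (simp add: Om.zero_boundary_values_iff_green[OF vH])
  then have D: "p \<in> Hdiv_H10 \<Omega>" using rH by (simp add: Hdiv_H10_def Om.H10_eq r_def v_def)
  have "bd p y = 0" if "y \<in> Y_dpg M" for y
    using 1[OF YD(1)[OF that]] 2[OF YD(2)[OF that]] by (simp add: bd_def r_def v_def)
  then show "p \<in> Z_set \<Omega> M (hat_zero M)" using D by (simp add: kernel_iff)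
  show "ae_eq \<Omega> (A_op \<Omega> \<alpha> p) g"
    using Om.weak_grad_ae[OF Om(2) grad] Om.weak_div_ae[OF Om(1) div]
    unfolding ae_eq_def r_def v_def
    by eventually_elim (simp add: A_op_def G_def comb_def r_def prod_eq_iff)
qed

end

lemma Young_L2:
  assumes f: "f \<in> L2 U" and g: "g \<in> L2 U" and t: "0 < t" and b: "b = 1 \<or> b = -1"
  shows "L2_ip U (comb 1 f b g) (comb 1 f b g) \<le> (1 + t) * L2_ip U f f + (1 + 1 / t) * L2_ip U g g"
proof -
  have b2: "b\<^sup>2 = 1" "(-b)\<^sup>2 = 1" using b by auto
  have "0 \<le> L2_ip U (comb t f (-b) g) (comb t f (-b) g)" by (rule L2_ip_nonneg)
  also have "\<dots> = t * (t * L2_ip U f f - 2 * b * L2_ip U f g + L2_ip U g g / t)"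
    using t b2 unfolding L2.comb_square[OF f g] by (simp add: power2_eq_square field_simps)
  finally have "2 * b * L2_ip U f g \<le> t * L2_ip U f f + L2_ip U g g / t"
    using t by (simp add: zero_le_mult_iff)
  then show ?thesis
    unfolding L2.comb_square[OF f g] b2 by (simp add: distrib_right)
qed

context dpg
begin

text \<open>
  The residual is continuous by the Cauchy--Schwarz inequality, so its representer exists and the loss is
  its squared dual norm.
\<close>

lemma residual_representation:
  assumes s: "0 < s" and p: "p \<in> L2 W" and g: "g \<in> L2 W"
    and res: "\<And>y. y \<in> Y_dpg M \<Longrightarrow> L2_ip \<Omega> (\<lambda>x. (0, f x)) y - b_dpg M \<alpha> w y
      = L2_ip W p (A_adj W \<alpha> y) + L2_ip W g y"
  shows "\<exists>\<epsilon>\<in>Y_dpg M. (\<forall>y\<in>Y_dpg M. Y_ip M \<alpha> s \<epsilon> y = L2_ip W p (A_adj W \<alpha> y) + L2_ip W g y) \<and>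
    loss \<Omega> M \<alpha> f s w = Y_ip M \<alpha> s \<epsilon> \<epsilon>"
proof -
  interpret Y: semi_hilbert "Y_dpg M" "Y_ip M \<alpha> s" by (rule Y_semi_hilbert[OF s])
  have "\<exists>\<epsilon>\<in>Y_dpg M. \<forall>y\<in>Y_dpg M. Y_ip M \<alpha> s \<epsilon> y = L2_ip W p (A_adj W \<alpha> y) + L2_ip W g y"
  proof (rule Y.Riesz_representation[where C="sqrt (L2_ip W p p) + s * sqrt (L2_ip W g g)"])
    fix y assume y: "y \<in> Y_dpg M"
    note A = A_adj_L2[OF y] and yL = YD(3)[OF y]
    have 1: "sqrt (L2_ip W (A_adj W \<alpha> y) (A_adj W \<alpha> y)) \<le> sqrt (Y_ip M \<alpha> s y y)"
      by (intro real_sqrt_le_mono) (simp add: Y_ip_eq y L2_ip_nonneg)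
    have "sqrt (L2_ip W y y) = s * sqrt (L2_ip W y y / s\<^sup>2)" using s by (simp add: real_sqrt_divide)
    also have "\<dots> \<le> s * sqrt (Y_ip M \<alpha> s y y)"
      using s by (intro mult_left_mono real_sqrt_le_mono) (simp_all add: Y_ip_eq y L2_ip_nonneg)
    finally have 2: "sqrt (L2_ip W y y) \<le> s * sqrt (Y_ip M \<alpha> s y y)" .
    have "\<bar>L2_ip W p (A_adj W \<alpha> y) + L2_ip W g y\<bar> \<le> \<bar>L2_ip W p (A_adj W \<alpha> y)\<bar> + \<bar>L2_ip W g y\<bar>" by simp
    also have "\<dots> \<le> sqrt (L2_ip W p p) * sqrt (L2_ip W (A_adj W \<alpha> y) (A_adj W \<alpha> y)) + sqrt (L2_ip W g g) * sqrt (L2_ip W y y)"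
      by (intro add_mono L2.Cauchy_Schwarz_sqrt p g A yL)
    also have "\<dots> \<le> sqrt (L2_ip W p p) * sqrt (Y_ip M \<alpha> s y y) + sqrt (L2_ip W g g) * (s * sqrt (Y_ip M \<alpha> s y y))"
      by (intro add_mono mult_left_mono 1 2) (simp_all add: L2_ip_nonneg)
    finally show "\<bar>L2_ip W p (A_adj W \<alpha> y) + L2_ip W g y\<bar>
        \<le> (sqrt (L2_ip W p p) + s * sqrt (L2_ip W g g)) * sqrt (Y_ip M \<alpha> s y y)"
      by (simp add: algebra_simps)
  next
    fix a u b v assume "u \<in> Y_dpg M" "v \<in> Y_dpg M"
    then show "L2_ip W p (A_adj W \<alpha> (comb a u b v)) + L2_ip W g (comb a u b v)
        = a * (L2_ip W p (A_adj W \<alpha> u) + L2_ip W g u) + b * (L2_ip W p (A_adj W \<alpha> v) + L2_ip W g v)"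
      using p g by (simp add: A_adj_comb_ip L2_ip_comb_right YD(3) algebra_simps)
  qed
  then have ex: "\<exists>\<epsilon>. \<epsilon> \<in> Y_dpg M \<and> (\<forall>y\<in>Y_dpg M. Y_ip M \<alpha> s \<epsilon> y = L2_ip \<Omega> (\<lambda>x. (0, f x)) y - b_dpg M \<alpha> w y)"
    by (simp add: res Bex_def)
  define \<epsilon> where "\<epsilon> = error_rep \<Omega> M \<alpha> f s w"
  have e: "\<epsilon> \<in> Y_dpg M" "\<And>y. y \<in> Y_dpg M \<Longrightarrow> Y_ip M \<alpha> s \<epsilon> y = L2_ip W p (A_adj W \<alpha> y) + L2_ip W g y"
    using someI_ex[OF ex, folded error_rep_def] res unfolding \<epsilon>_def by simp_all
  have "loss \<Omega> M \<alpha> f s w = Y_ip M \<alpha> s \<epsilon> \<epsilon>"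
    unfolding loss_def Y_norm_def \<epsilon>_def[symmetric] using Y.nonneg[OF e(1)] by simp
  then show ?thesis using e by blast
qed

text \<open>
  Young's inequality for the residual tested with its own representer \<open>\<epsilon>\<close>; the squares of \<open>A_adj \<epsilon>\<close> and
  \<open>\<epsilon> / s\<close> add up to the loss.
\<close>

lemma loss_le_residual:
  assumes s: "0 < s" and p: "p \<in> L2 W" and g: "g \<in> L2 W"
    and res: "\<And>y. y \<in> Y_dpg M \<Longrightarrow> L2_ip \<Omega> (\<lambda>x. (0, f x)) y - b_dpg M \<alpha> w y
      = L2_ip W p (A_adj W \<alpha> y) + L2_ip W g y"
  shows "loss \<Omega> M \<alpha> f s w \<le> L2_ip W p p + s\<^sup>2 * L2_ip W g g"
proof -
  obtain \<epsilon> where e: "\<epsilon> \<in> Y_dpg M" "\<And>y. y \<in> Y_dpg M \<Longrightarrow> Y_ip M \<alpha> s \<epsilon> y = L2_ip W p (A_adj W \<alpha> y) + L2_ip W g y"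
    "loss \<Omega> M \<alpha> f s w = Y_ip M \<alpha> s \<epsilon> \<epsilon>"
    using residual_representation[OF s p g res] by blast
  define a where "a = A_adj W \<alpha> \<epsilon>"
  have aL: "a \<in> L2 W" and eL: "\<epsilon> \<in> L2 W" unfolding a_def using A_adj_L2[OF e(1)] YD(3)[OF e(1)] .
  have "0 \<le> L2_dist2 W p a" by (rule L2_ip_nonneg)
  then have 1: "2 * L2_ip W p a \<le> L2_ip W p p + L2_ip W a a" by (simp add: L2.comb_square[OF p aL])
  have "0 \<le> L2_ip W (comb s g (- 1 / s) \<epsilon>) (comb s g (- 1 / s) \<epsilon>)" by (rule L2_ip_nonneg)
  then have 2: "2 * L2_ip W g \<epsilon> \<le> s\<^sup>2 * L2_ip W g g + L2_ip W \<epsilon> \<epsilon> / s\<^sup>2"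
    using s by (simp add: L2.comb_square[OF g eL] power_divide)
  have "loss \<Omega> M \<alpha> f s w = L2_ip W p a + L2_ip W g \<epsilon>" "loss \<Omega> M \<alpha> f s w = L2_ip W a a + L2_ip W \<epsilon> \<epsilon> / s\<^sup>2"
    using e(2)[OF e(1)] Y_ip_eq[OF e(1,1), of s] by (simp_all add: e(3) a_def)
  then show ?thesis using 1 2 by linarith
qed

text \<open>
  The squared test norm multiplied by \<open>s\<^sup>2\<close> is increasing in \<open>s\<close>, so the squared dual norm divided by
  \<open>s\<^sup>2\<close> is decreasing.
\<close>

lemma loss_monotone:
  assumes s: "0 < s1" "s1 < s2" and p: "p \<in> L2 W" and g: "g \<in> L2 W"
    and res: "\<And>y. y \<in> Y_dpg M \<Longrightarrow> L2_ip \<Omega> (\<lambda>x. (0, f x)) y - b_dpg M \<alpha> w y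
      = L2_ip W p (A_adj W \<alpha> y) + L2_ip W g y"
  shows "s1\<^sup>2 * loss \<Omega> M \<alpha> f s2 w \<le> s2\<^sup>2 * loss \<Omega> M \<alpha> f s1 w"
proof -
  have s2: "0 < s2" using s by simp
  interpret Y: semi_inner "Y_dpg M" "Y_ip M \<alpha> s1" by (rule Y_semi_inner)
  obtain u where u: "u \<in> Y_dpg M" "\<And>y. y \<in> Y_dpg M \<Longrightarrow> Y_ip M \<alpha> s1 u y = L2_ip W p (A_adj W \<alpha> y) + L2_ip W g y"
    "loss \<Omega> M \<alpha> f s1 w = Y_ip M \<alpha> s1 u u"
    using residual_representation[OF s(1) p g res] by blast
  obtain v where v: "v \<in> Y_dpg M" "\<And>y. y \<in> Y_dpg M \<Longrightarrow> Y_ip M \<alpha> s2 v y = L2_ip W p (A_adj W \<alpha> y) + L2_ip W g y"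
    "loss \<Omega> M \<alpha> f s2 w = Y_ip M \<alpha> s2 v v"
    using residual_representation[OF s2 p g res] by blast
  \<comment> \<open>the ratio of the two squared weights bounds the ratio of the squared norms\<close>
  define q where "q = s2\<^sup>2 / s1\<^sup>2"
  have q: "1 \<le> q" using s by (simp add: q_def power_mono)
  have uv: "Y_ip M \<alpha> s1 u v = loss \<Omega> M \<alpha> f s2 w" using u(2)[OF v(1)] v(2)[OF v(1)] v(3) by simp
  have vv: "Y_ip M \<alpha> s1 v v \<le> q * loss \<Omega> M \<alpha> f s2 w"
  proof -
    have "L2_ip W (A_adj W \<alpha> v) (A_adj W \<alpha> v) \<le> q * L2_ip W (A_adj W \<alpha> v) (A_adj W \<alpha> v)"
      using mult_right_mono[OF q L2_ip_nonneg[of W "A_adj W \<alpha> v"]] by simp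
    moreover have "L2_ip W v v / s1\<^sup>2 = q * (L2_ip W v v / s2\<^sup>2)" using s s2 by (simp add: q_def)
    ultimately show ?thesis unfolding v(3) Y_ip_eq[OF v(1,1)] by (simp add: distrib_left)
  qed
  have "0 \<le> Y_ip M \<alpha> s1 (comb q u (-1) v) (comb q u (-1) v)" by (rule Y.nonneg[OF Y_comb[OF u(1) v(1)]])
  also have "\<dots> = q\<^sup>2 * loss \<Omega> M \<alpha> f s1 w - 2 * q * loss \<Omega> M \<alpha> f s2 w + Y_ip M \<alpha> s1 v v"
    by (simp add: Y.comb_square[OF u(1) v(1)] uv u(3))
  also have "\<dots> \<le> q * (q * loss \<Omega> M \<alpha> f s1 w - loss \<Omega> M \<alpha> f s2 w)"
    using vv by (simp add: algebra_simps power2_eq_square)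
  finally have "loss \<Omega> M \<alpha> f s2 w \<le> q * loss \<Omega> M \<alpha> f s1 w" using q by (simp add: zero_le_mult_iff)
  then show ?thesis using s by (simp add: q_def field_simps)
qed

lemma residual_data:
  assumes f: "f \<in> L2 \<Omega>" and w: "w \<in> X_dpg \<Omega> M"
  shows "\<exists>p\<in>L2 W. \<exists>g\<in>L2 W. \<forall>y\<in>Y_dpg M. L2_ip \<Omega> (\<lambda>x. (0, f x)) y - b_dpg M \<alpha> w y
    = L2_ip W p (A_adj W \<alpha> y) + L2_ip W g y"
proof -
  obtain w0 what where ww: "w = (w0, what)" "w0 \<in> L2 \<Omega>" "what \<in> Xhat \<Omega> M" using w by (auto simp: X_dpg_def)
  obtain z where z: "z \<in> Hdiv_H10 \<Omega>" "what = hat z" using Xhat_obtain[OF ww(3)] .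
  have F: "(\<lambda>x. (0 :: real ^ 'd, f x)) \<in> L2 \<Omega>" "(\<lambda>x. (0 :: real ^ 'd, f x)) \<in> L2 W"
    using L2_pair[OF L2_zero f] by (simp_all add: L2_Om)
  have w0: "w0 \<in> L2 W" using ww(2) by (simp add: L2_Om)
  have "L2_ip \<Omega> (\<lambda>x. (0, f x)) y - b_dpg M \<alpha> w y
      = L2_ip W (comb 1 z (-1) w0) (A_adj W \<alpha> y) + L2_ip W (comb 1 (\<lambda>x. (0, f x)) (-1) (A_op \<Omega> \<alpha> z)) y"
    if y: "y \<in> Y_dpg M" for y
    using F w0 DomD(7)[OF z(1)] A_op_L2(2)[OF z(1)] YD(3)[OF y] A_adj_L2[OF y]
    by (simp add: ww(1) z(2) b_dpg_eq[OF ww(2) z(1) y] bd_eq[OF z(1) y] L2_ip_comb_left ip_Om)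
  moreover have "comb 1 z (-1) w0 \<in> L2 W" "comb 1 (\<lambda>x. (0, f x)) (-1) (A_op \<Omega> \<alpha> z) \<in> L2 W"
    by (intro L2_comb F w0 DomD(7)[OF z(1)] A_op_L2(2)[OF z(1)])+
  ultimately show ?thesis by blast
qed

lemma loss_monotone_X:
  assumes "f \<in> L2 \<Omega>" "w \<in> X_dpg \<Omega> M" "0 < s1" "s1 < s2"
  shows "s1\<^sup>2 * loss \<Omega> M \<alpha> f s2 w \<le> s2\<^sup>2 * loss \<Omega> M \<alpha> f s1 w"
proof -
  obtain p g where "p \<in> L2 W" "g \<in> L2 W" "\<And>y. y \<in> Y_dpg M \<Longrightarrow> L2_ip \<Omega> (\<lambda>x. (0, f x)) y - b_dpg M \<alpha> w y
    = L2_ip W p (A_adj W \<alpha> y) + L2_ip W g y" using residual_data[OF assms(1,2)] by blast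
  then show ?thesis by (rule loss_monotone[OF assms(3,4)])
qed

abbreviation Ker :: "'d field set" where "Ker \<equiv> Z_set \<Omega> M (hat_zero M)"

lemma KerD: "k \<in> Ker \<Longrightarrow> k \<in> Hdiv_H10 \<Omega>"
  by (simp add: kernel_iff)

lemma Ker_comb: "k \<in> Ker \<Longrightarrow> l \<in> Ker \<Longrightarrow> comb a k b l \<in> Ker"
  by (simp add: kernel_iff Dom_comb bd_comb)

lemma zero_Ker: "(\<lambda>x. 0) \<in> Ker"
  by (simp add: hat_zero_eq Z_set_iff zero_Dom)

lemma A_op_comb_ip:
  assumes "z \<in> Hdiv_H10 \<Omega>" "z' \<in> Hdiv_H10 \<Omega>" "f \<in> L2 \<Omega>"
  shows "L2_ip \<Omega> (A_op \<Omega> \<alpha> (comb a z b z')) f = a * L2_ip \<Omega> (A_op \<Omega> \<alpha> z) f + b * L2_ip \<Omega> (A_op \<Omega> \<alpha> z') f"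
proof -
  have "L2_ip \<Omega> (A_op \<Omega> \<alpha> (comb a z b z')) f = L2_ip \<Omega> (comb a (A_op \<Omega> \<alpha> z) b (A_op \<Omega> \<alpha> z')) f"
    by (rule L2_cong_ae[OF A_op_L2(1)[OF Dom_comb[OF assms(1,2)]]
          L2_comb[OF A_op_L2(1)[OF assms(1)] A_op_L2(1)[OF assms(2)]] assms(3,3) A_op_comb[OF assms(1,2)] ae_eq_refl])
  then show ?thesis by (simp add: L2_ip_comb_left A_op_L2 assms)
qed

lemma A_op_semi_inner: "semi_inner (Hdiv_H10 \<Omega>) (\<lambda>z z'. L2_ip \<Omega> (A_op \<Omega> \<alpha> z) (A_op \<Omega> \<alpha> z'))"
  by unfold_locales (auto simp: Dom_comb A_op_comb_ip A_op_L2 L2_ip_nonneg intro: L2_ip_sym)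

lemma stability_ip:
  assumes "stability_constant \<Omega> \<alpha> c" "z \<in> Hdiv_H10 \<Omega>"
  shows "L2_ip \<Omega> z z \<le> c\<^sup>2 * L2_ip \<Omega> (A_op \<Omega> \<alpha> z) (A_op \<Omega> \<alpha> z)"
proof -
  have "L2_norm \<Omega> z \<le> c * L2_norm \<Omega> (A_op \<Omega> \<alpha> z)" using assms by (simp add: stability_constant_def)
  from power_mono[OF this, of 2] show ?thesis by (simp add: power_mult_distrib L2_norm_power2 L2_norm_def[of _ z] L2_ip_nonneg)
qed

text \<open>
  The operator has closed range on the kernel of the traces: stability makes the arguments converge too,
  and \<open>broken_adjoint\<close> identifies the limit, since the kernel is the domain of an adjoint.
\<close>

lemma Ker_semi_hilbert:
  assumes stab: "stability_constant \<Omega> \<alpha> c"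
  shows "semi_hilbert Ker (\<lambda>z z'. L2_ip \<Omega> (A_op \<Omega> \<alpha> z) (A_op \<Omega> \<alpha> z'))"
proof -
  interpret D: semi_inner "Hdiv_H10 \<Omega>" "\<lambda>z z'. L2_ip \<Omega> (A_op \<Omega> \<alpha> z) (A_op \<Omega> \<alpha> z')" by (rule A_op_semi_inner)
  have c: "0 < c" using stab by (simp add: stability_constant_def)
  note st = stability_ip[OF stab]
  show ?thesis
  proof unfold_locales
    show "Ker \<noteq> {}" using zero_Ker by blast
    fix X :: "nat \<Rightarrow> 'd field"
    let ?A = "\<lambda>n. A_op \<Omega> \<alpha> (X n)"
    assume X: "\<And>n. X n \<in> Ker" and Cauchy: "\<And>e. 0 < e \<Longrightarrow> \<exists>N. \<forall>m\<ge>N. \<forall>n\<ge>N.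
      L2_ip \<Omega> (A_op \<Omega> \<alpha> (comb 1 (X m) (-1) (X n))) (A_op \<Omega> \<alpha> (comb 1 (X m) (-1) (X n))) < e"
    have XD: "X n \<in> Hdiv_H10 \<Omega>" for n using KerD[OF X] .
    have XL: "X n \<in> L2 \<Omega>" and AL: "?A n \<in> L2 \<Omega>" for n using DomD(6)[OF XD] A_op_L2(1)[OF XD] .
    have lm: "\<Omega> \<in> lmeasurable" by (intro lmeasurable_open Om.open_U Om.bounded_U)
    have eq: "L2_ip \<Omega> (A_op \<Omega> \<alpha> (comb 1 (X m) (-1) z)) (A_op \<Omega> \<alpha> (comb 1 (X m) (-1) z))
        = L2_dist2 \<Omega> (?A m) g"
      if "z \<in> Hdiv_H10 \<Omega>" "g \<in> L2 \<Omega>" "ae_eq \<Omega> (A_op \<Omega> \<alpha> z) g" for m z g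
    proof -
      have ae: "ae_eq \<Omega> (A_op \<Omega> \<alpha> (comb 1 (X m) (-1) z)) (comb 1 (?A m) (-1) g)"
        by (rule ae_eq_trans[OF A_op_comb[OF XD that(1)] ae_eq_comb[OF ae_eq_refl that(3)]])
      note L = A_op_L2(1)[OF Dom_comb[OF XD[of m] that(1)], of 1 "-1"]
      show ?thesis by (rule L2_cong_ae[OF L L2_comb[OF AL that(2)] L L2_comb[OF AL that(2)] ae ae])
    qed
    have "\<exists>N. \<forall>m\<ge>N. \<forall>n\<ge>N. L2_dist2 \<Omega> (?A m) (?A n) < e" if "0 < e" for e
      using Cauchy[OF that] unfolding eq[OF XD AL ae_eq_refl] .
    from L2_complete[OF lm AL this] obtain g where g: "g \<in> L2 \<Omega>"
      "(\<lambda>n. L2_dist2 \<Omega> (?A n) g) \<longlonglongrightarrow> 0" by blast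
    have "\<exists>N. \<forall>m\<ge>N. \<forall>n\<ge>N. L2_dist2 \<Omega> (X m) (X n) < e" if e: "0 < e" for e
    proof -
      have "0 < e / c\<^sup>2" using e c by simp
      from Cauchy[OF this] obtain N where N: "\<And>m n. m \<ge> N \<Longrightarrow> n \<ge> N \<Longrightarrow>
        L2_ip \<Omega> (A_op \<Omega> \<alpha> (comb 1 (X m) (-1) (X n))) (A_op \<Omega> \<alpha> (comb 1 (X m) (-1) (X n))) < e / c\<^sup>2" by blast
      have "L2_dist2 \<Omega> (X m) (X n) < e" if "m \<ge> N" "n \<ge> N" for m n
      proof -
        have "c\<^sup>2 * L2_ip \<Omega> (A_op \<Omega> \<alpha> (comb 1 (X m) (-1) (X n))) (A_op \<Omega> \<alpha> (comb 1 (X m) (-1) (X n))) < e"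
          using N[OF that] c by (simp add: field_simps)
        then show ?thesis using st[OF Dom_comb[OF XD XD], of 1 m "-1" n] by simp
      qed
      then show ?thesis by blast
    qed
    from L2_complete[OF lm XL this] obtain x where x: "x \<in> L2 \<Omega>"
      "(\<lambda>n. L2_dist2 \<Omega> (X n) x) \<longlonglongrightarrow> 0" by blast
    have xW: "x \<in> L2 W" and gW: "g \<in> L2 W" using x(1) g(1) by (simp_all add: L2_Om)
    have XW: "X n \<in> L2 W" and AW: "?A n \<in> L2 W" for n using XL AL by (simp_all add: L2_Om)
    have "L2_ip W x (A_adj W \<alpha> y) = L2_ip W g y" if y: "y \<in> Y_dpg M" for y
    proof -
      have "(\<lambda>n. L2_ip W (X n) (A_adj W \<alpha> y)) \<longlonglongrightarrow> L2_ip W x (A_adj W \<alpha> y)"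
        by (rule L2_ip_tendsto[OF XW xW A_adj_L2[OF y]]) (use x(2) in \<open>simp add: ip_Om L2_comb XW xW\<close>)
      moreover have "(\<lambda>n. L2_ip W (?A n) y) \<longlonglongrightarrow> L2_ip W g y"
        by (rule L2_ip_tendsto[OF AW gW YD(3)[OF y]]) (use g(2) in \<open>simp add: ip_Om L2_comb AW gW\<close>)
      moreover have "L2_ip W (X n) (A_adj W \<alpha> y) = L2_ip W (?A n) y" for n
        using X[of n] bd_eq[OF XD y, of n] y by (simp add: kernel_iff)
      ultimately show ?thesis using LIMSEQ_unique by simp
    qed
    from broken_adjoint[OF xW gW this] have xk: "x \<in> Ker" "ae_eq \<Omega> (A_op \<Omega> \<alpha> x) g" by blast+
    have "(\<lambda>n. L2_ip \<Omega> (A_op \<Omega> \<alpha> (comb 1 (X n) (-1) x)) (A_op \<Omega> \<alpha> (comb 1 (X n) (-1) x))) \<longlonglongrightarrow> 0"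
      using g(2) unfolding eq[OF KerD[OF xk(1)] g(1) xk(2)] .
    then show "\<exists>x\<in>Ker. (\<lambda>n. L2_ip \<Omega> (A_op \<Omega> \<alpha> (comb 1 (X n) (-1) x)) (A_op \<Omega> \<alpha> (comb 1 (X n) (-1) x))) \<longlonglongrightarrow> 0"
      using xk(1) by blast
  qed (auto simp: Ker_comb KerD D.comb_left D.nonneg intro: D.sym)
qed

text \<open>
  The minimal extension exists by the Riesz representation on the kernel of the traces, and its image is
  orthogonal to the image of the kernel.
\<close>

lemma minimal_extension:
  assumes stab: "stability_constant \<Omega> \<alpha> c" and e: "e \<in> Hdiv_H10 \<Omega>"
  defines "E \<equiv> E_ext \<Omega> M \<alpha> (hat e)"
  shows "E \<in> Z_set \<Omega> M (hat e)"
    and "\<And>k. k \<in> Ker \<Longrightarrow> L2_ip \<Omega> (A_op \<Omega> \<alpha> E) (A_op \<Omega> \<alpha> k) = 0"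
proof -
  interpret D: semi_inner "Hdiv_H10 \<Omega>" "\<lambda>z z'. L2_ip \<Omega> (A_op \<Omega> \<alpha> z) (A_op \<Omega> \<alpha> z')" by (rule A_op_semi_inner)
  interpret Kr: semi_hilbert Ker "\<lambda>z z'. L2_ip \<Omega> (A_op \<Omega> \<alpha> z) (A_op \<Omega> \<alpha> z')" by (rule Ker_semi_hilbert[OF stab])
  let ?B = "\<lambda>z z'. L2_ip \<Omega> (A_op \<Omega> \<alpha> z) (A_op \<Omega> \<alpha> z')"
  have "\<exists>p\<in>Ker. \<forall>k\<in>Ker. ?B p k = ?B e k"
    by (rule Kr.Riesz_representation[where C="sqrt (?B e e)"])
      (auto simp: D.comb_right KerD e intro: D.Cauchy_Schwarz_sqrt)
  then obtain p where p: "p \<in> Ker" "\<And>k. k \<in> Ker \<Longrightarrow> ?B p k = ?B e k" by blast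
  define E0 where "E0 = comb 1 e (-1) p"
  have E0D: "E0 \<in> Hdiv_H10 \<Omega>" unfolding E0_def by (rule Dom_comb[OF e KerD[OF p(1)]])
  have orth: "?B E0 k = 0" if "k \<in> Ker" for k
    unfolding E0_def using D.comb_left[OF e KerD[OF p(1)] KerD[OF that]] p(2)[OF that] by simp
  have "comb 1 E0 (-1) e = comb (-1) p 0 p" by (simp add: E0_def comb_def fun_eq_iff)
  then have E0Z: "E0 \<in> Z_set \<Omega> M (hat e)" using E0D Ker_comb[OF p(1) p(1)] by (simp add: Z_set_kernel_iff[OF e])
  have diff: "comb 1 z (-1) E0 \<in> Ker" if "z \<in> Z_set \<Omega> M (hat e)" for z
  proof -
    have "hat E0 = hat e" using E0Z by (simp add: Z_set_iff)
    then have "z \<in> Z_set \<Omega> M (hat E0)" using that by simp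
    then show ?thesis using Z_set_kernel_iff[OF E0D] by blast
  qed
  have pyth: "?B z z = ?B E0 E0 + ?B (comb 1 z (-1) E0) (comb 1 z (-1) E0)" if z: "z \<in> Z_set \<Omega> M (hat e)" for z
  proof -
    note k = diff[OF z]
    have zD: "z \<in> Hdiv_H10 \<Omega>" using z by (simp add: Z_set_iff)
    have "z = comb 1 E0 1 (comb 1 z (-1) E0)" by (simp add: comb_def fun_eq_iff)
    then have "?B z z = ?B (comb 1 E0 1 (comb 1 z (-1) E0)) (comb 1 E0 1 (comb 1 z (-1) E0))" by simp
    also have "\<dots> = ?B E0 E0 + ?B (comb 1 z (-1) E0) (comb 1 z (-1) E0)"
      using D.comb_square[OF E0D KerD[OF k], of 1 1] orth[OF k] by simp
    finally show ?thesis .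
  qed
  have min: "is_arg_min (\<lambda>z. L2_norm \<Omega> (A_op \<Omega> \<alpha> z)) (\<lambda>z. z \<in> Z_set \<Omega> M (hat e)) E0"
  proof -
    have "L2_norm \<Omega> (A_op \<Omega> \<alpha> E0) \<le> L2_norm \<Omega> (A_op \<Omega> \<alpha> z)" if "z \<in> Z_set \<Omega> M (hat e)" for z
      unfolding L2_norm_def by (intro real_sqrt_le_mono) (simp add: pyth[OF that] L2_ip_nonneg)
    then show ?thesis using E0Z by (auto simp: is_arg_min_def not_less)
  qed
  have Emin: "is_arg_min (\<lambda>z. L2_norm \<Omega> (A_op \<Omega> \<alpha> z)) (\<lambda>z. z \<in> Z_set \<Omega> M (hat e)) E"
    unfolding E_def E_ext_def arg_min_def
    by (rule someI[of "is_arg_min (\<lambda>z. L2_norm \<Omega> (A_op \<Omega> \<alpha> z)) (\<lambda>z. z \<in> Z_set \<Omega> M (hat e))", OF min])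
  then show EZ: "E \<in> Z_set \<Omega> M (hat e)" by (simp add: is_arg_min_def)
  have "L2_norm \<Omega> (A_op \<Omega> \<alpha> E) \<le> L2_norm \<Omega> (A_op \<Omega> \<alpha> E0)"
    using Emin E0Z by (auto simp: is_arg_min_def not_less)
  then have "?B E E \<le> ?B E0 E0" by (simp add: L2_norm_def)
  then have z: "?B (comb 1 E (-1) E0) (comb 1 E (-1) E0) = 0"
    using pyth[OF EZ] L2_ip_nonneg[of \<Omega> "A_op \<Omega> \<alpha> (comb 1 E (-1) E0)"] by simp
  fix k assume k: "k \<in> Ker"
  note dD = KerD[OF diff[OF EZ]]
  have "(?B (comb 1 E (-1) E0) k)\<^sup>2 \<le> 0" using D.Cauchy_Schwarz[OF dD KerD[OF k]] z by simp
  then have "?B (comb 1 E (-1) E0) k = 0" by simp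
  moreover have "E \<in> Hdiv_H10 \<Omega>" using EZ by (simp add: Z_set_iff)
  ultimately show "?B E k = 0" using D.comb_left[OF _ E0D KerD[OF k], of E 1 "-1"] orth[OF k] by simp
qed

end

section \<open>The constants in the error bounds\<close>

text \<open>
  With \<open>q = c / s\<close>, \<open>kconst c s\<close> is the positive root of \<open>k\<^sup>2 = q\<^sup>2 * (1 + k)\<close>.  For this Young
  parameter the error of replacing \<open>e0\<close> by \<open>e0 - z\<close> is absorbed by \<open>k * s\<^sup>2 * \<parallel>A_op z\<parallel>\<^sup>2\<close>.
\<close>

lemma kconst_props:
  assumes c: "0 < c" and s: "0 < s"
  shows "0 < kconst c s" and "(1 + 1 / kconst c s) * c\<^sup>2 = kconst c s * s\<^sup>2"
    and "kconst c s \<le> c\<^sup>2 / s\<^sup>2 + c / s"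
proof -
  define q where "q = c / s"
  have q: "0 < q" using c s by (simp add: q_def)
  have q2: "c\<^sup>2 / s\<^sup>2 = q\<^sup>2" "c ^ 4 / s ^ 4 = (q\<^sup>2)\<^sup>2" by (simp_all add: q_def power_divide)
  have k: "kconst c s = 1 / 2 * (q\<^sup>2 + sqrt ((q\<^sup>2)\<^sup>2 + 4 * q\<^sup>2))" unfolding kconst_def q2 by simp
  have "0 \<le> sqrt ((q\<^sup>2)\<^sup>2 + 4 * q\<^sup>2)" by simp
  moreover have "0 < q\<^sup>2" using q by simp
  ultimately have "0 < q\<^sup>2 + sqrt ((q\<^sup>2)\<^sup>2 + 4 * q\<^sup>2)" by linarith
  then show pos: "0 < kconst c s" unfolding k by simp
  have sq: "(sqrt ((q\<^sup>2)\<^sup>2 + 4 * q\<^sup>2))\<^sup>2 = (q\<^sup>2)\<^sup>2 + 4 * q\<^sup>2" by simp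
  have rt: "sqrt ((q\<^sup>2)\<^sup>2 + 4 * q\<^sup>2) = 2 * kconst c s - q\<^sup>2" unfolding k by (simp add: field_simps)
  have "(2 * kconst c s - q\<^sup>2)\<^sup>2 = (q\<^sup>2)\<^sup>2 + 4 * q\<^sup>2" using sq unfolding rt .
  then have quad: "(kconst c s)\<^sup>2 = q\<^sup>2 * (1 + kconst c s)"
    by (simp add: power2_eq_square algebra_simps)
  have c2: "c\<^sup>2 = q\<^sup>2 * s\<^sup>2" using s by (simp add: q_def power_divide)
  have "(1 + 1 / kconst c s) * q\<^sup>2 = kconst c s"
    using quad pos by (simp add: power2_eq_square field_simps)
  then show "(1 + 1 / kconst c s) * c\<^sup>2 = kconst c s * s\<^sup>2" unfolding c2 by (simp add: mult.assoc[symmetric])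
  have "sqrt ((q\<^sup>2)\<^sup>2 + 4 * q\<^sup>2) \<le> q\<^sup>2 + 2 * q"
    using q by (intro real_le_lsqrt) (simp_all add: power2_eq_square algebra_simps)
  then have "kconst c s \<le> q\<^sup>2 + q" unfolding k by (simp add: field_simps)
  then show "kconst c s \<le> c\<^sup>2 / s\<^sup>2 + c / s" by (simp add: q_def power_divide)
qed

lemma kconst_antimono:
  assumes "0 < c" "0 < s1" "s1 < s2"
  shows "kconst c s2 \<le> kconst c s1"
proof -
  have a: "c\<^sup>2 / s2\<^sup>2 \<le> c\<^sup>2 / s1\<^sup>2" "c ^ 4 / s2 ^ 4 \<le> c ^ 4 / s1 ^ 4"
    using assms by (auto intro!: divide_left_mono power_mono mult_pos_pos)
  have "sqrt (c ^ 4 / s2 ^ 4 + 4 * (c\<^sup>2 / s2\<^sup>2)) \<le> sqrt (c ^ 4 / s1 ^ 4 + 4 * (c\<^sup>2 / s1\<^sup>2))"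
    using a by (intro real_sqrt_le_mono add_mono) auto
  then show ?thesis unfolding kconst_def using a by (intro mult_left_mono add_mono) auto
qed

lemma kconst_tendsto_0: "0 < c \<Longrightarrow> ((\<lambda>s. kconst c s) \<longlongrightarrow> 0) at_top"
proof -
  assume c: "0 < c"
  have inv: "((\<lambda>s::real. inverse s) \<longlongrightarrow> 0) at_top" by (rule tendsto_inverse_0_at_top) (rule filterlim_ident)
  have "((\<lambda>s. c\<^sup>2 * (inverse s)\<^sup>2 + c * inverse s) \<longlongrightarrow> c\<^sup>2 * 0\<^sup>2 + c * 0) at_top" by (intro tendsto_intros inv)
  then have up: "((\<lambda>s. c\<^sup>2 * (inverse s)\<^sup>2 + c * inverse s) \<longlongrightarrow> 0) at_top" by simp
  show ?thesis
  proof (rule real_tendsto_sandwich[OF _ _ tendsto_const up])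
    show "\<forall>\<^sub>F s in at_top. 0 \<le> kconst c s"
      using eventually_gt_at_top[of "0::real"] by eventually_elim (simp add: kconst_props(1) c less_imp_le)
    show "\<forall>\<^sub>F s in at_top. kconst c s \<le> c\<^sup>2 * (inverse s)\<^sup>2 + c * inverse s"
      using eventually_gt_at_top[of "0::real"]
      by eventually_elim (use kconst_props(3)[OF c] in \<open>simp add: divide_inverse power_inverse\<close>)
  qed
qed

section \<open>The loss functional as a least squares distance\<close>

context dpg
begin

text \<open>
  The residual pairs with a test function as \<open>(e0 - z, A_adj y) + (A_op z, y)\<close> for every extension \<open>z\<close> of
  the interface error.  The Riesz representer \<open>\<epsilon>\<close> singles out the extension \<open>z\<close> with \<open>e0 - z = A_adj \<epsilon>\<close>
  and \<open>A_op z = \<epsilon> / s\<^sup>2\<close>, by the identification of the broken adjoint.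
\<close>

lemma loss_least_squares:
  assumes s: "0 < s" and exact: "exact_dpg_solution \<Omega> M \<alpha> f (u0, hat zu)"
    and u0: "u0 \<in> L2 \<Omega>" and w0: "w0 \<in> L2 \<Omega>" and zu: "zu \<in> Hdiv_H10 \<Omega>" and zw: "zw \<in> Hdiv_H10 \<Omega>"
    and f: "f \<in> L2 \<Omega>"
  defines "e0 \<equiv> comb 1 u0 (-1) w0" and "Z \<equiv> Z_set \<Omega> M (hat (comb 1 zu (-1) zw))"
  shows "\<And>z. z \<in> Z \<Longrightarrow> loss \<Omega> M \<alpha> f s (w0, hat zw)
      \<le> L2_dist2 \<Omega> e0 z + s\<^sup>2 * L2_ip \<Omega> (A_op \<Omega> \<alpha> z) (A_op \<Omega> \<alpha> z)"
    and "\<exists>z\<in>Z. loss \<Omega> M \<alpha> f s (w0, hat zw)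
      = L2_dist2 \<Omega> e0 z + s\<^sup>2 * L2_ip \<Omega> (A_op \<Omega> \<alpha> z) (A_op \<Omega> \<alpha> z)"
proof -
  define e where "e = comb 1 zu (-1) zw"
  have eD: "e \<in> Hdiv_H10 \<Omega>" unfolding e_def by (rule Dom_comb[OF zu zw])
  have e0: "e0 \<in> L2 \<Omega>" "e0 \<in> L2 W" unfolding e0_def using L2_comb[OF u0 w0] by (simp_all add: L2_Om)
  have u0W: "u0 \<in> L2 W" and w0W: "w0 \<in> L2 W" using u0 w0 by (simp_all add: L2_Om)
  have F: "(\<lambda>x. (0 :: real ^ 'd, f x)) \<in> L2 \<Omega>" using L2_pair[OF L2_zero f] .
  have ZD: "z \<in> Hdiv_H10 \<Omega>" "hat z = hat e" if "z \<in> Z" for z using that by (simp_all add: Z_def e_def Z_set_iff)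
  have res: "L2_ip \<Omega> (\<lambda>x. (0, f x)) y - b_dpg M \<alpha> (w0, hat zw) y
      = L2_ip W (comb 1 e0 (-1) z) (A_adj W \<alpha> y) + L2_ip W (A_op \<Omega> \<alpha> z) y"
    if z: "z \<in> Z" and y: "y \<in> Y_dpg M" for z y
  proof -
    note zD = ZD[OF z] and A = A_adj_L2[OF y]
    have yO: "y \<in> L2 \<Omega>" using YD(3)[OF y] by (simp add: L2_Om)
    have "L2_ip \<Omega> (\<lambda>x. (0, f x)) y = L2_ip \<Omega> f (snd \<circ> y)" by (simp add: L2_ip_def inner_prod_def)
    also have "\<dots> = b_dpg M \<alpha> (u0, hat zu) y" using exact y by (simp add: exact_dpg_solution_def)
    finally have "L2_ip \<Omega> (\<lambda>x. (0, f x)) y - b_dpg M \<alpha> (w0, hat zw) y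
        = L2_ip W e0 (A_adj W \<alpha> y) + bd e y"
      unfolding e0_def e_def
      by (simp add: b_dpg_eq[OF u0 zu y] b_dpg_eq[OF w0 zw y] L2_ip_comb_left[OF u0W w0W A] bd_comb[OF zu zw y])
    moreover have "bd e y = bd z y"
      using hat_eq_iff[OF zD(1) eD] zD(2) y bd_comb[OF zD(1) eD y, of 1 "-1"] by simp
    ultimately show ?thesis
      by (simp add: bd_eq[OF zD(1) y] L2_ip_comb_left[OF e0(2) DomD(7)[OF zD(1)] A])
  qed
  have conv: "L2_dist2 W e0 z + s\<^sup>2 * L2_ip W (A_op \<Omega> \<alpha> z) (A_op \<Omega> \<alpha> z)
      = L2_dist2 \<Omega> e0 z + s\<^sup>2 * L2_ip \<Omega> (A_op \<Omega> \<alpha> z) (A_op \<Omega> \<alpha> z)" if "z \<in> Z" for z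
    using L2_ip_Om[OF L2_comb[OF e0(1) DomD(6)[OF ZD(1)[OF that]]] L2_comb[OF e0(1) DomD(6)[OF ZD(1)[OF that]]], of 1 "-1" 1 "-1"]
      L2_ip_Om[OF A_op_L2(1)[OF ZD(1)[OF that]] A_op_L2(1)[OF ZD(1)[OF that]]] by simp
  show "loss \<Omega> M \<alpha> f s (w0, hat zw)
      \<le> L2_dist2 \<Omega> e0 z + s\<^sup>2 * L2_ip \<Omega> (A_op \<Omega> \<alpha> z) (A_op \<Omega> \<alpha> z)" if z: "z \<in> Z" for z
    using loss_le_residual[OF s L2_comb[OF e0(2) DomD(7)[OF ZD(1)[OF z]]] A_op_L2(2)[OF ZD(1)[OF z]] res[OF z]] conv[OF z] by simp
  have eZ: "e \<in> Z" by (simp add: Z_def e_def[symmetric] Z_set_iff eD)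
  have pL: "comb 1 e0 (-1) e \<in> L2 W" by (rule L2_comb[OF e0(2) DomD(7)[OF eD]])
  obtain \<epsilon> where eps: "\<epsilon> \<in> Y_dpg M" "\<And>y. y \<in> Y_dpg M \<Longrightarrow> Y_ip M \<alpha> s \<epsilon> y
      = L2_ip W (comb 1 e0 (-1) e) (A_adj W \<alpha> y) + L2_ip W (A_op \<Omega> \<alpha> e) y"
    "loss \<Omega> M \<alpha> f s (w0, hat zw) = Y_ip M \<alpha> s \<epsilon> \<epsilon>"
    using residual_representation[OF s pL A_op_L2(2)[OF eD] res[OF eZ]] by blast
  let ?a = "A_adj W \<alpha> \<epsilon>"
  have aL: "?a \<in> L2 W" and epsL: "\<epsilon> \<in> L2 W" using A_adj_L2[OF eps(1)] YD(3)[OF eps(1)] .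
  define p where "p = comb 1 (comb 1 e0 (-1) e) (-1) ?a"
  define g where "g = comb (1 / s\<^sup>2) \<epsilon> (-1) (A_op \<Omega> \<alpha> e)"
  have p: "p \<in> L2 W" and g: "g \<in> L2 W" unfolding p_def g_def by (intro L2_comb pL aL epsL A_op_L2(2)[OF eD])+
  have "L2_ip W p (A_adj W \<alpha> y) = L2_ip W g y" if y: "y \<in> Y_dpg M" for y
    using eps(2)[OF y] Y_ip_eq[OF eps(1) y, of s]
      L2_ip_comb_left[OF pL aL A_adj_L2[OF y], of 1 "-1"] L2_ip_comb_left[OF epsL A_op_L2(2)[OF eD] YD(3)[OF y], of "1/s\<^sup>2" "-1"]
    by (simp add: p_def g_def)
  from broken_adjoint[OF p g this] have pk: "p \<in> Ker" "ae_eq \<Omega> (A_op \<Omega> \<alpha> p) g" by blast+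
  \<comment> \<open>the optimal extension\<close>
  define z where "z = comb 1 e 1 p"
  have zD: "z \<in> Hdiv_H10 \<Omega>" unfolding z_def by (rule Dom_comb[OF eD KerD[OF pk(1)]])
  have "comb 1 z (-1) e = comb 1 p 0 p" by (simp add: z_def comb_def fun_eq_iff)
  then have zZ: "z \<in> Z"
    unfolding Z_def e_def[symmetric] Z_set_kernel_iff[OF eD] using zD Ker_comb[OF pk(1) pk(1), of 1 0] by simp
  have 1: "comb 1 e0 (-1) z = ?a" by (simp add: z_def p_def comb_def fun_eq_iff)
  have 2: "ae_eq W (A_op \<Omega> \<alpha> z) (comb (1 / s\<^sup>2) \<epsilon> 0 \<epsilon>)"
  proof -
    have "ae_eq \<Omega> (A_op \<Omega> \<alpha> z) (comb 1 (A_op \<Omega> \<alpha> e) 1 g)"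
      unfolding z_def by (rule ae_eq_trans[OF A_op_comb[OF eD KerD[OF pk(1)]] ae_eq_comb[OF ae_eq_refl pk(2)]])
    moreover have "comb 1 (A_op \<Omega> \<alpha> e) 1 g = comb (1 / s\<^sup>2) \<epsilon> 0 \<epsilon>" by (simp add: g_def comb_def fun_eq_iff)
    ultimately show ?thesis using ae_eq_subset[OF _ W_sub W.open_U Om.open_U] by simp
  qed
  have "L2_ip W (A_op \<Omega> \<alpha> z) (A_op \<Omega> \<alpha> z) = L2_ip W (comb (1 / s\<^sup>2) \<epsilon> 0 \<epsilon>) (comb (1 / s\<^sup>2) \<epsilon> 0 \<epsilon>)"
    by (rule L2_cong_ae[OF A_op_L2(2)[OF zD] L2_comb[OF epsL epsL] A_op_L2(2)[OF zD] L2_comb[OF epsL epsL] 2 2])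
  also have "\<dots> = (1 / s\<^sup>2)\<^sup>2 * L2_ip W \<epsilon> \<epsilon>" by (simp add: L2.comb_square[OF epsL epsL])
  finally have "s\<^sup>2 * L2_ip W (A_op \<Omega> \<alpha> z) (A_op \<Omega> \<alpha> z) = L2_ip W \<epsilon> \<epsilon> / s\<^sup>2"
    using s by (simp add: power2_eq_square field_simps)
  then have "loss \<Omega> M \<alpha> f s (w0, hat zw) = L2_dist2 W e0 z + s\<^sup>2 * L2_ip W (A_op \<Omega> \<alpha> z) (A_op \<Omega> \<alpha> z)"
    unfolding eps(3) 1 by (simp add: Y_ip_eq[OF eps(1,1)])
  then show "\<exists>z\<in>Z. loss \<Omega> M \<alpha> f s (w0, hat zw)
      = L2_dist2 \<Omega> e0 z + s\<^sup>2 * L2_ip \<Omega> (A_op \<Omega> \<alpha> z) (A_op \<Omega> \<alpha> z)"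
    using zZ conv[OF zZ] by auto
qed

text \<open>
  All bounds compare with the least squares form of the loss.  The lower bound takes the optimal \<open>z\<close> and
  the upper bound takes \<open>z = E\<close>, each with Young's inequality and the stability estimate; the identity with
  the \<open>K\<close>-functional is Pythagoras for \<open>z = E + k\<close>; and \<open>z = 0\<close> is admissible if there is no interface error.
\<close>

lemma loss_properties:
  assumes exact: "exact_dpg_solution \<Omega> M \<alpha> f (u0, uhat)" and f: "f \<in> L2 \<Omega>"
    and stab: "stability_constant \<Omega> \<alpha> c" and s: "0 < s" and w0: "w0 \<in> L2 \<Omega>" and what: "what \<in> Xhat \<Omega> M"
  defines "E \<equiv> E_ext \<Omega> M \<alpha> (hat_diff M uhat what)"
  defines "N \<equiv> (L2_norm \<Omega> (u0 - w0))\<^sup>2 + s\<^sup>2 * (L2_norm \<Omega> (A_op \<Omega> \<alpha> E))\<^sup>2"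
  shows "N \<le> (1 + kconst c s) * loss \<Omega> M \<alpha> f s (w0, what)"
    and "loss \<Omega> M \<alpha> f s (w0, what) \<le> (1 + kconst c s) * N"
    and "loss \<Omega> M \<alpha> f s (w0, what) = s\<^sup>2 * (L2_norm \<Omega> (A_op \<Omega> \<alpha> E))\<^sup>2 + K_fun \<Omega> M \<alpha> s ((u0 - w0) - E)"
    and "what = uhat \<Longrightarrow> loss \<Omega> M \<alpha> f s (w0, what) \<le> (L2_norm \<Omega> (u0 - w0))\<^sup>2"
proof -
  have X: "u0 \<in> L2 \<Omega>" "uhat \<in> Xhat \<Omega> M" using exact by (simp_all add: exact_dpg_solution_def X_dpg_def)
  obtain zu where zu: "zu \<in> Hdiv_H10 \<Omega>" "uhat = hat zu" using Xhat_obtain[OF X(2)] .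
  obtain zw where zw: "zw \<in> Hdiv_H10 \<Omega>" "what = hat zw" using Xhat_obtain[OF what] .
  define e where "e = comb 1 zu (-1) zw"
  have eD: "e \<in> Hdiv_H10 \<Omega>" unfolding e_def by (rule Dom_comb[OF zu(1) zw(1)])
  have hd: "hat_diff M uhat what = hat e" unfolding zu(2) zw(2) e_def by (rule hat_diff_eq[OF zu(1) zw(1)])
  define e0 where "e0 = comb 1 u0 (-1) w0"
  have e0: "e0 \<in> L2 \<Omega>" unfolding e0_def by (rule L2_comb[OF X(1) w0])
  define L where "L = loss \<Omega> M \<alpha> f s (w0, what)"
  define Z where "Z = Z_set \<Omega> M (hat e)"
  define n where "n z = L2_ip \<Omega> z z" for z :: "'d field"
  define A where "A z = n (A_op \<Omega> \<alpha> z)" for z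
  have n0: "0 \<le> n z" for z by (simp add: n_def L2_ip_nonneg)
  have norms: "(L2_norm \<Omega> z)\<^sup>2 = n z" for z :: "'d field" by (simp add: n_def L2_norm_power2)
  note ls = loss_least_squares[OF s exact[unfolded zu(2)] X(1) w0 zu(1) zw(1) f,
      folded zw(2) e0_def e_def, folded Z_def L_def n_def, folded A_def]
  have E: "E \<in> Z" "\<And>k. k \<in> Ker \<Longrightarrow> L2_ip \<Omega> (A_op \<Omega> \<alpha> E) (A_op \<Omega> \<alpha> k) = 0"
    using minimal_extension[OF stab eD] unfolding E_def hd Z_def by auto
  have ZD: "z \<in> Hdiv_H10 \<Omega>" if "z \<in> Z" for z using that by (simp add: Z_def Z_set_iff)
  have zL: "z \<in> L2 \<Omega>" if "z \<in> Z" for z using DomD(6)[OF ZD[OF that]] .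
  have st: "n z \<le> c\<^sup>2 * A z" if "z \<in> Z" for z
    using stability_ip[OF stab ZD[OF that]] by (simp add: n_def A_def)
  interpret D: semi_inner "Hdiv_H10 \<Omega>" "\<lambda>z z'. L2_ip \<Omega> (A_op \<Omega> \<alpha> z) (A_op \<Omega> \<alpha> z')" by (rule A_op_semi_inner)
  have pyth: "A (comb 1 E 1 k) = A E + A k" if k: "k \<in> Ker" for k
    using D.comb_square[OF ZD[OF E(1)] KerD[OF k], of 1 1] E(2)[OF k] by (simp add: A_def n_def)
  have EZk: "comb 1 E 1 k \<in> Z" if k: "k \<in> Ker" for k
  proof -
    have "comb 1 (comb 1 E 1 k) (-1) e = comb 1 (comb 1 E (-1) e) 1 k" by (simp add: comb_def fun_eq_iff)
    moreover have "comb 1 E (-1) e \<in> Ker" using E(1) unfolding Z_def Z_set_kernel_iff[OF eD] by blast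
    ultimately show ?thesis
      unfolding Z_def Z_set_kernel_iff[OF eD] using Ker_comb[OF _ k] Dom_comb[OF ZD[OF E(1)] KerD[OF k]] by simp
  qed
  have kZ: "comb 1 z (-1) E \<in> Ker" if z: "z \<in> Z" for z
  proof -
    have "hat E = hat e" using E(1) by (simp add: Z_def Z_set_iff)
    then have "z \<in> Z_set \<Omega> M (hat E)" using z by (simp add: Z_def)
    then show ?thesis using Z_set_kernel_iff[OF ZD[OF E(1)]] by blast
  qed
  have zE: "comb 1 E 1 (comb 1 z (-1) E) = z" for z by (simp add: comb_def fun_eq_iff)
  have AE: "A E \<le> A z" if z: "z \<in> Z" for z
    using pyth[OF kZ[OF z]] n0 unfolding zE by (simp add: A_def)
  have c: "0 < c" using stab by (simp add: stability_constant_def)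
  define k where "k = kconst c s"
  have k: "0 < k" "(1 + 1 / k) * c\<^sup>2 = k * s\<^sup>2" unfolding k_def using kconst_props[OF c s] by blast+
  have Young: "(1 + 1 / k) * n z \<le> k * (s\<^sup>2 * A z)" if "z \<in> Z" for z
  proof -
    have "(1 + 1 / k) * n z \<le> (1 + 1 / k) * (c\<^sup>2 * A z)" using k st[OF that] by (intro mult_left_mono) auto
    also have "\<dots> = (1 + 1 / k) * c\<^sup>2 * A z" by simp
    also have "\<dots> = k * (s\<^sup>2 * A z)" unfolding k(2) by simp
    finally show ?thesis .
  qed
  have N: "N = n e0 + s\<^sup>2 * A E" by (simp add: N_def norms e0_def diff_eq_comb A_def)
  show "N \<le> (1 + kconst c s) * loss \<Omega> M \<alpha> f s (w0, what)"
  proof -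
    obtain z where z: "z \<in> Z" "L = n (comb 1 e0 (-1) z) + s\<^sup>2 * A z" using ls(2) by blast
    have "e0 = comb 1 (comb 1 e0 (-1) z) 1 z" by (simp add: comb_def fun_eq_iff)
    then have "n e0 \<le> (1 + k) * n (comb 1 e0 (-1) z) + (1 + 1 / k) * n z"
      using Young_L2[OF L2_comb[OF e0 zL[OF z(1)]] zL[OF z(1)] k(1), of 1 1 "-1"] by (simp add: n_def)
    moreover have "s\<^sup>2 * A E \<le> s\<^sup>2 * A z" using AE[OF z(1)] by (intro mult_left_mono) auto
    moreover have "(1 + k) * L = (1 + k) * n (comb 1 e0 (-1) z) + s\<^sup>2 * A z + k * (s\<^sup>2 * A z)"
      unfolding z(2) by (simp add: algebra_simps)
    ultimately have "N \<le> (1 + k) * L" using Young[OF z(1)] unfolding N by linarith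
    then show ?thesis by (simp add: k_def L_def)
  qed
  show "loss \<Omega> M \<alpha> f s (w0, what) \<le> (1 + kconst c s) * N"
  proof -
    have "L \<le> n (comb 1 e0 (-1) E) + s\<^sup>2 * A E" by (rule ls(1)[OF E(1)])
    moreover have "n (comb 1 e0 (-1) E) \<le> (1 + k) * n e0 + (1 + 1 / k) * n E"
      using Young_L2[OF e0 zL[OF E(1)] k(1), of "-1"] by (simp add: n_def)
    moreover have "(1 + k) * N = (1 + k) * n e0 + s\<^sup>2 * A E + k * (s\<^sup>2 * A E)"
      unfolding N by (simp add: algebra_simps)
    ultimately have "L \<le> (1 + k) * N" using Young[OF E(1)] by linarith
    then show ?thesis by (simp add: k_def L_def)
  qed
  show "loss \<Omega> M \<alpha> f s (w0, what) = s\<^sup>2 * (L2_norm \<Omega> (A_op \<Omega> \<alpha> E))\<^sup>2 + K_fun \<Omega> M \<alpha> s ((u0 - w0) - E)"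
  proof -
    have sub: "comb 1 e0 (-1) (comb 1 E 1 k) = comb 1 (comb 1 e0 (-1) E) (-1) k" for k
      by (simp add: comb_def fun_eq_iff)
    have K: "K_fun \<Omega> M \<alpha> s ((u0 - w0) - E) = (INF k\<in>Ker. n (comb 1 (comb 1 e0 (-1) E) (-1) k) + s\<^sup>2 * A k)"
      by (simp add: K_fun_def norms A_def e0_def diff_eq_comb)
    have le: "L - s\<^sup>2 * A E \<le> n (comb 1 (comb 1 e0 (-1) E) (-1) k) + s\<^sup>2 * A k" if k: "k \<in> Ker" for k
      using ls(1)[OF EZk[OF k]] unfolding sub pyth[OF k] by (simp add: distrib_left)
    obtain z where z: "z \<in> Z" "L = n (comb 1 e0 (-1) z) + s\<^sup>2 * A z" using ls(2) by blast
    let ?k = "comb 1 z (-1) E"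
    have eq: "n (comb 1 (comb 1 e0 (-1) E) (-1) ?k) + s\<^sup>2 * A ?k = L - s\<^sup>2 * A E"
      using pyth[OF kZ[OF z(1)]] sub[of ?k] z(2) unfolding zE by (simp add: algebra_simps)
    have "(INF k\<in>Ker. n (comb 1 (comb 1 e0 (-1) E) (-1) k) + s\<^sup>2 * A k) = L - s\<^sup>2 * A E"
    proof (rule antisym)
      have "bdd_below ((\<lambda>k. n (comb 1 (comb 1 e0 (-1) E) (-1) k) + s\<^sup>2 * A k) ` Ker)"
        using le by (intro bdd_belowI2) auto
      then have "(INF k\<in>Ker. n (comb 1 (comb 1 e0 (-1) E) (-1) k) + s\<^sup>2 * A k)
          \<le> n (comb 1 (comb 1 e0 (-1) E) (-1) ?k) + s\<^sup>2 * A ?k"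
        by (rule cINF_lower[OF _ kZ[OF z(1)]])
      then show "(INF k\<in>Ker. n (comb 1 (comb 1 e0 (-1) E) (-1) k) + s\<^sup>2 * A k) \<le> L - s\<^sup>2 * A E"
        unfolding eq .
      show "L - s\<^sup>2 * A E \<le> (INF k\<in>Ker. n (comb 1 (comb 1 e0 (-1) E) (-1) k) + s\<^sup>2 * A k)"
        using zero_Ker le by (intro cINF_greatest) auto
    qed
    then show ?thesis unfolding K by (simp add: L_def norms A_def)
  qed
  show "loss \<Omega> M \<alpha> f s (w0, what) \<le> (L2_norm \<Omega> (u0 - w0))\<^sup>2" if "what = uhat"
  proof -
    have eK: "e \<in> Ker"
    proof -
      have "hat zu = hat zw" using that zu(2) zw(2) by simp
      then show ?thesis using hat_eq_iff[OF zu(1) zw(1)] eD by (simp add: kernel_iff e_def)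
    qed
    have e': "comb (-1) e 0 e \<in> Ker" by (rule Ker_comb[OF eK eK])
    have "comb 1 (\<lambda>x. 0) (-1) e = comb (-1) e 0 e" by (simp add: comb_def fun_eq_iff)
    then have "(\<lambda>x. 0) \<in> Z" unfolding Z_def Z_set_kernel_iff[OF eD] using e' zero_Dom by simp
    from ls(1)[OF this] have "L \<le> n (comb 1 e0 (-1) (\<lambda>x. 0)) + s\<^sup>2 * A (\<lambda>x. 0)" .
    moreover have "comb 1 e0 (-1) (\<lambda>x. 0) = e0" by (simp add: comb_def)
    moreover have "A (\<lambda>x. 0) = 0"
      using D.comb_square[OF zero_Dom zero_Dom, of 0 0] by (simp add: A_def n_def comb_def)
    ultimately show ?thesis by (simp add: L_def norms e0_def diff_eq_comb)
  qed
qed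

end

section \<open>The two-parameter functionals\<close>

lemma two_parameter_perturbation:
  fixes a b d k l :: real
  assumes k: "0 \<le> k" and l: "0 \<le> l" and d: "0 < d" and ab: "0 \<le> b" "b \<le> a"
  shows "\<bar>(inverse (1 + k) * a - (1 + l) * b) / d - (a - b) / d\<bar> \<le> (k + l) * (a / d)"
    and "\<bar>((1 + k) * a - inverse (1 + l) * b) / d - (a - b) / d\<bar> \<le> (k + l) * (a / d)"
proof -
  have inv: "0 \<le> 1 - inverse (1 + t)" "1 - inverse (1 + t) \<le> t" if "0 \<le> t" for t :: real
    using that by (auto simp: field_simps)
  have a: "0 \<le> a" using ab by simp
  have la: "l * b \<le> l * a" using l ab by (intro mult_left_mono) auto
  have "\<bar>(1 - inverse (1 + k)) * a + l * b\<bar> \<le> k * a + l * a"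
    using mult_right_mono[OF inv(2)[OF k] a] mult_nonneg_nonneg[OF inv(1)[OF k] a] mult_nonneg_nonneg[OF l ab(1)] la
    by linarith
  then have "\<bar>(1 - inverse (1 + k)) * a + l * b\<bar> / d \<le> (k * a + l * a) / d" using d by (intro divide_right_mono) auto
  moreover have "(inverse (1 + k) * a - (1 + l) * b) / d - (a - b) / d = - (((1 - inverse (1 + k)) * a + l * b) / d)"
    by (simp add: diff_divide_distrib[symmetric] algebra_simps minus_divide_left)
  ultimately show "\<bar>(inverse (1 + k) * a - (1 + l) * b) / d - (a - b) / d\<bar> \<le> (k + l) * (a / d)"
    using d by (simp add: abs_divide distrib_right)
  have lb: "(1 - inverse (1 + l)) * b \<le> l * a"
    using mult_mono[OF inv(2)[OF l] ab(2) l ab(1)] .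
  have "\<bar>k * a + (1 - inverse (1 + l)) * b\<bar> \<le> k * a + l * a"
    using mult_nonneg_nonneg[OF k a] mult_nonneg_nonneg[OF inv(1)[OF l] ab(1)] lb by linarith
  then have "\<bar>k * a + (1 - inverse (1 + l)) * b\<bar> / d \<le> (k * a + l * a) / d" using d by (intro divide_right_mono) auto
  moreover have "((1 + k) * a - inverse (1 + l) * b) / d - (a - b) / d = (k * a + (1 - inverse (1 + l)) * b) / d"
    by (simp add: diff_divide_distrib[symmetric] algebra_simps)
  ultimately show "\<bar>((1 + k) * a - inverse (1 + l) * b) / d - (a - b) / d\<bar> \<le> (k + l) * (a / d)"
    using d by (simp add: abs_divide distrib_right)
qed

text \<open>
  The perturbed weights differ from one by at most \<open>kconst c t1\<close> and \<open>kconst c t2\<close>, and monotonicity of the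
  loss bounds the subtracted term by the leading one.
\<close>

lemma loss2_perturbation:
  assumes c: "0 < c" and t: "0 < t1" "t1 < t2"
    and mono: "t1\<^sup>2 * loss \<Omega> M \<beta> f t2 w \<le> t2\<^sup>2 * loss \<Omega> M \<beta> f t1 w"
  shows "\<bar>loss2_L \<Omega> M \<beta> c f t1 t2 w - loss2 \<Omega> M \<beta> f t1 t2 w\<bar> \<le> 2 * kconst c t1 * loss2_scale \<Omega> M \<beta> f t1 t2 w"
    and "\<bar>loss2_R \<Omega> M \<beta> c f t1 t2 w - loss2 \<Omega> M \<beta> f t1 t2 w\<bar> \<le> 2 * kconst c t1 * loss2_scale \<Omega> M \<beta> f t1 t2 w"
    and "0 \<le> loss2_scale \<Omega> M \<beta> f t1 t2 w"
proof -
  have d: "0 < t2\<^sup>2 - t1\<^sup>2" using t by (simp add: power_strict_mono)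
  have k: "0 \<le> kconst c t1" "0 \<le> kconst c t2" "kconst c t1 + kconst c t2 \<le> 2 * kconst c t1"
    using kconst_props(1)[OF c, of t1] kconst_props(1)[OF c, of t2] kconst_antimono[OF c t] t by auto
  have b: "0 \<le> t1\<^sup>2 * loss \<Omega> M \<beta> f t2 w" by (simp add: loss_def)
  show sc: "0 \<le> loss2_scale \<Omega> M \<beta> f t1 t2 w" unfolding loss2_scale_def using d by (simp add: loss_def)
  have "(kconst c t1 + kconst c t2) * loss2_scale \<Omega> M \<beta> f t1 t2 w \<le> 2 * kconst c t1 * loss2_scale \<Omega> M \<beta> f t1 t2 w"
    by (rule mult_right_mono[OF k(3) sc])
  then show "\<bar>loss2_L \<Omega> M \<beta> c f t1 t2 w - loss2 \<Omega> M \<beta> f t1 t2 w\<bar> \<le> 2 * kconst c t1 * loss2_scale \<Omega> M \<beta> f t1 t2 w"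
    and "\<bar>loss2_R \<Omega> M \<beta> c f t1 t2 w - loss2 \<Omega> M \<beta> f t1 t2 w\<bar> \<le> 2 * kconst c t1 * loss2_scale \<Omega> M \<beta> f t1 t2 w"
    using two_parameter_perturbation[OF k(1,2) d b mono]
    unfolding loss2_L_def loss2_R_def loss2_def loss2_scale_def mult.assoc by linarith+
qed

section \<open>Simplicial meshes and piecewise constant parameters\<close>

text \<open>
  If two open elements meet, the intersection of their closures is a face of both that meets the interior, so
  the closures coincide.  The part of \<open>\<Omega>\<close> not covered lies in boundaries of convex sets.
\<close>

lemma mesh_conforming:
  fixes \<Omega> :: "(real ^ 'd) set"
  assumes dom: "lipschitz_domain \<Omega>" and cm: "conforming_mesh \<Omega> M"
  shows "mesh \<Omega> M"
proof (rule mesh.intro)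
  show "bounded_open \<Omega>" using dom by unfold_locales (auto simp: lipschitz_domain_def)
  show "finite M" using cm by (simp add: conforming_mesh_def)
  have int: "K = interior (closure K)" and sim: "int CARD('d) simplex closure K" if "K \<in> M" for K
    using cm that unfolding conforming_mesh_def by blast+
  show "K \<subseteq> \<Omega>" if "K \<in> M" for K using cm that unfolding conforming_mesh_def by blast
  show "open K" if "K \<in> M" for K using int[OF that] open_interior by metis
  show "K = K'" if K: "K \<in> M" "K' \<in> M" and x: "x \<in> K" "x \<in> K'" for K K' x
  proof -
    have face: "(closure K \<inter> closure K') face_of closure K" "(closure K' \<inter> closure K) face_of closure K'"
      using cm K unfolding conforming_mesh_def triangulation_def by blast+
    have xi: "x \<in> closure K \<inter> closure K'" "x \<in> interior (closure K)" "x \<in> interior (closure K')"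
      using x int[OF K(1)] int[OF K(2)] closure_subset by auto
    have "closure K \<inter> closure K' = closure K" "closure K' \<inter> closure K = closure K'"
      using face_of_disjoint_interior[OF face(1)] face_of_disjoint_interior[OF face(2)] xi by blast+
    then have "closure K = closure K'" by blast
    then have "interior (closure K) = interior (closure K')" by (rule arg_cong)
    then show ?thesis unfolding int[OF K(1), symmetric] int[OF K(2), symmetric] .
  qed
  have "\<Omega> - \<Union>M \<subseteq> (\<Union>K\<in>M. frontier (closure K))"
  proof
    fix x assume x: "x \<in> \<Omega> - \<Union>M"
    have "x \<in> closure \<Omega>" using x closure_subset[of \<Omega>] by blast
    also have "closure \<Omega> = (\<Union>K\<in>M. closure K)" using cm by (simp add: conforming_mesh_def)
    finally have "x \<in> (\<Union>K\<in>M. closure K)" .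
    then obtain K where K: "K \<in> M" "x \<in> closure K" by blast
    have "x \<notin> interior (closure K)" unfolding int[OF K(1), symmetric] using x K(1) by blast
    then have "x \<in> frontier (closure K)" using K(2) by (simp add: frontier_def)
    then show "x \<in> (\<Union>K\<in>M. frontier (closure K))" using K(1) by blast
  qed
  moreover have "negligible (\<Union>K\<in>M. frontier (closure K))"
    using cm sim by (intro negligible_Union) (auto simp: conforming_mesh_def intro!: negligible_convex_frontier convex_simplex)
  ultimately show "negligible (\<Omega> - \<Union>M)" using negligible_subset by blast
qed

lemma params_bounded_measurable:
  assumes sub: "subdivision \<Omega> m Sub" and a: "\<alpha> \<in> params m Sub"
  obtains C where "\<alpha> \<in> borel_measurable borel" "\<And>x. \<bar>\<alpha> x\<bar> \<le> C"
proof -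
  obtain a0 a where al: "\<alpha> = (\<lambda>x. a0 + (\<Sum>i = 1..m. a i * indicator (Sub i) x))"
    using a by (auto simp: params_def)
  have op: "open (Sub i)" if i: "i \<in> {1..m}" for i
    using sub i unfolding subdivision_def by blast
  have meas: "\<alpha> \<in> borel_measurable borel"
    unfolding al
    by (intro borel_measurable_add borel_measurable_const borel_measurable_sum borel_measurable_times
        borel_measurable_indicator borel_open op)
  have bnd: "\<bar>\<alpha> x\<bar> \<le> \<bar>a0\<bar> + (\<Sum>i = 1..m. \<bar>a i\<bar>)" for x
  proof -
    have "\<bar>\<Sum>i = 1..m. a i * indicator (Sub i) x\<bar> \<le> (\<Sum>i = 1..m. \<bar>a i * indicator (Sub i) x\<bar>)" by (rule sum_abs)
    also have "\<dots> \<le> (\<Sum>i = 1..m. \<bar>a i\<bar>)" by (rule sum_mono) (simp add: indicator_def)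
    finally show ?thesis unfolding al by linarith
  qed
  show thesis by (rule that[OF meas bnd])
qed

section \<open>Error bounds for the DPG loss functionals\<close>

theorem theorem6p1:
  fixes \<Omega> :: "(real ^ 'd) set" and Sub :: "nat \<Rightarrow> (real ^ 'd) set" and m :: nat
    and M :: "(real ^ 'd) set set" and \<sigma> :: real
    and \<alpha> f :: "real ^ 'd \<Rightarrow> real" and c s s1 s2 :: real
    and u0 w0 :: "'d field" and uhat what :: "'d interface"
  assumes "lipschitz_domain \<Omega>" and "subdivision \<Omega> m Sub"
    and "conforming_mesh \<Omega> M" and "shape_regular \<sigma> M"
    and "f \<in> L2 \<Omega>"
    and "\<alpha> \<in> params m Sub" and "stability_constant \<Omega> \<alpha> c"
    and "0 < s" and "0 < s1" and "s1 < s2"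
    and "exact_dpg_solution \<Omega> M \<alpha> f (u0, uhat)"
    and "w0 \<in> L2 \<Omega>" and "what \<in> Xhat \<Omega> M"
  shows
    "(variationally_correct (X_dpg \<Omega> M)
       (\<lambda>w. dpg_norm \<Omega> M \<alpha> s (X_diff M (u0, uhat) w)) (loss \<Omega> M \<alpha> f s)) \<and>
     (inverse (1 + kconst c s) * (dpg_norm \<Omega> M \<alpha> s (X_diff M (u0, uhat) (w0, what)))\<^sup>2
       \<le> loss \<Omega> M \<alpha> f s (w0, what)) \<and>
     (loss \<Omega> M \<alpha> f s (w0, what)
       \<le> (1 + kconst c s) * (dpg_norm \<Omega> M \<alpha> s (X_diff M (u0, uhat) (w0, what)))\<^sup>2) \<and>
     (loss \<Omega> M \<alpha> f s (w0, what) =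
       s\<^sup>2 * (L2_norm \<Omega> (A_op \<Omega> \<alpha> (E_ext \<Omega> M \<alpha> (hat_diff M uhat what))))\<^sup>2
       + K_fun \<Omega> M \<alpha> s ((u0 - w0) - E_ext \<Omega> M \<alpha> (hat_diff M uhat what))) \<and>
     (0 \<le> loss2 \<Omega> M \<alpha> f s1 s2 (w0, what)) \<and>
     (loss2_L \<Omega> M \<alpha> c f s1 s2 (w0, what) \<le> (L2_norm \<Omega> (u0 - w0))\<^sup>2) \<and>
     ((L2_norm \<Omega> (u0 - w0))\<^sup>2 \<le> loss2_R \<Omega> M \<alpha> c f s1 s2 (w0, what)) \<and>
     (\<forall>e > 0. \<forall>\<^sub>F t1 in at_top. \<forall>t2 > t1.
       \<forall>\<beta> \<in> params m Sub. stability_constant \<Omega> \<beta> c \<longrightarrow> (\<forall>w \<in> X_dpg \<Omega> M.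
         \<bar>loss2_L \<Omega> M \<beta> c f t1 t2 w - loss2 \<Omega> M \<beta> f t1 t2 w\<bar> \<le> e * loss2_scale \<Omega> M \<beta> f t1 t2 w \<and>
         \<bar>loss2_R \<Omega> M \<beta> c f t1 t2 w - loss2 \<Omega> M \<beta> f t1 t2 w\<bar> \<le> e * loss2_scale \<Omega> M \<beta> f t1 t2 w)) \<and>
     (\<forall>t2 :: real \<Rightarrow> real. (\<forall>\<^sub>F t1 in at_top. t1 < t2 t1) \<longrightarrow>
       filterlim (\<lambda>t1. t1 * (1 - (t1 / t2 t1)\<^sup>2)) at_top at_top \<longrightarrow>
       ((\<lambda>t1. loss2_L \<Omega> M \<alpha> c f t1 (t2 t1) (w0, uhat) - loss2 \<Omega> M \<alpha> f t1 (t2 t1) (w0, uhat)) \<longlongrightarrow> 0) at_top \<and>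
       ((\<lambda>t1. loss2_R \<Omega> M \<alpha> c f t1 (t2 t1) (w0, uhat) - loss2 \<Omega> M \<alpha> f t1 (t2 t1) (w0, uhat)) \<longlongrightarrow> 0) at_top)"
proof -
  interpret mesh \<Omega> M using assms(1,3) by (rule mesh_conforming)
  have dpg: "\<exists>C. dpg \<Omega> M \<beta> C" if b: "\<beta> \<in> params m Sub" for \<beta>
  proof -
    obtain C where "\<beta> \<in> borel_measurable borel" "\<And>x. \<bar>\<beta> x\<bar> \<le> C"
      using params_bounded_measurable[OF assms(2) b] by blast
    then show ?thesis using mesh_axioms by (intro exI[of _ C] dpg.intro dpg_axioms.intro)
  qed
  obtain C where "dpg \<Omega> M \<alpha> C" using dpg[OF assms(6)] by blast
  then interpret dpg \<Omega> M \<alpha> C .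
  have c: "0 < c" using assms(7) by (simp add: stability_constant_def)
  have X: "(u0, uhat) \<in> X_dpg \<Omega> M" "uhat \<in> Xhat \<Omega> M"
    using assms(11) by (simp_all add: exact_dpg_solution_def X_dpg_def)
  have norm: "(dpg_norm \<Omega> M \<alpha> r (X_diff M (u0, uhat) (v0, vhat)))\<^sup>2 = (L2_norm \<Omega> (u0 - v0))\<^sup>2
      + r\<^sup>2 * (L2_norm \<Omega> (A_op \<Omega> \<alpha> (E_ext \<Omega> M \<alpha> (hat_diff M uhat vhat))))\<^sup>2" for r v0 vhat
    by (simp add: dpg_norm_def X_diff_def)
  note props = loss_properties[OF assms(11,5,7)]
  have kpos: "0 < kconst c r" if "0 < r" for r using kconst_props(1)[OF c that] .
  have lower: "inverse (1 + kconst c r) * (dpg_norm \<Omega> M \<alpha> r (X_diff M (u0, uhat) (v0, vhat)))\<^sup>2 \<le> loss \<Omega> M \<alpha> f r (v0, vhat)"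
    and upper: "loss \<Omega> M \<alpha> f r (v0, vhat) \<le> (1 + kconst c r) * (dpg_norm \<Omega> M \<alpha> r (X_diff M (u0, uhat) (v0, vhat)))\<^sup>2"
    if v: "v0 \<in> L2 \<Omega>" "vhat \<in> Xhat \<Omega> M" and r: "0 < r" for r v0 vhat
    using props(1,2)[OF r v] kpos[OF r] unfolding norm by (simp_all add: field_simps)
  have item1: "variationally_correct (X_dpg \<Omega> M) (\<lambda>w. dpg_norm \<Omega> M \<alpha> s (X_diff M (u0, uhat) w)) (loss \<Omega> M \<alpha> f s)"
    unfolding variationally_correct_def
  proof (intro exI conjI ballI)
    show "0 < inverse (1 + kconst c s)" "0 < 1 + kconst c s" using kpos[OF assms(8)] by simp_all
    fix w assume "w \<in> X_dpg \<Omega> M"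
    then obtain v0 vhat where w: "w = (v0, vhat)" "v0 \<in> L2 \<Omega>" "vhat \<in> Xhat \<Omega> M" by (auto simp: X_dpg_def)
    show "inverse (1 + kconst c s) * (dpg_norm \<Omega> M \<alpha> s (X_diff M (u0, uhat) w))\<^sup>2 \<le> loss \<Omega> M \<alpha> f s w"
      "loss \<Omega> M \<alpha> f s w \<le> (1 + kconst c s) * (dpg_norm \<Omega> M \<alpha> s (X_diff M (u0, uhat) w))\<^sup>2"
      unfolding w(1) using lower[OF w(2,3) assms(8)] upper[OF w(2,3) assms(8)] .
  qed
  have s2: "0 < s2" using assms(9,10) by simp
  have d: "0 < s2\<^sup>2 - s1\<^sup>2" using assms(9,10) by (simp add: power_strict_mono)
  have wX: "(w0, what) \<in> X_dpg \<Omega> M" using assms(12,13) by (simp add: X_dpg_def)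
  have item3: "0 \<le> loss2 \<Omega> M \<alpha> f s1 s2 (w0, what)"
    unfolding loss2_def using d loss_monotone_X[OF assms(5) wX assms(9,10)] by simp
  define n where "n = (L2_norm \<Omega> (u0 - w0))\<^sup>2"
  define a where "a = (L2_norm \<Omega> (A_op \<Omega> \<alpha> (E_ext \<Omega> M \<alpha> (hat_diff M uhat what))))\<^sup>2"
  define l1 where "l1 = loss \<Omega> M \<alpha> f s1 (w0, what)"
  define l2 where "l2 = loss \<Omega> M \<alpha> f s2 (w0, what)"
  define k1 where "k1 = kconst c s1"
  define k2 where "k2 = kconst c s2"
  note b1 = props(1,2)[OF assms(9,12,13), folded n_def a_def l1_def k1_def]
    and b2 = props(1,2)[OF s2 assms(12,13), folded n_def a_def l2_def k2_def]
  have k: "0 < k1" "0 < k2" unfolding k1_def k2_def using kpos assms(9) s2 by blast+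
  have i1: "inverse (1 + k1) * l1 \<le> n + s1\<^sup>2 * a" and i2: "inverse (1 + k2) * l2 \<le> n + s2\<^sup>2 * a"
    using b1(2) b2(2) k by (simp_all add: field_simps)
  \<comment> \<open>this combination eliminates the interface error \<open>a\<close>\<close>
  have comb: "s2\<^sup>2 * (n + s1\<^sup>2 * a) - s1\<^sup>2 * (n + s2\<^sup>2 * a) = (s2\<^sup>2 - s1\<^sup>2) * n" by (simp add: algebra_simps)
  have item4L: "loss2_L \<Omega> M \<alpha> c f s1 s2 (w0, what) \<le> n"
  proof -
    have "s2\<^sup>2 * (inverse (1 + k1) * l1) - s1\<^sup>2 * ((1 + k2) * l2) \<le> (s2\<^sup>2 - s1\<^sup>2) * n"
      unfolding comb[symmetric] by (intro diff_mono mult_left_mono i1 b2(1)) auto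
    then show ?thesis
      unfolding loss2_L_def l1_def[symmetric] l2_def[symmetric] k1_def[symmetric] k2_def[symmetric]
      using d by (simp add: divide_le_eq mult_ac)
  qed
  have item4R: "n \<le> loss2_R \<Omega> M \<alpha> c f s1 s2 (w0, what)"
  proof -
    have "(s2\<^sup>2 - s1\<^sup>2) * n \<le> s2\<^sup>2 * ((1 + k1) * l1) - s1\<^sup>2 * (inverse (1 + k2) * l2)"
      unfolding comb[symmetric] by (intro diff_mono mult_left_mono b1(1) i2) auto
    then show ?thesis
      unfolding loss2_R_def l1_def[symmetric] l2_def[symmetric] k1_def[symmetric] k2_def[symmetric]
      using d by (simp add: le_divide_eq mult_ac)
  qed
  have item5: "\<forall>e > 0. \<forall>\<^sub>F t1 in at_top. \<forall>t2 > t1.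
       \<forall>\<beta> \<in> params m Sub. stability_constant \<Omega> \<beta> c \<longrightarrow> (\<forall>w \<in> X_dpg \<Omega> M.
         \<bar>loss2_L \<Omega> M \<beta> c f t1 t2 w - loss2 \<Omega> M \<beta> f t1 t2 w\<bar> \<le> e * loss2_scale \<Omega> M \<beta> f t1 t2 w \<and>
         \<bar>loss2_R \<Omega> M \<beta> c f t1 t2 w - loss2 \<Omega> M \<beta> f t1 t2 w\<bar> \<le> e * loss2_scale \<Omega> M \<beta> f t1 t2 w)"
  proof (intro allI impI)
    fix e :: real assume e: "0 < e"
    have "\<forall>\<^sub>F t1 in at_top. kconst c t1 < e / 2"
      by (rule order_tendstoD(2)[OF kconst_tendsto_0[OF c]]) (use e in simp)
    with eventually_gt_at_top[of "0::real"]
    show "\<forall>\<^sub>F t1 in at_top. \<forall>t2 > t1. \<forall>\<beta> \<in> params m Sub. stability_constant \<Omega> \<beta> c \<longrightarrow> (\<forall>w \<in> X_dpg \<Omega> M.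
         \<bar>loss2_L \<Omega> M \<beta> c f t1 t2 w - loss2 \<Omega> M \<beta> f t1 t2 w\<bar> \<le> e * loss2_scale \<Omega> M \<beta> f t1 t2 w \<and>
         \<bar>loss2_R \<Omega> M \<beta> c f t1 t2 w - loss2 \<Omega> M \<beta> f t1 t2 w\<bar> \<le> e * loss2_scale \<Omega> M \<beta> f t1 t2 w)"
    proof eventually_elim
      case (elim t1)
      show ?case
      proof (intro allI impI ballI)
        fix t2 \<beta> w assume t2: "t1 < t2" and \<beta>: "\<beta> \<in> params m Sub" and w: "w \<in> X_dpg \<Omega> M"
        obtain C' where "dpg \<Omega> M \<beta> C'" using dpg[OF \<beta>] by blast
        then have mono: "t1\<^sup>2 * loss \<Omega> M \<beta> f t2 w \<le> t2\<^sup>2 * loss \<Omega> M \<beta> f t1 w"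
          using assms(5) w elim(1) t2 by (rule dpg.loss_monotone_X)
        note P = loss2_perturbation[OF c elim(1) t2 mono]
        have "2 * kconst c t1 * loss2_scale \<Omega> M \<beta> f t1 t2 w \<le> e * loss2_scale \<Omega> M \<beta> f t1 t2 w"
          using elim(2) by (intro mult_right_mono[OF _ P(3)]) simp
        then show "\<bar>loss2_L \<Omega> M \<beta> c f t1 t2 w - loss2 \<Omega> M \<beta> f t1 t2 w\<bar> \<le> e * loss2_scale \<Omega> M \<beta> f t1 t2 w \<and>
         \<bar>loss2_R \<Omega> M \<beta> c f t1 t2 w - loss2 \<Omega> M \<beta> f t1 t2 w\<bar> \<le> e * loss2_scale \<Omega> M \<beta> f t1 t2 w"
          using P(1,2) by linarith
      qed
    qed
  qed
  have item6: "((\<lambda>t1. loss2_L \<Omega> M \<alpha> c f t1 (t2 t1) (w0, uhat) - loss2 \<Omega> M \<alpha> f t1 (t2 t1) (w0, uhat)) \<longlongrightarrow> 0) at_top \<and>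
       ((\<lambda>t1. loss2_R \<Omega> M \<alpha> c f t1 (t2 t1) (w0, uhat) - loss2 \<Omega> M \<alpha> f t1 (t2 t1) (w0, uhat)) \<longlongrightarrow> 0) at_top"
    if ev: "\<forall>\<^sub>F t1 in at_top. t1 < t2 t1" and lim: "filterlim (\<lambda>t1. t1 * (1 - (t1 / t2 t1)\<^sup>2)) at_top at_top"
    for t2 :: "real \<Rightarrow> real"
  proof -
    let ?L = "\<lambda>t. loss2_L \<Omega> M \<alpha> c f t (t2 t) (w0, uhat) - loss2 \<Omega> M \<alpha> f t (t2 t) (w0, uhat)"
    let ?R = "\<lambda>t. loss2_R \<Omega> M \<alpha> c f t (t2 t) (w0, uhat) - loss2 \<Omega> M \<alpha> f t (t2 t) (w0, uhat)"
    let ?b = "\<lambda>t. 4 * c * n / (t * (1 - (t / t2 t)\<^sup>2))"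
    have n0: "0 \<le> n" by (simp add: n_def)
    \<comment> \<open>without interface error the loss is at most \<open>n\<close>, and \<open>kconst c t \<le> 2 * c / t\<close> once \<open>t \<ge> c\<close>\<close>
    have bound: "\<forall>\<^sub>F t in at_top. norm (?L t) \<le> ?b t \<and> norm (?R t) \<le> ?b t"
      using ev eventually_gt_at_top[of c]
    proof eventually_elim
      case (elim t)
      have t: "0 < t" and T: "0 < t2 t" using elim c by simp_all
      have uX: "(w0, uhat) \<in> X_dpg \<Omega> M" using assms(12) X(2) by (simp add: X_dpg_def)
      note P = loss2_perturbation[OF c t elim(1) loss_monotone_X[OF assms(5) uX t elim(1)]]
      have ln: "loss \<Omega> M \<alpha> f t (w0, uhat) \<le> n" using props(4)[OF t assms(12) X(2)] by (simp add: n_def)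
      have kb: "kconst c t \<le> 2 * c / t"
      proof -
        have "c\<^sup>2 / t\<^sup>2 = (c / t) * (c / t)" by (simp add: power2_eq_square)
        also have "\<dots> \<le> 1 * (c / t)" using elim(2) c t by (intro mult_right_mono) auto
        finally show ?thesis using kconst_props(3)[OF c t] by simp
      qed
      have q: "0 < 1 - (t / t2 t)\<^sup>2" using elim(1) t T by (simp add: power_less_one_iff power_divide[symmetric] abs_square_less_1)
      have sc: "loss2_scale \<Omega> M \<alpha> f t (t2 t) (w0, uhat) \<le> n / (1 - (t / t2 t)\<^sup>2)"
      proof -
        have "loss2_scale \<Omega> M \<alpha> f t (t2 t) (w0, uhat) = loss \<Omega> M \<alpha> f t (w0, uhat) / (1 - (t / t2 t)\<^sup>2)"
          unfolding loss2_scale_def using T q by (simp add: power_divide field_simps)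
        also have "\<dots> \<le> n / (1 - (t / t2 t)\<^sup>2)" using ln q by (intro divide_right_mono) auto
        finally show ?thesis .
      qed
      have "2 * kconst c t * loss2_scale \<Omega> M \<alpha> f t (t2 t) (w0, uhat) \<le> 2 * (2 * c / t) * (n / (1 - (t / t2 t)\<^sup>2))"
        using kb sc P(3) c t kpos[OF t] by (intro mult_mono) auto
      also have "\<dots> = ?b t" by simp
      finally show ?case using P(1,2) by auto
    qed
    have b0: "(?b \<longlongrightarrow> 0) at_top" by (rule real_tendsto_divide_at_top[OF tendsto_const lim])
    have "(?L \<longlongrightarrow> 0) at_top" "(?R \<longlongrightarrow> 0) at_top"
      by (rule Lim_null_comparison[OF eventually_mono[OF bound] b0]; simp)+
    then show ?thesis by blast
  qed
  show ?thesis
    using item1 lower[OF assms(12,13,8)] upper[OF assms(12,13,8)] props(3)[OF assms(8,12,13)] item3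
      item4L[unfolded n_def] item4R[unfolded n_def] item5 item6
    by blast
qed

end
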